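(* Let $\mathbb{A}$ be a finite idempotent algebra that omits type $\mathbf{1}$. Then for every subalgebra $\mathbb{B}$ of $\mathbb{A}$ the graph $\mathcal{G}(\mathbb{B})$ is connected.
   Context: Types are in the sense of tame congruence theory. For an algebra $\mathbb{B}$ and $a,b\in\mathbb{B}$, $\mathrm{Sg}(a,b)$ denotes the subalgebra generated by $\{a,b\}$; for a congruence $\theta$, $a^\theta$ is the $\theta$-block of $a$ and $t/\theta$ is the operation induced by a term operation $t$ on the factor algebra. The graph $\mathcal{G}(\mathbb{B})$ has vertex set the universe of $\mathbb{B}$; a pair $ab$ of vertices is an (undirected) edge if there exist a congruence $\theta$ of $\mathrm{Sg}(a,b)$ and a term operation $t$ of $\mathbb{B}$ such that one of the following holds: $t/\theta$ is a binary operation which is a semilattice operation on $\{a^\theta,b^\theta\}$ (i.e. $t/\theta(a^\theta,b^\theta)=t/\theta(b^\theta,a^\theta)\in\{a^\theta,b^\theta\}$); or $t/\theta$ is a ternary operation which is a majority operation on $\{a^\theta,b^\theta\}$ (i.e. $t/\theta(x,x,y)=t/\theta(x,y,x)=t/\theta(y,x,x)=x$ for all $x,y\in\{a^\theta,b^\theta\}$); or $t/\theta$ is an affine operation on $\mathrm{Sg}(a,b)/\theta$ (i.e. $t/\theta(x,y,z)=x-y+z$ for some abelian group structure on $\mathrm{Sg}(a,b)/\theta$).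
   Formalization: "Omits type 1" is taken to mean that no prime quotient of any subalgebra of A has type 1 (for A alone the claim fails: {0,1,2} with all idempotent operations that are projections on {0,1}); an edge ab also requires the blocks of a and b under θ to be distinct. *)

theory Defs
  imports "HOL-Algebra.Bij" "Graph_Theory.Digraph_Component"
begin

section \<open>Universal algebra\<close>

record ('f, 'a) ualg =
  univ :: "'a set"
  syms :: "'f set"
  arity :: "'f \<Rightarrow> nat"
  interp :: "'f \<Rightarrow> 'a list \<Rightarrow> 'a"

definition tuples :: "'a set \<Rightarrow> nat \<Rightarrow> 'a list set" where
  "tuples S n = {xs. set xs \<subseteq> S \<and> length xs = n}"

definition closed_under :: "('f, 'a) ualg \<Rightarrow> 'a set \<Rightarrow> bool" where
  "closed_under A S \<longleftrightarrow> (\<forall>f\<in>syms A. \<forall>xs\<in>tuples S (arity A f). interp A f xs \<in> S)"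

definition is_algebra :: "('f, 'a) ualg \<Rightarrow> bool" where
  "is_algebra A \<longleftrightarrow> univ A \<noteq> {} \<and> closed_under A (univ A)"

definition idempotent_algebra :: "('f, 'a) ualg \<Rightarrow> bool" where
  "idempotent_algebra A \<longleftrightarrow>
     (\<forall>f\<in>syms A. \<forall>x\<in>univ A. interp A f (replicate (arity A f) x) = x)"

definition subalgebra :: "('f, 'a) ualg \<Rightarrow> ('f, 'a) ualg \<Rightarrow> bool" where
  "subalgebra B A \<longleftrightarrow>
     (\<exists>S. S \<subseteq> univ A \<and> S \<noteq> {} \<and> closed_under A S \<and> B = A\<lparr>univ := S\<rparr>)"

definition Sg :: "('f, 'a) ualg \<Rightarrow> 'a \<Rightarrow> 'a \<Rightarrow> ('f, 'a) ualg" where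
  "Sg A a b = A\<lparr>univ := \<Inter>{S. S \<subseteq> univ A \<and> closed_under A S \<and> a \<in> S \<and> b \<in> S}\<rparr>"

text \<open>Operations of arity \<open>n\<close> are functions on lists of length \<open>n\<close>, made extensional
  (\<open>undefined\<close> off the tuples over the universe) so that equality of operations is
  equality of functions.\<close>

inductive_set term_ops :: "('f, 'a) ualg \<Rightarrow> nat \<Rightarrow> ('a list \<Rightarrow> 'a) set"
  for A :: "('f, 'a) ualg" and n :: nat where
  proj: "i < n \<Longrightarrow> (\<lambda>xs\<in>tuples (univ A) n. xs ! i) \<in> term_ops A n"
| comp: "f \<in> syms A \<Longrightarrow> length gs = arity A f \<Longrightarrow> \<forall>g\<in>set gs. g \<in> term_ops A n \<Longrightarrow>
    (\<lambda>xs\<in>tuples (univ A) n. interp A f (map (\<lambda>g. g xs) gs)) \<in> term_ops A n"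

definition pol_ops :: "('f, 'a) ualg \<Rightarrow> nat \<Rightarrow> ('a list \<Rightarrow> 'a) set" where
  "pol_ops A n =
     {\<lambda>xs\<in>tuples (univ A) n. t (xs @ cs) | t cs k.
        t \<in> term_ops A (n + k) \<and> cs \<in> tuples (univ A) k}"

definition congruence :: "('f, 'a) ualg \<Rightarrow> ('a \<times> 'a) set \<Rightarrow> bool" where
  "congruence A \<theta> \<longleftrightarrow> equiv (univ A) \<theta> \<and>
     (\<forall>f\<in>syms A. \<forall>xs\<in>tuples (univ A) (arity A f). \<forall>ys\<in>tuples (univ A) (arity A f).
        list_all2 (\<lambda>x y. (x, y) \<in> \<theta>) xs ys \<longrightarrow> (interp A f xs, interp A f ys) \<in> \<theta>)"

text \<open>\<open>op_mod \<theta> t\<close> is \<open>t/\<theta>\<close>. The union runs over all choices of representatives, which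
  all give the same block when \<open>\<theta>\<close> is a congruence.\<close>

definition op_mod :: "('a \<times> 'a) set \<Rightarrow> ('a list \<Rightarrow> 'a) \<Rightarrow> 'a set list \<Rightarrow> 'a set" where
  "op_mod \<theta> t Xs = (\<Union>xs\<in>listset Xs. \<theta> `` {t xs})"

definition factor_alg :: "('f, 'a) ualg \<Rightarrow> ('a \<times> 'a) set \<Rightarrow> ('f, 'a set) ualg" where
  "factor_alg A \<theta> = \<lparr>univ = univ A // \<theta>, syms = syms A, arity = arity A,
     interp = (\<lambda>f. op_mod \<theta> (interp A f))\<rparr>"


section \<open>Tame congruence theory: the unary type\<close>

text \<open>The definitions follow Hobby and McKenzie, \<^emph>\<open>The Structure of Finite Algebras\<close>.\<close>

definition prime_quotient ::
  "('f, 'a) ualg \<Rightarrow> ('a \<times> 'a) set \<Rightarrow> ('a \<times> 'a) set \<Rightarrow> bool" where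
  "prime_quotient A \<alpha> \<beta> \<longleftrightarrow> congruence A \<alpha> \<and> congruence A \<beta> \<and> \<alpha> \<subset> \<beta> \<and>
     \<not> (\<exists>\<gamma>. congruence A \<gamma> \<and> \<alpha> \<subset> \<gamma> \<and> \<gamma> \<subset> \<beta>)"

definition separating_images ::
  "('f, 'a) ualg \<Rightarrow> ('a \<times> 'a) set \<Rightarrow> ('a \<times> 'a) set \<Rightarrow> 'a set set" where
  "separating_images A \<alpha> \<beta> =
     {(\<lambda>x. p [x]) ` univ A | p. p \<in> pol_ops A 1 \<and> (\<exists>(x, y)\<in>\<beta>. (p [x], p [y]) \<notin> \<alpha>)}"

definition minimal_sets ::
  "('f, 'a) ualg \<Rightarrow> ('a \<times> 'a) set \<Rightarrow> ('a \<times> 'a) set \<Rightarrow> 'a set set" where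
  "minimal_sets A \<alpha> \<beta> = {U \<in> separating_images A \<alpha> \<beta>.
     \<forall>V\<in>separating_images A \<alpha> \<beta>. V \<subseteq> U \<longrightarrow> V = U}"

definition traces ::
  "('f, 'a) ualg \<Rightarrow> ('a \<times> 'a) set \<Rightarrow> ('a \<times> 'a) set \<Rightarrow> 'a set set" where
  "traces A \<alpha> \<beta> = {N. \<exists>U\<in>minimal_sets A \<alpha> \<beta>. \<exists>x\<in>U. N = U \<inter> \<beta> `` {x} \<and> \<not> N \<times> N \<subseteq> \<alpha>}"

text \<open>The induced algebra \<open>A|\<^sub>N\<close>: its basic operations are the restrictions to \<open>N\<close> of all
  polynomial operations of \<open>A\<close> that preserve \<open>N\<close>, each serving as its own symbol.\<close>

definition induced_alg ::
  "('f, 'a) ualg \<Rightarrow> 'a set \<Rightarrow> (nat \<times> ('a list \<Rightarrow> 'a), 'a) ualg" where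
  "induced_alg A N = \<lparr>univ = N,
     syms = {(n, p). p \<in> pol_ops A n \<and> p ` tuples N n \<subseteq> N}, arity = fst, interp = snd\<rparr>"

definition polynomially_equivalent :: "('f, 'a) ualg \<Rightarrow> ('g, 'a) ualg \<Rightarrow> bool" where
  "polynomially_equivalent A B \<longleftrightarrow> univ A = univ B \<and> (\<forall>n. pol_ops A n = pol_ops B n)"

definition perm_alg :: "'a set \<Rightarrow> ('a \<Rightarrow> 'a) set \<Rightarrow> ('a \<Rightarrow> 'a, 'a) ualg" where
  "perm_alg S P = \<lparr>univ = S, syms = P, arity = (\<lambda>_. 1), interp = (\<lambda>\<pi> xs. \<pi> (hd xs))\<rparr>"

definition unary_type :: "('f, 'a) ualg \<Rightarrow> bool" where
  "unary_type M \<longleftrightarrow>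
     (\<exists>P. subgroup P (BijGroup (univ M)) \<and> polynomially_equivalent M (perm_alg (univ M) P))"

text \<open>In a finite algebra every prime quotient has a trace, and all its traces give the same
  type, so here \<open>some trace\<close> and \<open>every trace\<close> amount to the same.\<close>

definition has_type_1 ::
  "('f, 'a) ualg \<Rightarrow> ('a \<times> 'a) set \<Rightarrow> ('a \<times> 'a) set \<Rightarrow> bool" where
  "has_type_1 A \<alpha> \<beta> \<longleftrightarrow>
     (\<exists>N\<in>traces A \<alpha> \<beta>. unary_type (factor_alg (induced_alg A N) (\<alpha> \<inter> N \<times> N)))"

text \<open>Omitting type 1 is understood hereditarily, that is, for all subalgebras. For a finite
  idempotent algebra this is equivalent to the variety it generates omitting type 1. Looking at
  the congruences of \<open>A\<close> alone would not do: take the algebra on \<open>{0, 1, 2}\<close> whose operations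
  are all idempotent ones that restrict to a projection on \<open>{0, 1}\<close>. It is simple of type 3, but
  in its subalgebra \<open>{0, 1}\<close> all operations are projections.\<close>

definition omits_type_1 :: "('f, 'a) ualg \<Rightarrow> bool" where
  "omits_type_1 A \<longleftrightarrow>
     (\<forall>B \<alpha> \<beta>. subalgebra B A \<longrightarrow> prime_quotient B \<alpha> \<beta> \<longrightarrow> \<not> has_type_1 B \<alpha> \<beta>)"


section \<open>The graph of an algebra\<close>

definition semilattice_on :: "('b list \<Rightarrow> 'b) \<Rightarrow> 'b \<Rightarrow> 'b \<Rightarrow> bool" where
  "semilattice_on f u v \<longleftrightarrow> f [u, v] = f [v, u] \<and> f [u, v] \<in> {u, v}"

definition majority_on :: "('b list \<Rightarrow> 'b) \<Rightarrow> 'b set \<Rightarrow> bool" where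
  "majority_on f S \<longleftrightarrow> (\<forall>x\<in>S. \<forall>y\<in>S. f [x, x, y] = x \<and> f [x, y, x] = x \<and> f [y, x, x] = x)"

definition affine_on :: "('b list \<Rightarrow> 'b) \<Rightarrow> 'b set \<Rightarrow> bool" where
  "affine_on f S \<longleftrightarrow> (\<exists>G :: 'b monoid. comm_group G \<and> carrier G = S \<and>
     (\<forall>x\<in>S. \<forall>y\<in>S. \<forall>z\<in>S. f [x, y, z] = x \<otimes>\<^bsub>G\<^esub> inv\<^bsub>G\<^esub> y \<otimes>\<^bsub>G\<^esub> z))"

text \<open>The blocks of \<open>a\<close> and \<open>b\<close> have to be distinct: for the full congruence any operation
  would be a semilattice operation on the single block, and every pair would be an edge.\<close>

definition is_edge :: "('f, 'a) ualg \<Rightarrow> 'a \<Rightarrow> 'a \<Rightarrow> bool" where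
  "is_edge B a b \<longleftrightarrow> a \<in> univ B \<and> b \<in> univ B \<and>
     (\<exists>\<theta>. congruence (Sg B a b) \<theta> \<and> \<theta> `` {a} \<noteq> \<theta> `` {b} \<and>
        ((\<exists>t\<in>term_ops B 2. semilattice_on (op_mod \<theta> t) (\<theta> `` {a}) (\<theta> `` {b})) \<or>
         (\<exists>t\<in>term_ops B 3. majority_on (op_mod \<theta> t) {\<theta> `` {a}, \<theta> `` {b}}) \<or>
         (\<exists>t\<in>term_ops B 3. affine_on (op_mod \<theta> t) (univ (Sg B a b) // \<theta>))))"

definition graph_of :: "('f, 'a) ualg \<Rightarrow> 'a pair_pre_digraph" where
  "graph_of B = \<lparr>pverts = univ B, parcs = {(a, b). is_edge B a b}\<rparr>"

end

theory Submission
  imports Defs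
begin

text \<open>
  Take a subalgebra \<open>B\<close> of least size whose graph is disconnected and a maximal congruence \<open>\<alpha>\<close>
  of \<open>B\<close>. Proper subuniverses of \<open>Q = B/\<alpha>\<close> lie in single components, so it suffices to find
  an edge of the simple algebra \<open>Q\<close> between two elements that are not in the same component.

  As \<open>\<alpha>\<close> is not of type 1, some polynomial of \<open>Q\<close> depends on two variables on a minimal set
  \<open>U\<close>, and by Palfy's argument either \<open>U\<close> has two elements and a polynomial meet
  operation, or \<open>U\<close> carries an abelian group structure for which all polynomials are affine.

  In the first case a copy \<open>{a, b}\<close> of \<open>U\<close> meets two components, so \<open>a\<close> and \<open>b\<close> generate
  \<open>Q\<close> and the meet has the form \<open>m (x, y, a, b)\<close> for a term \<open>m\<close>. A symmetric subuniverse
  of \<open>Q\<^sup>2\<close> containing \<open>(a, b)\<close> but neither \<open>(a, a)\<close> nor \<open>(b, b)\<close> is the graph of a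
  bijection, because its linkedness congruence cannot join components. If \<open>{a, b}\<close> is neither a
  semilattice nor a majority edge, this applies to the pairs \<open>(F (a, b), F (b, a))\<close> and to the
  pairs \<open>(F (a, a, b), F (b, a, a))\<close> with \<open>F (a, b, a) = a\<close>; feeding \<open>m\<close> into the latter
  gives a contradiction.

  In the second case every trace \<open>g ` U\<close> yields a term \<open>z + E (x - y)\<close>, where \<open>E\<close> is the
  linear part of a retraction onto the trace. Composing such terms produces a Mal'cev term, and
  \<open>Q\<close> is affine.
\<close>

section \<open>Generated subpowers, terms and polynomials\<close>

text \<open>Edges are witnessed by terms, whereas minimal sets only yield polynomials, whose
  constants are arbitrary elements. The two cases trade constants for terms in different ways. A
  pair outside every component generates \<open>Q\<close>, so the constants of a meet polynomial on
  it are themselves terms in that pair. In the affine case the constants are overwritten by a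
  variable: idempotence makes the new term fix the diagonal, and since a change of one argument has
  the same effect in every context, the linear part of the polynomial survives. Maximality of
  \<alpha> is used in several ways. The blocks of \<alpha> are proper subuniverses, hence inside
  single components, so the component relation descends to \<open>Q\<close>. Simplicity of
  \<open>Q\<close> makes any equivalence full that contains all polynomial images of one pair of
  distinct elements. A minimal set is its own trace, as the upper congruence is full. Finally,
  representatives of a pair outside all components generate \<open>B\<close>, so \<alpha> itself is
  the congruence that witnesses the edge.\<close>

text \<open>A function of type \<open>'d \<Rightarrow> 'a\<close> is an element of the power \<open>A\<close> to the \<open>'d\<close>, and
  \<open>gen A G\<close> is the subuniverse generated by \<open>G\<close>. Depending on \<open>'d\<close> and \<open>G\<close>, its elements are
  terms (over valuations of variables \<open>0, 1, 2, \<dots>\<close>) or polynomials in one, two or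
  infinitely many variables.\<close>

inductive_set gen :: "('f, 'a) ualg \<Rightarrow> ('d \<Rightarrow> 'a) set \<Rightarrow> ('d \<Rightarrow> 'a) set"
  for A :: "('f, 'a) ualg" and G :: "('d \<Rightarrow> 'a) set" where
  gen_base: "g \<in> G \<Longrightarrow> g \<in> gen A G"
| gen_app: "f \<in> syms A \<Longrightarrow> length gs = arity A f \<Longrightarrow> \<forall>g\<in>set gs. g \<in> gen A G \<Longrightarrow>
    (\<lambda>d. interp A f (map (\<lambda>g. g d) gs)) \<in> gen A G"

definition vals :: "'a set \<Rightarrow> ('i \<Rightarrow> 'a) set" where
  "vals S = {v. \<forall>i. v i \<in> S}"

definition Tm :: "('f, 'a) ualg \<Rightarrow> ((nat \<Rightarrow> 'a) \<Rightarrow> 'a) set" where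
  "Tm A = gen A (range (\<lambda>i v. v i))"

definition pols :: "('f, 'a) ualg \<Rightarrow> ('d \<Rightarrow> 'a) set \<Rightarrow> ('d \<Rightarrow> 'a) set" where
  "pols A G = gen A (G \<union> (\<lambda>c _. c) ` univ A)"

abbreviation Pol1 :: "('f, 'a) ualg \<Rightarrow> ('a \<Rightarrow> 'a) set" where
  "Pol1 A \<equiv> pols A {\<lambda>x. x}"

abbreviation Pol2 :: "('f, 'a) ualg \<Rightarrow> ('a \<times> 'a \<Rightarrow> 'a) set" where
  "Pol2 A \<equiv> pols A {fst, snd}"

abbreviation PolV :: "('f, 'a) ualg \<Rightarrow> ((nat \<Rightarrow> 'a) \<Rightarrow> 'a) set" where
  "PolV A \<equiv> pols A (range (\<lambda>i v. v i))"

lemma valsD: "v \<in> vals S \<Longrightarrow> v i \<in> S"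
  by (simp add: vals_def)

lemma vals_upd: "v \<in> vals S \<Longrightarrow> x \<in> S \<Longrightarrow> v(i := x) \<in> vals S"
  by (simp add: vals_def)

text \<open>Substitution reduces to the generators by induction. The composition rules for terms and
  polynomials are instances with a suitable \<rho>.\<close>

lemma gen_precomp:
  assumes "h \<in> gen A G" "\<And>g. g \<in> G \<Longrightarrow> (\<lambda>d. g (\<rho> d)) \<in> gen A G'"
  shows "(\<lambda>d. h (\<rho> d)) \<in> gen A G'"
  using assms(1)
proof induction
  case (gen_base g)
  then show ?case using assms(2) by simp
next
  case (gen_app f gs)
  have "(\<lambda>d. interp A f (map (\<lambda>g. g d) (map (\<lambda>g d. g (\<rho> d)) gs))) \<in> gen A G'"
    by (rule gen.gen_app) (use gen_app in auto)
  then show ?case by (simp add: comp_def)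
qed

lemma gen_mono: "G \<subseteq> G' \<Longrightarrow> gen A G \<subseteq> gen A G'"
proof
  fix h assume "G \<subseteq> G'" "h \<in> gen A G"
  then show "h \<in> gen A G'" 
    using gen_precomp[where \<rho> = "\<lambda>d. d" and h = h and G = G and G' = G' and A = A]
    by (auto intro: gen_base)
qed

lemma gen_closed:
  assumes "h \<in> gen A G" "closed_under A S" "\<And>g. g \<in> G \<Longrightarrow> g d \<in> S"
  shows "h d \<in> S"
  using assms(1)
proof induction
  case (gen_base g)
  then show ?case using assms by simp
next
  case (gen_app f gs)
  then have "map (\<lambda>g. g d) gs \<in> tuples S (arity A f)" by (auto simp: tuples_def)
  then show ?case using assms(2) gen_app(1) by (simp add: closed_under_def)
qed

text \<open>\<open>R\<close> is the only bound on the arguments, so that congruences and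
  subuniverses of the square are treated alike.\<close>

definition compat2 :: "('f, 'a) ualg \<Rightarrow> ('a \<times> 'a) set \<Rightarrow> bool" where
  "compat2 A R \<longleftrightarrow> (\<forall>f\<in>syms A. \<forall>xs ys. length xs = arity A f \<longrightarrow>
     list_all2 (\<lambda>x y. (x, y) \<in> R) xs ys \<longrightarrow> (interp A f xs, interp A f ys) \<in> R)"

lemma gen_compat2:
  assumes "h \<in> gen A G" "compat2 A R" "\<And>g. g \<in> G \<Longrightarrow> (g d, g d') \<in> R"
  shows "(h d, h d') \<in> R"
  using assms(1)
proof induction
  case (gen_base g)
  then show ?case using assms by simp
next
  case (gen_app f gs)
  then show ?case using assms(2) by (auto simp: compat2_def list_all2_conv_all_nth)
qed

text \<open>The family \<gamma> acts as a tuple of generators indexed by variables. This is the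
  passage from polynomials back to terms: list the variables and the constants in \<gamma>.\<close>

lemma gen_rep:
  assumes "h \<in> gen A (range \<gamma>)"
  obtains F where "F \<in> Tm A" "h = (\<lambda>d. F (\<lambda>i. \<gamma> i d))"
proof -
  have "\<exists>F\<in>Tm A. h = (\<lambda>d. F (\<lambda>i. \<gamma> i d))"
    using assms
  proof induction
    case (gen_base g)
    then obtain i where "g = \<gamma> i" by auto
    then show ?case unfolding Tm_def by (intro bexI[of _ "\<lambda>v. v i"]) (auto intro: gen.gen_base)
  next
    case (gen_app f gs)
    then obtain \<Phi> where \<Phi>: "\<And>g. g \<in> set gs \<Longrightarrow> \<Phi> g \<in> Tm A \<and> g = (\<lambda>d. \<Phi> g (\<lambda>i. \<gamma> i d))"
      by metis
    have 1: "(\<lambda>v. interp A f (map (\<lambda>g. g v) (map \<Phi> gs))) \<in> Tm A"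
      unfolding Tm_def by (rule gen.gen_app) (use gen_app \<Phi> in \<open>auto simp: Tm_def\<close>)
    have "map (\<lambda>g. g d) gs = map (\<lambda>g. g (\<lambda>i. \<gamma> i d)) (map \<Phi> gs)" for d
      using \<Phi> by (auto simp: fun_eq_iff)
    then show ?case by (intro bexI[OF _ 1] ext) (simp only:)
  qed
  then show ?thesis using that by blast
qed

lemma Tm_var: "(\<lambda>v. v i) \<in> Tm A"
  by (auto simp: Tm_def intro: gen_base)

lemma Tm_subst_gen:
  assumes "F \<in> Tm A" "\<And>i. \<gamma> i \<in> gen A G"
  shows "(\<lambda>d. F (\<lambda>i. \<gamma> i d)) \<in> gen A G"
  by (rule gen_precomp[where h = F and \<rho> = "\<lambda>d i. \<gamma> i d", OF assms(1)[unfolded Tm_def]]) (use assms(2) in auto)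

lemma Tm_subst: "F \<in> Tm A \<Longrightarrow> (\<And>i. \<gamma> i \<in> Tm A) \<Longrightarrow> (\<lambda>v. F (\<lambda>i. \<gamma> i v)) \<in> Tm A"
  using Tm_subst_gen[of F A \<gamma> "range (\<lambda>i v. v i)"] by (simp add: Tm_def)

lemma Tm_closed: "F \<in> Tm A \<Longrightarrow> closed_under A S \<Longrightarrow> v \<in> vals S \<Longrightarrow> F v \<in> S"
  unfolding Tm_def by (rule gen_closed[where h = F and d = v]) (auto simp: vals_def)

lemma pols_const: "c \<in> univ A \<Longrightarrow> (\<lambda>_. c) \<in> pols A G"
  by (auto simp: pols_def intro: gen_base)

lemma pols_base: "g \<in> G \<Longrightarrow> g \<in> pols A G"
  by (auto simp: pols_def intro: gen_base)

lemma pols_precomp: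
  assumes "h \<in> pols A G" "\<And>g. g \<in> G \<Longrightarrow> (\<lambda>d. g (\<rho> d)) \<in> pols A G'"
  shows "(\<lambda>d. h (\<rho> d)) \<in> pols A G'"
proof -
  have "(\<lambda>d. g (\<rho> d)) \<in> gen A (G' \<union> (\<lambda>c _. c) ` univ A)" if "g \<in> G \<union> (\<lambda>c _. c) ` univ A" for g
    using that assms(2) by (auto simp: pols_def intro: gen_base)
  from gen_precomp[where \<rho> = \<rho>, OF assms(1)[unfolded pols_def] this] show ?thesis by (simp add: pols_def)
qed

lemma pols_comp1: "p \<in> Pol1 A \<Longrightarrow> q \<in> pols A G \<Longrightarrow> (\<lambda>d. p (q d)) \<in> pols A G"
  by (rule pols_precomp[where \<rho> = q and h = p and G = "{\<lambda>x. x}"]) auto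

lemma pols_comp2: "p \<in> Pol2 A \<Longrightarrow> q \<in> pols A G \<Longrightarrow> r \<in> pols A G \<Longrightarrow> (\<lambda>d. p (q d, r d)) \<in> pols A G"
  by (rule pols_precomp[where \<rho> = "\<lambda>d. (q d, r d)" and h = p]) auto

lemma pols_compV: "F \<in> PolV A \<Longrightarrow> (\<And>i. \<gamma> i \<in> pols A G) \<Longrightarrow> (\<lambda>d. F (\<lambda>i. \<gamma> i d)) \<in> pols A G"
  by (rule pols_precomp[where \<rho> = "\<lambda>d i. \<gamma> i d" and h = F]) auto

text \<open>A polynomial is built in finitely many steps, so it reads finitely many variables. The
  bound makes it possible to change a valuation one variable at a time.\<close>

lemma PolV_finite_dep:
  assumes "F \<in> PolV A"
  obtains n where "\<And>v w. (\<And>i. i < n \<Longrightarrow> v i = w i) \<Longrightarrow> F v = F w"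
proof -
  have "\<exists>n. \<forall>v w. (\<forall>i<n. v i = w i) \<longrightarrow> F v = F w"
    using assms unfolding pols_def
  proof induction
    case (gen_base g)
    then show ?case
    proof
      assume "g \<in> range (\<lambda>i v. v i)"
      then obtain i where "g = (\<lambda>v. v i)" by auto
      then show ?thesis by (intro exI[of _ "Suc i"]) auto
    qed auto
  next
    case (gen_app f gs)
    then obtain N where N: "\<And>g. g \<in> set gs \<Longrightarrow> \<forall>v w. (\<forall>i<N g. v i = w i) \<longrightarrow> g v = g w"
      by metis
    define n where "n = Max (N ` set gs \<union> {0})"
    have "g v = g w" if "\<forall>i<n. v i = w i" "g \<in> set gs" for g v w
    proof -
      have "N g \<le> n" unfolding n_def using that by (intro Max_ge) auto
      then show ?thesis using N[OF that(2)] that(1) by auto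
    qed
    then have "map (\<lambda>g. g v) gs = map (\<lambda>g. g w) gs" if "\<forall>i<n. v i = w i" for v w
      using that by simp
    then show ?case by metis
  qed
  then show ?thesis using that by blast
qed

text \<open>The walk from \<open>v\<close> to \<open>w\<close> overwrites one coordinate at a time.
  After \<open>n\<close> steps infinitely many coordinates may still differ, but \<open>P\<close>
  does not see them, by \<open>dep\<close>.\<close>

lemma vals_induct:
  assumes "v \<in> vals S" "w \<in> vals S" "P v"
    and step: "\<And>k j x. k \<in> vals S \<Longrightarrow> x \<in> S \<Longrightarrow> P k \<Longrightarrow> P (k(j := x))"
    and dep: "\<And>k k'. (\<And>i. i < n \<Longrightarrow> k i = k' i) \<Longrightarrow> P k \<Longrightarrow> P k'"
  shows "P (w :: nat \<Rightarrow> 'a)"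
proof -
  define k where "k j = (\<lambda>i. if i < j then w i else v i)" for j
  have kv: "k j \<in> vals S" for j using assms(1,2) by (auto simp: k_def vals_def)
  have "P (k j)" for j
  proof (induction j)
    case 0
    then show ?case using assms(3) by (simp add: k_def)
  next
    case (Suc j)
    have "k (Suc j) = (k j)(j := w j)" by (auto simp: k_def fun_eq_iff less_Suc_eq)
    moreover have "P ((k j)(j := w j))" by (rule step[OF kv valsD[OF assms(2)] Suc])
    ultimately show ?case by (simp only:)
  qed
  from this[of n] show ?thesis by (rule dep[rotated]) (simp add: k_def)
qed

lemma Tm_PolV: "Tm A \<subseteq> PolV A"
  unfolding Tm_def pols_def by (rule gen_mono) auto

lemma pols_closed:
  "h \<in> pols A G \<Longrightarrow> closed_under A (univ A) \<Longrightarrow> (\<And>g. g \<in> G \<Longrightarrow> g d \<in> univ A) \<Longrightarrow> h d \<in> univ A"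
  unfolding pols_def by (rule gen_closed[where h = h and d = d]) auto

lemma Pol1_closed: "p \<in> Pol1 A \<Longrightarrow> is_algebra A \<Longrightarrow> x \<in> univ A \<Longrightarrow> p x \<in> univ A"
  by (rule pols_closed[where h = p and d = x]) (auto simp: is_algebra_def)

lemma Pol2_closed: "p \<in> Pol2 A \<Longrightarrow> is_algebra A \<Longrightarrow> x \<in> univ A \<Longrightarrow> y \<in> univ A \<Longrightarrow> p (x, y) \<in> univ A"
  by (rule pols_closed[where h = p and d = "(x, y)"]) (auto simp: is_algebra_def)

lemma PolV_closed: "p \<in> PolV A \<Longrightarrow> is_algebra A \<Longrightarrow> v \<in> vals (univ A) \<Longrightarrow> p v \<in> univ A"
  by (rule pols_closed[where h = p and d = v]) (auto simp: is_algebra_def vals_def)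

lemma PolV_section2:
  assumes "F \<in> PolV A" "k \<in> vals (univ A)"
  shows "(\<lambda>d. F (k(i := fst d, j := snd d))) \<in> Pol2 A"
proof -
  define \<gamma> where "\<gamma> l = (if l = j then snd else if l = i then fst else (\<lambda>_. k l))" for l
  have "\<gamma> l \<in> Pol2 A" for l
    using valsD[OF assms(2)] by (auto simp: \<gamma>_def intro: pols_base pols_const)
  from pols_compV[where \<gamma> = \<gamma>, OF assms(1) this] have "(\<lambda>d. F (\<lambda>l. \<gamma> l d)) \<in> Pol2 A" .
  moreover have "(\<lambda>l. \<gamma> l d) = k(i := fst d, j := snd d)" for d by (auto simp: \<gamma>_def fun_eq_iff)
  ultimately show ?thesis by simp
qed

lemma PolV_section1:
  assumes "F \<in> PolV A" "k \<in> vals (univ A)"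
  shows "(\<lambda>x. F (k(i := x))) \<in> Pol1 A"
proof -
  define \<gamma> where "\<gamma> l = (if l = i then (\<lambda>x. x) else (\<lambda>_. k l))" for l
  have "\<gamma> l \<in> Pol1 A" for l
    using valsD[OF assms(2)] by (auto simp: \<gamma>_def intro: pols_base pols_const)
  from pols_compV[where \<gamma> = \<gamma>, OF assms(1) this] have "(\<lambda>d. F (\<lambda>l. \<gamma> l d)) \<in> Pol1 A" .
  moreover have "(\<lambda>l. \<gamma> l d) = k(i := d)" for d by (auto simp: \<gamma>_def fun_eq_iff)
  ultimately show ?thesis by simp
qed

lemma pols_funpow: "p \<in> Pol1 A \<Longrightarrow> (p ^^ n) \<in> Pol1 A"
proof (induction n)
  case 0
  then show ?case using pols_base[of "\<lambda>x. x" "{\<lambda>x. x}" A] by (simp add: id_def)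
next
  case (Suc n)
  then show ?case using pols_comp1[of p A "p ^^ n"] by (simp add: comp_def)
qed

lemma closed_under_singleton:
  assumes "idempotent_algebra A" "x \<in> univ A"
  shows "closed_under A {x}"
  unfolding closed_under_def tuples_def
proof clarify
  fix f xs assume f: "f \<in> syms A" and xs: "set xs \<subseteq> {x}" "length xs = arity A f"
  then have "xs = replicate (arity A f) x" by (metis replicate_eqI singletonD subsetD)
  then show "interp A f xs = x" using assms f by (simp add: idempotent_algebra_def)
qed

lemma idempotent_Tm:
  assumes "idempotent_algebra A" "F \<in> Tm A" "x \<in> univ A" "\<And>i. v i = x"
  shows "F v = x"
  using Tm_closed[OF assms(2) closed_under_singleton[OF assms(1,3)], of v] assms(4)
  by (simp add: vals_def)

text \<open>Variables 0, 1, 2 of the term are the arguments of the polynomial, the others are filled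
  by an enumeration of the universe.\<close>

definition val3 :: "('f, 'a) ualg \<Rightarrow> 'a \<Rightarrow> 'a \<Rightarrow> 'a \<Rightarrow> nat \<Rightarrow> 'a" where
  "val3 A x y z i = (if i = 0 then x else if i = 1 then y else if i = 2 then z
     else from_nat_into (univ A) (i - 3))"

lemma pols3_rep:
  assumes "h \<in> pols A {a, b, c}" "finite (univ A)" "univ A \<noteq> {}"
  obtains F where "F \<in> Tm A" "\<And>d. h d = F (val3 A (a d) (b d) (c d))"
proof -
  define \<gamma> where "\<gamma> i d = val3 A (a d) (b d) (c d) i" for i d
  have "{a, b, c} \<union> (\<lambda>c _. c) ` univ A \<subseteq> range \<gamma>"
  proof -
    have "a = \<gamma> 0" "b = \<gamma> 1" "c = \<gamma> 2" by (auto simp: \<gamma>_def val3_def fun_eq_iff)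
    moreover have "(\<lambda>_. k) \<in> range \<gamma>" if k: "k \<in> univ A" for k
    proof -
      obtain n where "from_nat_into (univ A) n = k"
        using k assms(2) by (meson countable_finite from_nat_into_surj)
      then have "(\<lambda>_. k) = \<gamma> (n + 3)" by (auto simp: \<gamma>_def val3_def fun_eq_iff)
      then show ?thesis by blast
    qed
    ultimately show ?thesis by auto
  qed
  from subsetD[OF gen_mono[OF this] assms(1)[unfolded pols_def]] have "h \<in> gen A (range \<gamma>)" .
  then obtain F where F: "F \<in> Tm A" "h = (\<lambda>d. F (\<lambda>i. \<gamma> i d))" by (rule gen_rep)
  have "h d = F (val3 A (a d) (b d) (c d))" for d
    using F(2) by (simp add: \<gamma>_def)
  then show ?thesis using F(1) that by blast
qed

lemma val3_vals: "univ A \<noteq> {} \<Longrightarrow> x \<in> univ A \<Longrightarrow> y \<in> univ A \<Longrightarrow> z \<in> univ A \<Longrightarrow> val3 A x y z \<in> vals (univ A)"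
  by (auto simp: vals_def val3_def from_nat_into)

section \<open>Simple algebras\<close>

lemma congruence_compat2: "congruence A \<theta> \<Longrightarrow> compat2 A \<theta>"
  unfolding compat2_def
proof (intro ballI allI impI)
  fix f xs ys
  assume c: "congruence A \<theta>" and f: "f \<in> syms A" "length xs = arity A f"
    and l: "list_all2 (\<lambda>x y. (x, y) \<in> \<theta>) xs ys"
  have "\<theta> \<subseteq> univ A \<times> univ A" using c by (simp add: congruence_def equiv_def)
  then have "set xs \<subseteq> univ A" "set ys \<subseteq> univ A" 
    using l by (fastforce simp: list_all2_conv_all_nth in_set_conv_nth)+
  moreover have "length ys = arity A f" using l f by (simp add: list_all2_lengthD)
  ultimately show "(interp A f xs, interp A f ys) \<in> \<theta>" 
    using c f l unfolding congruence_def tuples_def by blast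
qed

text \<open>The arguments of a basic operation can be changed one at a time, and each single change
  is a unary polynomial; \<open>zs k\<close> is the tuple with the first \<open>k\<close> arguments
  changed.\<close>

lemma congruenceI_pol:
  assumes "is_algebra A" "equiv (univ A) \<theta>"
    and pol: "\<And>p x y. p \<in> Pol1 A \<Longrightarrow> (x, y) \<in> \<theta> \<Longrightarrow> (p x, p y) \<in> \<theta>"
  shows "congruence A \<theta>"
  unfolding congruence_def
proof (intro conjI ballI impI)
  fix f xs ys
  assume f: "f \<in> syms A" and xs: "xs \<in> tuples (univ A) (arity A f)"
    and ys: "ys \<in> tuples (univ A) (arity A f)" and l: "list_all2 (\<lambda>x y. (x, y) \<in> \<theta>) xs ys"
  let ?n = "arity A f"
  have X: "xs ! i \<in> univ A" "ys ! i \<in> univ A" if "i < ?n" for i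
    using xs ys that by (auto simp: tuples_def)
  have len: "length xs = ?n" "length ys = ?n" using xs ys by (auto simp: tuples_def)
  define zs where "zs k = map (\<lambda>i. if i < k then ys ! i else xs ! i) [0..<?n]" for k
  have inX: "interp A f (zs k) \<in> univ A" for k
  proof -
    have "zs k \<in> tuples (univ A) ?n" using X by (auto simp: zs_def tuples_def)
    then show ?thesis using assms(1) f by (simp add: is_algebra_def closed_under_def)
  qed
  have "(interp A f (zs 0), interp A f (zs k)) \<in> \<theta>" if "k \<le> ?n" for k
    using that
  proof (induction k)
    case 0
    then show ?case using assms(2) inX by (auto simp: equiv_def refl_on_def)
  next
    case (Suc k)
    define p where "p x = interp A f (map (\<lambda>g. g x)
      (map (\<lambda>i. if i < k then (\<lambda>_. ys ! i) else if i = k then (\<lambda>x. x) else (\<lambda>_. xs ! i)) [0..<?n]))" for x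
    have "p \<in> Pol1 A" unfolding p_def pols_def
      by (rule gen_app[OF f]) (use X in \<open>auto intro!: gen_base\<close>)
    moreover have "(xs ! k, ys ! k) \<in> \<theta>" using l Suc.prems len by (auto simp: list_all2_conv_all_nth)
    ultimately have "(p (xs ! k), p (ys ! k)) \<in> \<theta>" by (rule pol)
    moreover have "p (xs ! k) = interp A f (zs k)" unfolding p_def zs_def
      by (rule arg_cong[where f = "interp A f"]) auto
    moreover have "p (ys ! k) = interp A f (zs (Suc k))" unfolding p_def zs_def
      by (rule arg_cong[where f = "interp A f"]) (auto simp: less_Suc_eq)
    moreover have "(interp A f (zs 0), interp A f (zs k)) \<in> \<theta>" using Suc by simp
    moreover have "trans \<theta>" using assms(2) by (simp add: equiv_def)
    ultimately show ?case by (metis transD)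
  qed
  from this[of ?n] have "(interp A f (zs 0), interp A f (zs ?n)) \<in> \<theta>" by simp
  moreover have "zs 0 = xs" "zs ?n = ys"
    unfolding zs_def using len by (auto intro!: nth_equalityI)
  ultimately show "(interp A f xs, interp A f ys) \<in> \<theta>" by simp
qed (fact assms(2))

text \<open>The largest congruence inside \<open>E\<close>: pulling back along all unary polynomials
  makes the relation invariant, and the identity polynomial keeps it inside
  \<open>E\<close>.\<close>

lemma congruence_kernel:
  assumes "is_algebra A" "equiv (univ A) E"
  shows "congruence A {(x, y). x \<in> univ A \<and> y \<in> univ A \<and> (\<forall>p\<in>Pol1 A. (p x, p y) \<in> E)}"
    (is "congruence A ?\<theta>")
proof (rule congruenceI_pol[OF assms(1)])
  show "equiv (univ A) ?\<theta>"
  proof (rule equivI)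
    show "?\<theta> \<subseteq> univ A \<times> univ A" by auto
    show "refl_on (univ A) ?\<theta>" using assms(2) Pol1_closed[OF _ assms(1)] by (auto simp: equiv_def refl_on_def)
    show "sym ?\<theta>" using assms(2) by (auto simp: equiv_def sym_def)
    show "trans ?\<theta>" using assms(2) unfolding equiv_def trans_def by blast
  qed
  show "(p x, p y) \<in> ?\<theta>" if p: "p \<in> Pol1 A" and xy: "(x, y) \<in> ?\<theta>" for p x y
  proof -
    have "(q (p x), q (p y)) \<in> E" if q: "q \<in> Pol1 A" for q
      using xy pols_comp1[OF q p] by auto
    then show ?thesis using xy Pol1_closed[OF p assms(1)] by auto
  qed
qed

definition simple_alg :: "('f, 'a) ualg \<Rightarrow> bool" where
  "simple_alg A \<longleftrightarrow> (\<forall>\<theta>. congruence A \<theta> \<longrightarrow> \<theta> = Id_on (univ A) \<or> \<theta> = univ A \<times> univ A)"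

section \<open>Minimal sets of simple algebras\<close>

text \<open>Every orbit has a period of at most \<open>card U\<close>, and each such number divides
  the factorial. The exponent is the same for all points and all permutations of \<open>U\<close>,
  which allows it to be used inside polynomials.\<close>

lemma funpow_fact_card:
  assumes fin: "finite U" and inj: "inj_on f U" and cl: "\<And>x. x \<in> U \<Longrightarrow> f x \<in> U" and x: "x \<in> U"
  shows "(f ^^ fact (card U)) x = x"
proof -
  have clp: "(f ^^ n) y \<in> U" if "y \<in> U" for n y using that by (induction n) (auto simp: cl)
  have injp: "inj_on (f ^^ n) U" for n
  proof (induction n)
    case (Suc n)
    have "inj_on (f \<circ> (f ^^ n)) U"
      by (rule comp_inj_on[OF Suc]) (rule inj_on_subset[OF inj], use clp in auto)
    then show ?case by (simp add: comp_def)
  qed simp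
  have "\<not> inj_on (\<lambda>n. (f ^^ n) x) {0..card U}"
  proof
    assume "inj_on (\<lambda>n. (f ^^ n) x) {0..card U}"
    then have "card {0..card U} \<le> card U"
      by (rule card_inj_on_le) (use clp x fin in auto)
    then show False by simp
  qed
  then obtain i j where ij: "i < j" "j \<le> card U" "(f ^^ i) x = (f ^^ j) x"
    unfolding inj_on_def by (metis atLeastAtMost_iff linorder_neqE_nat)
  then have "(f ^^ i) ((f ^^ (j - i)) x) = (f ^^ i) x"
    using funpow_add[of i "j - i" f] by (simp add: comp_def)
  then have fp: "(f ^^ (j - i)) x = x" using injp[of i] clp x by (auto simp: inj_on_def)
  have "(j - i) dvd fact (card U)" using ij by (intro dvd_fact) auto
  then obtain k where k: "fact (card U) = (j - i) * k" by (auto simp: dvd_def)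
  have "((f ^^ (j - i)) ^^ k) x = x" using fp by (induction k) auto
  then show ?thesis using k by (simp add: funpow_mult)
qed

text \<open>Makes the inverse of a polynomial permutation an iterate, hence a polynomial.\<close>

lemma funpow_inverse:
  assumes "finite U" "inj_on f U" "\<And>x. x \<in> U \<Longrightarrow> f x \<in> U" "x \<in> U"
  shows "(f ^^ (fact (card U) - 1)) (f x) = x" "f ((f ^^ (fact (card U) - 1)) x) = x"
proof -
  have "(fact (card U) :: nat) = Suc (fact (card U) - 1)" by simp
  then have "(f ^^ Suc (fact (card U) - 1)) x = x" using funpow_fact_card[OF assms] by metis
  then show "f ((f ^^ (fact (card U) - 1)) x) = x" unfolding funpow.simps comp_def .
  then show "(f ^^ (fact (card U) - 1)) (f x) = x" by (simp add: funpow_swap1)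
qed

text \<open>A minimal set of a simple algebra for the pair of equality and the full relation, given
  through a polynomial retraction \<open>e\<close>. Minimality has the form in which it is used: a
  polynomial pushed back into \<open>U\<close> is constant or injective there.\<close>

locale minset =
  fixes Q :: "('f, 'b) ualg" and e :: "'b \<Rightarrow> 'b" and U :: "'b set"
  assumes alg: "is_algebra Q" and fin: "finite (univ Q)" and idem: "idempotent_algebra Q"
    and simple: "simple_alg Q"
    and e_pol: "e \<in> Pol1 Q" and e_id: "\<And>x. x \<in> U \<Longrightarrow> e x = x"
    and e_im: "\<And>x. x \<in> univ Q \<Longrightarrow> e x \<in> U"
    and U_sub: "U \<subseteq> univ Q" and U_two: "\<exists>u\<in>U. \<exists>v\<in>U. u \<noteq> v"
    and minimal: "\<And>p. p \<in> Pol1 Q \<Longrightarrow> (\<forall>x\<in>U. \<forall>y\<in>U. e (p x) = e (p y)) \<or> inj_on (\<lambda>x. e (p x)) U"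
begin

abbreviation "X \<equiv> univ Q"

lemma finU: "finite U"
  using U_sub fin finite_subset by blast

lemma UX: "x \<in> U \<Longrightarrow> x \<in> X"
  using U_sub by blast

lemma X_ne: "X \<noteq> {}"
  using alg by (simp add: is_algebra_def)

lemma Pol1_id: "(\<lambda>x. x) \<in> Pol1 Q"
  by (rule pols_base) simp

text \<open>The kernel congruence of \<open>E\<close> contains the pair of distinct elements
  \<open>u\<close>, \<open>v\<close>, so simplicity makes it full.\<close>

lemma equiv_full:
  assumes E: "equiv X E" and uv: "u \<in> X" "v \<in> X" "u \<noteq> v" "\<And>p. p \<in> Pol1 Q \<Longrightarrow> (p u, p v) \<in> E"
    and xy: "x \<in> X" "y \<in> X"
  shows "(x, y) \<in> E"
proof -
  let ?\<theta> = "{(x, y). x \<in> X \<and> y \<in> X \<and> (\<forall>p\<in>Pol1 Q. (p x, p y) \<in> E)}"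
  have "?\<theta> = Id_on X \<or> ?\<theta> = X \<times> X"
    using congruence_kernel[OF alg E] simple by (simp add: simple_alg_def)
  moreover have "(u, v) \<in> ?\<theta>" using uv by auto
  then have ne: "?\<theta> \<noteq> Id_on X" using uv(3) by (metis Id_on_iff)
  ultimately have "?\<theta> = X \<times> X" using ne by argo
  moreover have "(x, y) \<in> X \<times> X" using xy by simp
  ultimately have "(x, y) \<in> ?\<theta>" by (simp only:)
  then have "\<forall>p\<in>Pol1 Q. (p x, p y) \<in> E" by simp
  from bspec[OF this Pol1_id] show ?thesis .
qed

text \<open>Otherwise \<open>equiv_full\<close>, applied to the kernel of \<open>e\<close>, would
  collapse \<open>U\<close>, which \<open>e\<close> fixes pointwise. The maps \<open>e (p x)\<close>
  thus serve as coordinates that embed \<open>X\<close> into a power of \<open>U\<close>.\<close>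

lemma separate:
  assumes "x \<in> X" "y \<in> X" "x \<noteq> y"
  shows "\<exists>p\<in>Pol1 Q. e (p x) \<noteq> e (p y)"
proof (rule ccontr)
  assume n: "\<not> ?thesis"
  let ?E = "{(x, y). x \<in> X \<and> y \<in> X \<and> e x = e y}"
  have E: "equiv X ?E" by (auto simp: equiv_def refl_on_def sym_def trans_def)
  obtain u v where uv: "u \<in> U" "v \<in> U" "u \<noteq> v" using U_two by blast
  have "(p x, p y) \<in> ?E" if "p \<in> Pol1 Q" for p
    using n that Pol1_closed[OF that alg] assms by auto
  from equiv_full[OF E assms this UX[OF uv(1)] UX[OF uv(2)]] have "e u = e v" by blast
  then show False using e_id uv by simp
qed

text \<open>Dual to \<open>separate\<close>: the polynomial images of \<open>U\<close> link all of
  \<open>X\<close>. Facts shown on such images are spread to \<open>X\<close> with it.\<close>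

lemma connect:
  assumes E: "equiv X E" and g: "\<And>g u u'. g \<in> Pol1 Q \<Longrightarrow> u \<in> U \<Longrightarrow> u' \<in> U \<Longrightarrow> (g u, g u') \<in> E"
    and xy: "x \<in> X" "y \<in> X"
  shows "(x, y) \<in> E"
proof -
  obtain u v where uv: "u \<in> U" "v \<in> U" "u \<noteq> v" using U_two by blast
  show ?thesis by (rule equiv_full[OF E UX[OF uv(1)] UX[OF uv(2)] uv(3) g[OF _ uv(1,2)] xy])
qed

text \<open>Some coordinate \<open>e (q x)\<close> separates two values of \<open>f\<close>. By
  minimality the composite then permutes \<open>U\<close>, and an iterate undoes this
  permutation.\<close>

lemma left_inverse:
  assumes f: "f \<in> Pol1 Q" and nc: "u0 \<in> U" "v0 \<in> U" "f u0 \<noteq> f v0"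
  obtains g where "g \<in> Pol1 Q" "\<And>x. x \<in> X \<Longrightarrow> g x \<in> U" "\<And>u. u \<in> U \<Longrightarrow> g (f u) = u"
proof -
  obtain q where q: "q \<in> Pol1 Q" "e (q (f u0)) \<noteq> e (q (f v0))"
    using separate[of "f u0" "f v0"] nc Pol1_closed[OF f alg] UX by auto
  define r where "r x = e (q x)" for x
  define \<pi> where "\<pi> u = r (f u)" for u
  have r: "r \<in> Pol1 Q" unfolding r_def by (rule pols_comp1[OF e_pol q(1)])
  have \<pi>: "\<pi> \<in> Pol1 Q" unfolding \<pi>_def by (rule pols_comp1[OF r f])
  have rU: "r x \<in> U" if "x \<in> X" for x
    using that q(1) Pol1_closed[OF q(1) alg] e_im by (auto simp: r_def)
  have \<pi>U: "\<pi> u \<in> U" if "u \<in> U" for u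
    using that rU Pol1_closed[OF f alg] UX by (auto simp: \<pi>_def)
  have "inj_on \<pi> U"
    using minimal[OF pols_comp1[OF q(1) f]] nc q(2) unfolding \<pi>_def r_def by blast
  then have inv: "(\<pi> ^^ (fact (card U) - 1)) (\<pi> x) = x" if "x \<in> U" for x
    using funpow_inverse(1)[OF finU] \<pi>U that by blast
  let ?n = "fact (card U) - 1 :: nat"
  have "(\<lambda>x. (\<pi> ^^ ?n) (r x)) \<in> Pol1 Q" by (rule pols_comp1[OF pols_funpow[OF \<pi>] r])
  moreover have "(\<pi> ^^ n) x \<in> U" if "x \<in> U" for x n using that by (induction n) (auto simp: \<pi>U)
  then have "(\<pi> ^^ ?n) (r x) \<in> U" if "x \<in> X" for x using that rU by blast
  moreover have "(\<pi> ^^ ?n) (r (f u)) = u" if "u \<in> U" for u using inv[OF that] unfolding \<pi>_def .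
  ultimately show ?thesis using that by blast
qed

lemma Pol2_sections:
  assumes "h \<in> Pol2 Q" "c \<in> X"
  shows "(\<lambda>x. h (x, c)) \<in> Pol1 Q" "(\<lambda>x. h (c, x)) \<in> Pol1 Q"
  using pols_comp2[OF assms(1) Pol1_id pols_const[OF assms(2)]]
    pols_comp2[OF assms(1) pols_const[OF assms(2)] Pol1_id] by auto

section \<open>Palfy's argument: a section that is constant next to one that is injective\<close>

definition mixed :: bool where
  "mixed \<longleftrightarrow> (\<exists>h\<in>Pol2 Q. \<exists>c\<in>U. \<exists>d\<in>U. (\<forall>x\<in>U. \<forall>y\<in>U. e (h (x, c)) = e (h (y, c))) \<and>
     inj_on (\<lambda>x. e (h (x, d))) U)"

text \<open>After iteration each map \<open>f x y\<close> in the variable \<open>x\<close> is the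
  identity or constant. For a third element \<open>y\<close> of \<open>U\<close> and
  \<open>x\<close> other than \<open>g\<close>, the map \<open>f x\<close> would agree at
  \<open>y\<close> with its value at \<open>c\<close> or at \<open>d\<close>; not being injective it
  would be constant, although it takes the values \<open>g\<close> and \<open>x\<close>. So
  \<open>U\<close> is \<open>{c, d}\<close> and \<open>f\<close> is a Boolean operation.\<close>

lemma mixed_meet:
  assumes mixed
  obtains u v m where "u \<in> U" "v \<in> U" "u \<noteq> v" "U = {u, v}" "m \<in> Pol2 Q"
    "m (u, u) = u" "m (u, v) = u" "m (v, u) = u" "m (v, v) = v"
proof -
  obtain h c d where h: "h \<in> Pol2 Q" and cd: "c \<in> U" "d \<in> U"
    and c: "\<And>x y. x \<in> U \<Longrightarrow> y \<in> U \<Longrightarrow> e (h (x, c)) = e (h (y, c))"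
    and d: "inj_on (\<lambda>x. e (h (x, d))) U"
    using assms unfolding mixed_def by blast
  define k where "k y x = e (h (x, y))" for y x
  define f where "f x y = (k y ^^ fact (card U)) x" for x y
  have kU: "k y x \<in> U" if "x \<in> X" "y \<in> X" for x y
    using that e_im Pol2_closed[OF h alg] by (auto simp: k_def)
  have powU: "(k y ^^ n) x \<in> U" if "x \<in> U" "y \<in> X" for x y n
    using that by (induction n) (auto simp: kU UX)
  have fpol: "(\<lambda>d. f (fst d) (snd d)) \<in> Pol2 Q"
  proof -
    have "(\<lambda>d. (k (snd d) ^^ n) (fst d)) \<in> Pol2 Q" for n
    proof (induction n)
      case 0
      then show ?case by (auto intro: pols_base)
    next
      case (Suc n)
      have "(\<lambda>d. e (h ((k (snd d) ^^ n) (fst d), snd d))) \<in> Pol2 Q"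
        by (rule pols_comp1[OF e_pol]) (rule pols_comp2[OF h Suc], auto intro: pols_base)
      moreover have "(k (snd d) ^^ Suc n) (fst d) = e (h ((k (snd d) ^^ n) (fst d), snd d))" for d
        unfolding funpow.simps comp_def k_def ..
      ultimately show ?case by presburger
    qed
    then show ?thesis by (simp add: f_def)
  qed
  have fU: "f x y \<in> U" if "x \<in> U" "y \<in> U" for x y
    using that powU UX by (simp add: f_def)
  have "k d = (\<lambda>x. e (h (x, d)))" by (simp add: k_def fun_eq_iff)
  then have "inj_on (k d) U" using d by simp
  then have fd: "f x d = x" if "x \<in> U" for x
    unfolding f_def by (rule funpow_fact_card[OF finU]) (use that cd kU UX in auto)
  have dich: "f x y = x" if "x \<in> U" "y \<in> U" "inj_on (k y) U" for x y
    unfolding f_def by (rule funpow_fact_card[OF finU that(3) _ that(1)]) (use that kU UX in auto)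
  have const: "f x y = f x' y" if "x \<in> U" "x' \<in> U" "y \<in> U" "\<forall>x\<in>U. \<forall>x'\<in>U. k y x = k y x'" for x x' y
  proof -
    \<comment> \<open>The exponent is positive, so the constant map is applied at least
      once.\<close>
    obtain n where n: "fact (card U) = Suc n" by (metis fact_nonzero old.nat.exhaust)
    have "k y ((k y ^^ n) x) = k y ((k y ^^ n) x')"
      using that(4) powU[OF that(1) UX[OF that(3)], of n] powU[OF that(2) UX[OF that(3)], of n] by blast
    then show ?thesis unfolding f_def n funpow.simps comp_def .
  qed
  have row: "f x y = x \<or> (\<forall>x'\<in>U. f x' y = f x y)" if "x \<in> U" "y \<in> U" for x y
  proof -
    have "(\<forall>x\<in>U. \<forall>x'\<in>U. k y x = k y x') \<or> inj_on (k y) U"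
      using minimal[OF Pol2_sections(1)[OF h UX[OF that(2)]]] unfolding k_def .
    then show ?thesis using dich const that by blast
  qed
  have col: "(\<forall>y\<in>U. \<forall>y'\<in>U. f x y = f x y') \<or> inj_on (f x) U" if "x \<in> U" for x
  proof -
    have "(\<lambda>y. f x y) \<in> Pol1 Q" using Pol2_sections(2)[OF fpol UX[OF that]] by simp
    from minimal[OF this] show ?thesis using that fU e_id by (simp add: inj_on_def)
  qed
  define g where "g = f c c"
  have fc: "f x c = g" if "x \<in> U" for x
    unfolding g_def by (rule const[OF that cd(1) cd(1)]) (use c in \<open>unfold k_def, blast\<close>)
  have gU: "g \<in> U" unfolding g_def using fU cd by blast
  have "c \<noteq> d"
  proof
    assume "c = d"
    then have "x = g" if "x \<in> U" for x using fd fc that by metis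
    then show False using U_two by metis
  qed
  have colg: "f g y = g" if "y \<in> U" for y
  proof -
    have "f g c = f g d" using fc fd gU by simp
    then have "\<not> inj_on (f g) U" using \<open>c \<noteq> d\<close> cd by (auto simp: inj_on_def)
    then have "f g y = f g c" using col[OF gU] that cd by blast
    then show ?thesis using fc gU by simp
  qed
  have only: "y = c \<or> y = d" if y: "y \<in> U" for y
  proof (rule ccontr)
    assume n: "\<not> (y = c \<or> y = d)"
    obtain x where x: "x \<in> U" "x \<noteq> g" using U_two by metis
    have "f x y \<noteq> x"
    proof
      assume "f x y = x"
      then have "f x y = f x d" using fd x by simp
      then have "\<not> inj_on (f x) U" using n cd y by (auto simp: inj_on_def)
      then have "f x c = f x d" using col[OF x(1)] cd by blast
      then show False using fd fc x by simp
    qed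
    then have "f g y = f x y" using row[OF x(1) y] gU by auto
    then have "f x y = f x c" using colg[OF y] fc x by simp
    then have "\<not> inj_on (f x) U" using n cd y by (auto simp: inj_on_def)
    then have "f x c = f x d" using col[OF x(1)] cd by blast
    then show False using fd fc x by simp
  qed
  then have U: "U = {c, d}" using cd by blast
  show ?thesis
  proof (cases "g = c")
    case True
    show ?thesis
      by (rule that[of c d, OF cd \<open>c \<noteq> d\<close> U fpol]) (use fc fd cd True in auto)
  next
    case False
    then have g: "g = d" using only gU by blast
    \<comment> \<open>With \<open>d\<close> as truth, \<open>f x y\<close> is the implication from
      \<open>y\<close> to \<open>x\<close> and \<open>f c\<close> is negation. The composite is
      disjunction, which is a meet with absorbing element \<open>d\<close>.\<close>
    have "(\<lambda>z. f (fst z) (f c (snd z))) \<in> Pol2 Q"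
      using pols_comp2[OF fpol, of fst "{fst, snd}" "\<lambda>z. f c (snd z)"]
        pols_comp2[OF fpol, of "\<lambda>_. c" "{fst, snd}" snd] pols_const[OF UX[OF cd(1)]]
      by (simp add: pols_base) blast
    moreover have "U = {d, c}" using U by blast
    ultimately show ?thesis
      by (intro that[of d c "\<lambda>z. f (fst z) (f c (snd z))", OF cd(2,1) \<open>c \<noteq> d\<close>[symmetric]])
        (use fc fd cd g in auto)
  qed
qed

end

section \<open>Minimal sets of affine type\<close>

definition v3 :: "'a \<Rightarrow> 'a \<Rightarrow> 'a \<Rightarrow> nat \<Rightarrow> 'a" where
  "v3 x y z i = (if i = 0 then x else if i = 1 then y else z)"

lemma v3_vals: "x \<in> S \<Longrightarrow> y \<in> S \<Longrightarrow> z \<in> S \<Longrightarrow> v3 x y z \<in> vals S"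
  by (simp add: v3_def vals_def)

lemma Tm_v3_comp:
  assumes "F \<in> Tm A" "a \<in> Tm A" "b \<in> Tm A" "c \<in> Tm A"
  shows "(\<lambda>v. F (v3 (a v) (b v) (c v))) \<in> Tm A"
proof -
  have "(\<lambda>v. F (\<lambda>i. (if i = 0 then a else if i = 1 then b else c) v)) \<in> Tm A"
    by (rule Tm_subst[OF assms(1)]) (use assms in auto)
  moreover have "(\<lambda>i. (if i = 0 then a else if i = 1 then b else c) v) = v3 (a v) (b v) (c v)" for v
    by (auto simp: v3_def fun_eq_iff)
  ultimately show ?thesis by simp
qed

definition nonunary_on :: "('f, 'b) ualg \<Rightarrow> ('b \<Rightarrow> 'b) \<Rightarrow> 'b set \<Rightarrow> bool" where
  "nonunary_on Q e U \<longleftrightarrow> (\<exists>F\<in>PolV Q. \<exists>i j. i \<noteq> j \<and>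
      (\<exists>v\<in>vals U. \<exists>x\<in>U. e (F (v(i := x))) \<noteq> e (F v)) \<and> (\<exists>v\<in>vals U. \<exists>x\<in>U. e (F (v(j := x))) \<noteq> e (F v)))"

section \<open>The term condition and a quasigroup polynomial on the minimal set\<close>

locale affine_minset = minset +
  assumes not_mixed: "\<not> mixed"
    and nonunary: "nonunary_on Q e U"
begin

text \<open>A weak form of the term condition: by minimality a section that is not constant is
  injective, and next to a constant section it would make the polynomial mixed. The group laws and
  the linearity of polynomials all rest on this.\<close>

lemma const_sections:
  assumes "h \<in> Pol2 Q" "c \<in> U" "d \<in> U" "\<And>x y. x \<in> U \<Longrightarrow> y \<in> U \<Longrightarrow> e (h (x, c)) = e (h (y, c))"
    "x \<in> U" "y \<in> U"
  shows "e (h (x, d)) = e (h (y, d))"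
proof -
  have "\<not> inj_on (\<lambda>x. e (h (x, d))) U" using not_mixed assms unfolding mixed_def by blast
  then show ?thesis using minimal[OF Pol2_sections(1)[OF assms(1) UX[OF assms(3)]]] assms by blast
qed

text \<open>The other variables are moved from \<open>v\<close> to \<open>w\<close> one at a time,
  each move being an instance of the two-variable case.\<close>

lemma const_sectionsV:
  assumes F: "F \<in> PolV Q" and vw: "v \<in> vals U" "w \<in> vals U"
    and c: "\<And>x y. x \<in> U \<Longrightarrow> y \<in> U \<Longrightarrow> e (F (v(i := x))) = e (F (v(i := y)))"
    and xy: "x \<in> U" "y \<in> U"
  shows "e (F (w(i := x))) = e (F (w(i := y)))"
proof -
  obtain n where n: "\<And>v w. (\<And>i. i < n \<Longrightarrow> v i = w i) \<Longrightarrow> F v = F w"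
    using PolV_finite_dep[OF F] by blast
  have UvX: "vals U \<subseteq> vals X" using U_sub by (auto simp: vals_def)
  have "\<forall>x\<in>U. \<forall>y\<in>U. e (F (w(i := x))) = e (F (w(i := y)))"
  proof (rule vals_induct[OF vw, where n = n])
    show "\<forall>x\<in>U. \<forall>y\<in>U. e (F (v(i := x))) = e (F (v(i := y)))" using c by blast
  next
    fix k j z assume k: "k \<in> vals U" "z \<in> U" and IH: "\<forall>x\<in>U. \<forall>y\<in>U. e (F (k(i := x))) = e (F (k(i := y)))"
    show "\<forall>x\<in>U. \<forall>y\<in>U. e (F (k(j := z, i := x))) = e (F (k(j := z, i := y)))"
    proof (cases "j = i")
      case True
      then show ?thesis using IH by (simp only: fun_upd_upd)
    next
      case False
      let ?h = "\<lambda>d. F (k(i := fst d, j := snd d))"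
      have h: "?h \<in> Pol2 Q" by (rule PolV_section2[OF F]) (use k UvX in auto)
      have kj: "k(i := x, j := k j) = k(i := x)" for x using False by auto
      have "e (?h (x, k j)) = e (?h (y, k j))" if "x \<in> U" "y \<in> U" for x y
        unfolding fst_conv snd_conv kj using IH that by blast
      from const_sections[OF h valsD[OF k(1), of j] k(2) this]
      have "e (F (k(i := x, j := z))) = e (F (k(i := y, j := z)))" if "x \<in> U" "y \<in> U" for x y
        using that unfolding fst_conv snd_conv by blast
      then show ?thesis unfolding fun_upd_twist[OF False, of k z] by blast
    qed
  next
    fix k k' :: "nat \<Rightarrow> 'b" assume kk: "\<And>i. i < n \<Longrightarrow> k i = k' i"
      and a: "\<forall>x\<in>U. \<forall>y\<in>U. e (F (k(i := x))) = e (F (k(i := y)))"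
    have "F (k'(i := x)) = F (k(i := x))" for x by (rule n) (use kk in auto)
    then show "\<forall>x\<in>U. \<forall>y\<in>U. e (F (k'(i := x))) = e (F (k'(i := y)))" using a by presburger
  qed
  then show ?thesis using xy by blast
qed

text \<open>A section in an essential variable that is constant for one choice of parameters would
  be constant for all. So the sections in both essential variables are injective, and freezing the
  rest at \<open>u\<close> leaves a quasigroup on \<open>U\<close>.\<close>

lemma latin:
  obtains h where "h \<in> Pol2 Q" "\<And>x y. x \<in> X \<Longrightarrow> y \<in> X \<Longrightarrow> h (x, y) \<in> U"
    "\<And>y. y \<in> U \<Longrightarrow> inj_on (\<lambda>x. h (x, y)) U" "\<And>x. x \<in> U \<Longrightarrow> inj_on (\<lambda>y. h (x, y)) U"
proof -
  obtain F i j where F: "F \<in> PolV Q" and ij: "i \<noteq> j"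
    and i: "\<exists>v\<in>vals U. \<exists>x\<in>U. e (F (v(i := x))) \<noteq> e (F v)"
    and j: "\<exists>v\<in>vals U. \<exists>x\<in>U. e (F (v(j := x))) \<noteq> e (F v)"
    using nonunary unfolding nonunary_on_def by blast
  have UvX: "vals U \<subseteq> vals X" using U_sub by (auto simp: vals_def)
  have inj: "inj_on (\<lambda>x. e (F (w(l := x)))) U"
    if l: "\<exists>v\<in>vals U. \<exists>x\<in>U. e (F (v(l := x))) \<noteq> e (F v)" and w: "w \<in> vals U" for l w
  proof (rule ccontr)
    assume "\<not> ?thesis"
    then have c: "e (F (w(l := x))) = e (F (w(l := y)))" if "x \<in> U" "y \<in> U" for x y
      using minimal[OF PolV_section1[OF F subsetD[OF UvX w], of l]] that by blast
    obtain v x where v: "v \<in> vals U" "x \<in> U" "e (F (v(l := x))) \<noteq> e (F v)" using l by blast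
    have "e (F (v(l := x))) = e (F (v(l := v l)))"
      by (rule const_sectionsV[OF F w v(1) c v(2) valsD[OF v(1)]])
    then show False using v(3) by simp
  qed
  obtain u where u: "u \<in> U" using U_two by blast
  let ?k = "\<lambda>_::nat. u"
  have k: "?k \<in> vals U" using u by (simp add: vals_def)
  let ?h = "\<lambda>d. e (F (?k(i := fst d, j := snd d)))"
  have h: "(\<lambda>d. F (?k(i := fst d, j := snd d))) \<in> Pol2 Q"
    by (rule PolV_section2[OF F subsetD[OF UvX k]])
  show ?thesis
  proof (rule that[of ?h])
    show "?h \<in> Pol2 Q" by (rule pols_comp1[OF e_pol h])
    show "?h (x, y) \<in> U" if "x \<in> X" "y \<in> X" for x y
      using Pol2_closed[OF h alg that] e_im by simp
    show "inj_on (\<lambda>x. ?h (x, y)) U" if "y \<in> U" for y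
      using inj[OF i vals_upd[OF k that], of j] ij by (simp add: fun_upd_twist)
    show "inj_on (\<lambda>y. ?h (x, y)) U" if "x \<in> U" for x
      using inj[OF j vals_upd[OF k that], of i] by simp
  qed
qed

section \<open>The abelian group on the minimal set\<close>

definition is_loop where
  "is_loop p q z \<longleftrightarrow> p \<in> Pol2 Q \<and> q \<in> Pol2 Q \<and> z \<in> U \<and> (\<forall>x\<in>X. \<forall>y\<in>X. p (x, y) \<in> U) \<and>
    (\<forall>x\<in>U. \<forall>y\<in>U. q (x, y) \<in> U) \<and> (\<forall>x\<in>U. p (x, z) = x) \<and> (\<forall>x\<in>U. p (z, x) = x) \<and>
    (\<forall>x\<in>U. \<forall>y\<in>U. q (p (x, y), y) = x \<and> p (q (x, y), y) = x)"

text \<open>The principal isotope of the quasigroup \<open>h\<close> at \<open>u\<close>: undoing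
  the two translations by \<open>u\<close> in the arguments makes \<open>h (u, u)\<close> neutral.
  Right division is an iterate again and so a polynomial.\<close>

lemma loop_exists:
  "\<exists>p q z. is_loop p q z"
proof -
  obtain h where h: "h \<in> Pol2 Q" and hU: "\<And>x y. x \<in> X \<Longrightarrow> y \<in> X \<Longrightarrow> h (x, y) \<in> U"
    and inj1: "\<And>y. y \<in> U \<Longrightarrow> inj_on (\<lambda>x. h (x, y)) U"
    and inj2: "\<And>x. x \<in> U \<Longrightarrow> inj_on (\<lambda>y. h (x, y)) U"
    using latin by blast
  obtain u where u: "u \<in> U" using U_two by blast
  let ?n = "fact (card U) - 1 :: nat"
  define r where "r = (\<lambda>x. h (x, u)) ^^ ?n"
  define l where "l = (\<lambda>y. h (u, y)) ^^ ?n"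
  have r: "r \<in> Pol1 Q" unfolding r_def by (rule pols_funpow[OF Pol2_sections(1)[OF h UX[OF u]]])
  have l: "l \<in> Pol1 Q" unfolding l_def by (rule pols_funpow[OF Pol2_sections(2)[OF h UX[OF u]]])
  have ri: "r (h (x, u)) = x" "h (r x, u) = x" if "x \<in> U" for x
    using funpow_inverse[OF finU inj1[OF u] _ that] hU UX u by (auto simp: r_def)
  have li: "l (h (u, x)) = x" "h (u, l x) = x" if "x \<in> U" for x
    using funpow_inverse[OF finU inj2[OF u] _ that] hU UX u by (auto simp: l_def)
  define p where "p d = h (r (fst d), l (snd d))" for d
  have p: "p \<in> Pol2 Q" unfolding p_def
    by (rule pols_comp2[OF h pols_comp1[OF r] pols_comp1[OF l]]) (auto intro: pols_base)
  define z where "z = h (u, u)"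
  have z: "z \<in> U" unfolding z_def using hU u UX by blast
  have pz: "p (x, z) = x" "p (z, x) = x" if "x \<in> U" for x
    using ri li that u by (auto simp: p_def z_def)
  have pU: "p (x, y) \<in> U" if "x \<in> X" "y \<in> X" for x y
    using that hU Pol1_closed[OF r alg] Pol1_closed[OF l alg] by (simp add: p_def)
  have pinj: "inj_on (\<lambda>x. p (x, y)) U" if y: "y \<in> U" for y
  proof (rule ccontr)
    assume "\<not> ?thesis"
    then have "\<not> inj_on (\<lambda>x. e (p (x, y))) U" using pU UX e_id y by (auto simp: inj_on_def)
    then have c: "e (p (x, y)) = e (p (x', y))" if "x \<in> U" "x' \<in> U" for x x'
      using minimal[OF Pol2_sections(1)[OF p UX[OF y]]] that by blast
    obtain s t where st: "s \<in> U" "t \<in> U" "s \<noteq> t" using U_two by blast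
    have "e (p (s, z)) = e (p (t, z))" by (rule const_sections[OF p y z c st(1,2)])
    then show False using st pz e_id by simp
  qed
  define q where "q d = ((\<lambda>t. p (t, snd d)) ^^ ?n) (fst d)" for d
  have q: "q \<in> Pol2 Q"
  proof -
    have "(\<lambda>d. ((\<lambda>t. p (t, snd d)) ^^ n) (fst d)) \<in> Pol2 Q" for n
    proof (induction n)
      case 0
      then show ?case by (auto intro: pols_base)
    next
      case (Suc n)
      have "(\<lambda>d. p (((\<lambda>t. p (t, snd d)) ^^ n) (fst d), snd d)) \<in> Pol2 Q"
        by (rule pols_comp2[OF p Suc]) (auto intro: pols_base)
      then show ?case by simp
    qed
    then show ?thesis unfolding q_def .
  qed
  have "((\<lambda>t. p (t, y)) ^^ n) x \<in> U" if "x \<in> U" "y \<in> U" for x y n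
    using that by (induction n) (auto simp: pU UX)
  then have qU: "q (x, y) \<in> U" if "x \<in> U" "y \<in> U" for x y using that by (simp add: q_def)
  have "q (p (x, y), y) = x" "p (q (x, y), y) = x" if "x \<in> U" "y \<in> U" for x y
    using funpow_inverse[OF finU pinj[OF that(2)] _ that(1)] pU UX that by (auto simp: q_def)
  then show ?thesis
    by (intro exI[of _ p] exI[of _ q] exI[of _ z]) (simp add: is_loop_def p q z pU qU pz)
qed

definition ops where
  "ops = (SOME (p, q, z). is_loop p q z)"

definition plus (infixl "\<oplus>" 65) where "x \<oplus> y = fst ops (x, y)"
definition minus (infixl "\<ominus>" 65) where "x \<ominus> y = fst (snd ops) (x, y)"
definition zero where "zero = snd (snd ops)"

lemma ops:
  shows plus_pol: "(\<lambda>d. fst d \<oplus> snd d) \<in> Pol2 Q" and minus_pol: "(\<lambda>d. fst d \<ominus> snd d) \<in> Pol2 Q"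
    and zeroU: "zero \<in> U" and plus_X: "x \<in> X \<Longrightarrow> y \<in> X \<Longrightarrow> x \<oplus> y \<in> U"
    and minusU: "x \<in> U \<Longrightarrow> y \<in> U \<Longrightarrow> x \<ominus> y \<in> U"
    and plus_zero: "x \<in> U \<Longrightarrow> x \<oplus> zero = x" and zero_plus: "x \<in> U \<Longrightarrow> zero \<oplus> x = x"
    and plus_minus: "x \<in> U \<Longrightarrow> y \<in> U \<Longrightarrow> (x \<oplus> y) \<ominus> y = x"
    and minus_plus: "x \<in> U \<Longrightarrow> y \<in> U \<Longrightarrow> (x \<ominus> y) \<oplus> y = x"
proof -
  obtain p q z where o: "ops = (p, q, z)" by (metis surj_pair)
  have "is_loop p q z"
    using someI_ex[of "\<lambda>(p, q, z). is_loop p q z"] loop_exists o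
    unfolding ops_def[symmetric] by auto
  note * = this[unfolded is_loop_def]
  have pq: "(\<lambda>d. fst d \<oplus> snd d) = p" "(\<lambda>d. fst d \<ominus> snd d) = q"
    by (auto simp: plus_def minus_def o)
  show "(\<lambda>d. fst d \<oplus> snd d) \<in> Pol2 Q" "(\<lambda>d. fst d \<ominus> snd d) \<in> Pol2 Q"
    unfolding pq using * by blast+
  show "zero \<in> U" "x \<in> X \<Longrightarrow> y \<in> X \<Longrightarrow> x \<oplus> y \<in> U" "x \<in> U \<Longrightarrow> y \<in> U \<Longrightarrow> x \<ominus> y \<in> U"
    "x \<in> U \<Longrightarrow> x \<oplus> zero = x" "x \<in> U \<Longrightarrow> zero \<oplus> x = x"
    "x \<in> U \<Longrightarrow> y \<in> U \<Longrightarrow> (x \<oplus> y) \<ominus> y = x" "x \<in> U \<Longrightarrow> y \<in> U \<Longrightarrow> (x \<ominus> y) \<oplus> y = x"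
    using * by (auto simp: plus_def minus_def zero_def o)
qed

lemma plusU: "x \<in> U \<Longrightarrow> y \<in> U \<Longrightarrow> x \<oplus> y \<in> U"
  using plus_X UX by blast

lemma minus_self: "x \<in> U \<Longrightarrow> x \<ominus> x = zero"
  using plus_minus[OF zeroU, of x] zero_plus by simp

lemma minus_zeroD: "x \<in> U \<Longrightarrow> y \<in> U \<Longrightarrow> x \<ominus> y = zero \<Longrightarrow> x = y"
  using minus_plus[of x y] zero_plus by simp

lemma plus_pols: "a \<in> pols Q G \<Longrightarrow> b \<in> pols Q G \<Longrightarrow> (\<lambda>d. a d \<oplus> b d) \<in> pols Q G"
  using pols_comp2[OF plus_pol] by simp

lemma minus_pols: "a \<in> pols Q G \<Longrightarrow> b \<in> pols Q G \<Longrightarrow> (\<lambda>d. a d \<ominus> b d) \<in> pols Q G"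
  using pols_comp2[OF minus_pol] by simp

lemma Pol2_fst: "fst \<in> Pol2 Q" and Pol2_snd: "snd \<in> Pol2 Q"
  by (auto intro: pols_base)

text \<open>The section at \<open>zero\<close> is constant, so every section is, and its value can
  be read off at \<open>zero\<close>. Commutativity and associativity follow by applying this to the
  difference of their two sides.\<close>

lemma zero_poly:
  assumes G: "G \<in> Pol2 Q" and U: "\<And>x y. x \<in> U \<Longrightarrow> y \<in> U \<Longrightarrow> G (x, y) \<in> U"
    and z: "\<And>x. x \<in> U \<Longrightarrow> G (x, zero) = zero" "\<And>y. y \<in> U \<Longrightarrow> G (zero, y) = zero"
    and xy: "x \<in> U" "y \<in> U"
  shows "G (x, y) = zero"
proof -
  have "e (G (x, y)) = e (G (zero, y))"
    by (rule const_sections[OF G zeroU xy(2) _ xy(1) zeroU]) (simp add: z)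
  then show ?thesis using xy zeroU U z e_id by simp
qed

lemma plus_commute: 
  assumes "x \<in> U" "y \<in> U" shows "x \<oplus> y = y \<oplus> x"
proof -
  let ?G = "\<lambda>d. (fst d \<oplus> snd d) \<ominus> (snd d \<oplus> fst d)"
  have "?G \<in> Pol2 Q" by (intro minus_pols plus_pols Pol2_fst Pol2_snd)
  from zero_poly[OF this _ _ _ assms] have "(x \<oplus> y) \<ominus> (y \<oplus> x) = zero"
    by (simp add: plusU minusU plus_zero zero_plus minus_self)
  then show ?thesis by (rule minus_zeroD[rotated 2]) (simp_all add: assms plusU)
qed

lemma plus_assoc:
  assumes "x \<in> U" "y \<in> U" "z \<in> U" shows "(x \<oplus> y) \<oplus> z = x \<oplus> (y \<oplus> z)"
proof -
  let ?G = "\<lambda>d. ((fst d \<oplus> snd d) \<oplus> z) \<ominus> (fst d \<oplus> (snd d \<oplus> z))"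
  have "?G \<in> Pol2 Q" by (intro minus_pols plus_pols Pol2_fst Pol2_snd pols_const UX assms)
  from zero_poly[OF this _ _ _ assms(1,2)] have "((x \<oplus> y) \<oplus> z) \<ominus> (x \<oplus> (y \<oplus> z)) = zero"
    by (simp add: plusU minusU plus_zero zero_plus minus_self assms)
  then show ?thesis by (rule minus_zeroD[rotated 2]) (simp_all add: assms plusU)
qed

lemma plus_left_commute:
  assumes "x \<in> U" "y \<in> U" "z \<in> U" shows "x \<oplus> (y \<oplus> z) = y \<oplus> (x \<oplus> z)"
  using plus_assoc[of x y z] plus_assoc[of y x z] plus_commute[of x y] assms by simp

lemmas plus_ac = plus_assoc plus_commute plus_left_commute plusU

lemma plus_cancel: "x \<in> U \<Longrightarrow> x' \<in> U \<Longrightarrow> y \<in> U \<Longrightarrow> x \<oplus> y = x' \<oplus> y \<Longrightarrow> x = x'"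
  using plus_minus by metis

text \<open>\<open>par a b c d\<close> expresses \<open>a - b = c - d\<close> without subtraction.\<close>

definition par where "par a b c d \<longleftrightarrow> a \<oplus> d = c \<oplus> b"

lemma par_refl: "par a b a b"
  by (simp add: par_def)

lemma par_diag: "a \<in> U \<Longrightarrow> b \<in> U \<Longrightarrow> par a a b b"
  by (simp add: par_def plus_commute)

lemma par_sym: "par a b c d \<Longrightarrow> par c d a b"
  by (simp add: par_def)

lemma par_trans:
  assumes "par a b c d" "par c d f g" "a \<in> U" "b \<in> U" "c \<in> U" "d \<in> U" "f \<in> U" "g \<in> U"
  shows "par a b f g"
proof -
  have "(a \<oplus> g) \<oplus> d = (a \<oplus> d) \<oplus> g" using assms by (simp add: plus_ac)
  also have "\<dots> = (c \<oplus> b) \<oplus> g" using assms(1) by (simp add: par_def)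
  also have "\<dots> = (c \<oplus> g) \<oplus> b" using assms(3-) by (simp add: plus_ac)
  also have "\<dots> = (f \<oplus> d) \<oplus> b" using assms(2) by (simp add: par_def)
  also have "\<dots> = (f \<oplus> b) \<oplus> d" using assms(3-) by (simp add: plus_ac)
  finally show ?thesis unfolding par_def
    by (rule plus_cancel[rotated 3]) (use assms(3-) plusU in auto)
qed

lemma par_swap: "par a b c d \<Longrightarrow> a \<in> U \<Longrightarrow> b \<in> U \<Longrightarrow> c \<in> U \<Longrightarrow> d \<in> U \<Longrightarrow> par b a d c"
  by (simp add: par_def plus_commute)

lemma par_mid: "par a b c d \<Longrightarrow> a \<in> U \<Longrightarrow> b \<in> U \<Longrightarrow> c \<in> U \<Longrightarrow> d \<in> U \<Longrightarrow> par a c b d"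
  by (simp add: par_def plus_commute)

lemma par_cancel: "par a b c b \<Longrightarrow> a \<in> U \<Longrightarrow> b \<in> U \<Longrightarrow> c \<in> U \<Longrightarrow> a = c"
  unfolding par_def by (rule plus_cancel[rotated 3])

lemma par_add:
  assumes "par a b a' b'" "par b c b' c'" and U: "a \<in> U" "b \<in> U" "c \<in> U" "a' \<in> U" "b' \<in> U" "c' \<in> U"
  shows "par a c a' c'"
proof -
  have "par a a' b b'" "par b b' c c'" using assms par_mid by auto
  then have "par a a' c c'" using par_trans U by metis
  then show ?thesis using par_mid U by auto
qed

lemma ePolU: "p \<in> Pol1 Q \<Longrightarrow> x \<in> X \<Longrightarrow> e (p x) \<in> U"
  using e_im Pol1_closed[OF _ alg] by blast

text \<open>Seen through \<open>e\<close>, a binary polynomial is a function of \<open>x\<close>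
  plus a function of \<open>y\<close>. On polynomial images of \<open>U\<close> this is the term
  condition; \<open>connect\<close> extends it to \<open>X\<close>, first in the \<open>x\<close>
  and then in the \<open>y\<close> direction.\<close>

lemma parallelogram:
  assumes H: "H \<in> Pol2 Q" and X: "x \<in> X" "x' \<in> X" "y \<in> X" "y' \<in> X"
  shows "par (e (H (x, y))) (e (H (x', y))) (e (H (x, y'))) (e (H (x', y')))"
proof -
  have HU: "e (H (x, y)) \<in> U" if "x \<in> X" "y \<in> X" for x y
    using that e_im Pol2_closed[OF H alg] by blast
  note gX = Pol1_closed[OF _ alg UX]
  have square: "par (e (H (g s, g' t))) (e (H (g s', g' t))) (e (H (g s, g' t'))) (e (H (g s', g' t')))"
    if g: "g \<in> Pol1 Q" "g' \<in> Pol1 Q" and U: "s \<in> U" "s' \<in> U" "t \<in> U" "t' \<in> U" for g g' s s' t t'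
  proof -
    define K where "K s t = e (H (g s, g' t))" for s t
    have KU: "K s t \<in> U" if "s \<in> U" "t \<in> U" for s t using that g gX HU by (auto simp: K_def)
    have Kpol: "(\<lambda>d. K (a d) (b d)) \<in> Pol2 Q" if "a \<in> Pol2 Q" "b \<in> Pol2 Q" for a b
      unfolding K_def by (intro pols_comp1[OF e_pol] pols_comp2[OF H] pols_comp1[OF g(1)] pols_comp1[OF g(2)] that)
    \<comment> \<open>With second argument \<open>s'\<close> this difference vanishes for every
      first argument. By the term condition it does not depend on the first argument at
      \<open>s\<close> either.\<close>
    let ?Z = "\<lambda>d. K (snd d) (fst d) \<ominus> K s' (fst d)"
    have Z: "?Z \<in> Pol2 Q"
      by (intro minus_pols Kpol Pol2_fst Pol2_snd pols_const UX U)
    have "e (?Z (t, s)) = e (?Z (t', s))"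
      by (rule const_sections[OF Z U(2,1) _ U(3,4)]) (use KU U minus_self in simp)
    then have eq: "K s t \<ominus> K s' t = K s t' \<ominus> K s' t'"
      using KU U minusU e_id by simp
    define m where "m = K s t \<ominus> K s' t"
    have mU: "m \<in> U" unfolding m_def using KU U minusU by simp
    have "m \<oplus> K s' t = K s t" unfolding m_def using KU U by (intro minus_plus) auto
    moreover have "m \<oplus> K s' t' = K s t'" unfolding m_def eq using KU U by (intro minus_plus) auto
    moreover have "(m \<oplus> K s' t) \<oplus> K s' t' = (m \<oplus> K s' t') \<oplus> K s' t"
      using mU KU[OF U(2,3)] KU[OF U(2,4)] by (simp add: plus_ac)
    ultimately have "K s t \<oplus> K s' t' = K s t' \<oplus> K s' t" by (simp only:)
    then show ?thesis unfolding par_def K_def .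
  qed
  have one: "par (e (H (x, g' t))) (e (H (x', g' t))) (e (H (x, g' t'))) (e (H (x', g' t')))"
    if g: "g' \<in> Pol1 Q" and U: "t \<in> U" "t' \<in> U" and X: "x \<in> X" "x' \<in> X" for g' t t' x x'
  proof -
    define E where "E = {(x, x'). x \<in> X \<and> x' \<in> X \<and>
      par (e (H (x, g' t))) (e (H (x', g' t))) (e (H (x, g' t'))) (e (H (x', g' t')))}"
    have g': "g' t \<in> X" "g' t' \<in> X" using g U gX by auto
    have "equiv X E"
    proof (rule equivI)
      show "E \<subseteq> X \<times> X" by (auto simp: E_def)
      show "refl_on X E" using par_diag HU g' by (auto simp: E_def refl_on_def)
      show "sym E" using par_swap HU g' by (auto simp: E_def sym_def)
      show "trans E"
      proof (rule transI)
        fix a b c assume "(a, b) \<in> E" "(b, c) \<in> E"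
        then show "(a, c) \<in> E" unfolding E_def using par_add HU g' by blast
      qed
    qed
    moreover have "(h s, h s') \<in> E" if "h \<in> Pol1 Q" "s \<in> U" "s' \<in> U" for h s s'
      using square[OF that(1) g that(2,3) U] that gX by (auto simp: E_def)
    ultimately have "(x, x') \<in> E" using connect X by blast
    then show ?thesis by (simp add: E_def)
  qed
  define E where "E = {(y, y'). y \<in> X \<and> y' \<in> X \<and>
      par (e (H (x, y))) (e (H (x', y))) (e (H (x, y'))) (e (H (x', y')))}"
  have "equiv X E"
  proof (rule equivI)
    show "E \<subseteq> X \<times> X" by (auto simp: E_def)
    show "refl_on X E" using par_refl by (auto simp: E_def refl_on_def)
    show "sym E" using par_sym by (auto simp: E_def sym_def)
    show "trans E"
    proof (rule transI)
      fix a b c assume "(a, b) \<in> E" "(b, c) \<in> E"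
      then show "(a, c) \<in> E" unfolding E_def using par_trans HU X(1,2) by blast
    qed
  qed
  moreover have "(h s, h s') \<in> E" if "h \<in> Pol1 Q" "s \<in> U" "s' \<in> U" for h s s'
    using one[OF that(1) that(2,3) X(1,2)] that gX by (auto simp: E_def)
  ultimately have "(y, y') \<in> E" using connect X by blast
  then show ?thesis by (simp add: E_def)
qed

text \<open>Equality of the differences x - y and x' - y' in every coordinate
  \<open>e (p _)\<close>, although \<open>X\<close> itself has no subtraction yet.\<close>

definition pard where
  "pard x y x' y' \<longleftrightarrow> x \<in> X \<and> y \<in> X \<and> x' \<in> X \<and> y' \<in> X \<and>
     (\<forall>p\<in>Pol1 Q. par (e (p x)) (e (p y)) (e (p x')) (e (p y')))"

lemma pard_trans: "pard a b c d \<Longrightarrow> pard c d f g \<Longrightarrow> pard a b f g"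
  unfolding pard_def using par_trans ePolU by (metis (no_types, lifting))

lemma pard_sym: "pard a b c d \<Longrightarrow> pard c d a b"
  unfolding pard_def using par_sym by blast

lemma pard_cancel: "pard a b c b \<Longrightarrow> a = c"
  unfolding pard_def using par_cancel ePolU separate by metis

lemma pard_pol: 
  assumes "pard a b c d" "p \<in> Pol1 Q" shows "pard (p a) (p b) (p c) (p d)"
proof -
  have "par (e (q (p a))) (e (q (p b))) (e (q (p c))) (e (q (p d)))" if "q \<in> Pol1 Q" for q
  proof -
    have "\<forall>p\<in>Pol1 Q. par (e (p a)) (e (p b)) (e (p c)) (e (p d))" using assms(1) by (simp add: pard_def)
    from bspec[OF this pols_comp1[OF that assms(2)]] show ?thesis .
  qed
  then show ?thesis using assms Pol1_closed[OF assms(2) alg] by (simp add: pard_def)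
qed

text \<open>Exchanging \<open>x\<close> for \<open>x'\<close> in one position shifts the value by
  the same amount in every context, because \<open>parallelogram\<close> allows the context to be
  changed one variable at a time.\<close>

lemma pard_term:
  assumes F: "F \<in> Tm Q" and k: "k \<in> vals X" "k' \<in> vals X" and x: "x \<in> X" "x' \<in> X"
  shows "pard (F (k(i := x))) (F (k(i := x'))) (F (k'(i := x))) (F (k'(i := x')))"
proof -
  have FV: "F \<in> PolV Q" using F Tm_PolV by blast
  obtain n where n: "\<And>v w. (\<And>i. i < n \<Longrightarrow> v i = w i) \<Longrightarrow> F v = F w"
    using PolV_finite_dep[OF FV] by blast
  have FX: "F v \<in> X" if "v \<in> vals X" for v using PolV_closed[OF FV alg that] .
  note upd = vals_upd[OF _ x(1)] vals_upd[OF _ x(2)]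
  have "par (e (p (F (k(i := x))))) (e (p (F (k(i := x'))))) (e (p (F (k'(i := x))))) (e (p (F (k'(i := x')))))"
    if p: "p \<in> Pol1 Q" for p
  proof -
    define f where "f l y = e (p (F (l(i := y))))" for l y
    have "par (f k x) (f k x') (f k' x) (f k' x')"
    proof (rule vals_induct[OF k, where n = n])
      fix l j z assume l: "l \<in> vals X" "z \<in> X" and IH: "par (f k x) (f k x') (f l x) (f l x')"
      show "par (f k x) (f k x') (f (l(j := z)) x) (f (l(j := z)) x')"
      proof (cases "j = i")
        case True
        then show ?thesis using IH by (simp only: f_def fun_upd_upd)
      next
        case False
        let ?H = "\<lambda>d. p (F (l(i := fst d, j := snd d)))"
        have "?H \<in> Pol2 Q" by (rule pols_comp1[OF p PolV_section2[OF FV l(1)]])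
        note par = parallelogram[OF this x valsD[OF l(1), of j] l(2), unfolded fst_conv snd_conv]
        have "l(i := y, j := l j) = l(i := y)" "l(i := y, j := z) = l(j := z, i := y)" for y
          using False by (auto simp: fun_upd_twist)
        then have *: "par (f l x) (f l x') (f (l(j := z)) x) (f (l(j := z)) x')"
          using par by (simp only: f_def)
        show ?thesis unfolding f_def
          by (rule par_trans[OF IH[unfolded f_def] *[unfolded f_def]]) (intro ePolU[OF p] FX upd vals_upd k l)+
      qed
    next
      fix l l' :: "nat \<Rightarrow> 'b" assume ll: "\<And>i. i < n \<Longrightarrow> l i = l' i" and a: "par (f k x) (f k x') (f l x) (f l x')"
      have "F (l(i := y)) = F (l'(i := y))" for y by (rule n) (use ll in auto)
      then show "par (f k x) (f k x') (f l' x) (f l' x')" using a by (simp only: f_def)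
    qed (rule par_refl)
    then show ?thesis unfolding f_def .
  qed
  then show ?thesis unfolding pard_def
    using FX[OF upd(1)[OF k(1)]] FX[OF upd(2)[OF k(1)]] FX[OF upd(1)[OF k(2)]] FX[OF upd(2)[OF k(2)]] by simp
qed

end

section \<open>From traces to a Mal'cev term and the affine structure\<close>

context affine_minset
begin

lemma Tm_X: "F \<in> Tm Q \<Longrightarrow> v \<in> vals X \<Longrightarrow> F v \<in> X"
  using Tm_closed alg unfolding is_algebra_def by blast

lemma pard_v3:
  assumes N: "N \<in> Tm Q" and X: "x \<in> X" "x' \<in> X" "y \<in> X" "z \<in> X" "y' \<in> X" "z' \<in> X"
  shows "pard (N (v3 x y z)) (N (v3 x' y z)) (N (v3 x y' z')) (N (v3 x' y' z'))"
proof -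
  have "(v3 x y z)(0 := w) = v3 w y z" for w x y z :: 'b by (auto simp: v3_def fun_eq_iff)
  then show ?thesis
    using pard_term[OF N v3_vals[OF X(1,3,4)] v3_vals[OF X(1,5,6)] X(1,2), of 0] by simp
qed

text \<open>For a trace \<open>g ` U\<close> with retraction \<open>g \<circ> r\<close>, writing \<open>E\<close> for the linear part of the
  retraction, the term constructed here is \<open>z + E (x - y)\<close>.\<close>

lemma trace_term:
  assumes g: "g \<in> Pol1 Q" and ab: "a \<in> U" "b \<in> U" "g a \<noteq> g b"
  obtains N where "N \<in> Tm Q" "\<And>y z. y \<in> X \<Longrightarrow> z \<in> X \<Longrightarrow> N (v3 y y z) = z"
    "N (v3 (g a) (g b) (g b)) = g a"
proof -
  obtain r where r: "r \<in> Pol1 Q" "\<And>x. x \<in> X \<Longrightarrow> r x \<in> U" "\<And>u. u \<in> U \<Longrightarrow> r (g u) = u"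
    using left_inverse[OF g ab] by blast
  have gX: "g u \<in> X" if "u \<in> U" for u using Pol1_closed[OF g alg UX[OF that]] .
  \<comment> \<open>\<open>e'\<close> retracts \<open>X\<close> onto the trace, and
    \<open>d'\<close> is x - y + z of the retracted arguments.\<close>
  define e' where "e' x = g (r x)" for x
  define d' where "d' = (\<lambda>(x, y, z). g ((r x \<ominus> r y) \<oplus> r z))"
  have e'pol: "e' \<in> Pol1 Q" unfolding e'_def by (rule pols_comp1[OF g r(1)])
  have e'X: "e' x \<in> X" if "x \<in> X" for x using that gX r by (simp add: e'_def)
  have e'e': "e' (e' x) = e' x" if "x \<in> X" for x using that r by (simp add: e'_def)
  have e'g: "e' (g u) = g u" if "u \<in> U" for u using that r by (simp add: e'_def)
  have d'pol: "d' \<in> pols Q {fst, \<lambda>d. fst (snd d), \<lambda>d. snd (snd d)}"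
  proof -
    have "(\<lambda>d. g ((r (fst d) \<ominus> r (fst (snd d))) \<oplus> r (snd (snd d)))) \<in>
        pols Q {fst, \<lambda>d. fst (snd d), \<lambda>d. snd (snd d)}"
      by (rule pols_comp1[OF g], rule plus_pols, rule minus_pols; rule pols_comp1[OF r(1)], rule pols_base) auto
    then show ?thesis unfolding d'_def by (simp add: case_prod_beta')
  qed
  obtain u0 where u0: "u0 \<in> U" using U_two by blast
  define \<kappa> where "\<kappa> = val3 Q u0 u0 u0"
  have \<kappa>: "\<kappa> \<in> vals X" unfolding \<kappa>_def using val3_vals[OF X_ne] UX[OF u0] by blast
  obtain F0 where F0: "F0 \<in> Tm Q" "\<And>x. e' x = F0 (val3 Q x x x)"
    using pols3_rep[of e' Q "\<lambda>x. x" "\<lambda>x. x" "\<lambda>x. x"] e'pol fin X_ne by auto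
  \<comment> \<open>\<open>F0\<close> receives the argument in variables 0, 1 and 2 alike. Merging
    them leaves variable 0 for the argument and the variables from 3 on for the constants.\<close>
  define F where "F v = F0 (\<lambda>i. if i < 3 then v 0 else v i)" for v
  have F: "F \<in> Tm Q"
  proof -
    have "(\<lambda>v. F0 (\<lambda>i. (if i < 3 then (\<lambda>v. v 0) else (\<lambda>v. v i)) v)) \<in> Tm Q"
      by (rule Tm_subst[OF F0(1)]) (auto intro: Tm_var)
    moreover have "(\<lambda>i. (if i < 3 then (\<lambda>v. v 0) else (\<lambda>v. v i)) v) = (\<lambda>i. if i < 3 then v 0 else v i)"
      for v :: "nat \<Rightarrow> 'b" by auto
    ultimately show ?thesis unfolding F_def by (simp only:)
  qed
  have Fe: "F (\<kappa>(0 := x)) = e' x" for x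
  proof -
    have "(\<lambda>i. if i < 3 then (\<kappa>(0 := x)) 0 else (\<kappa>(0 := x)) i) = val3 Q x x x"
      by (auto simp: \<kappa>_def val3_def fun_eq_iff)
    then show ?thesis unfolding F_def F0(2) by (simp only:)
  qed
  obtain D where D: "D \<in> Tm Q" "\<And>d. d' d = D (val3 Q (fst d) (fst (snd d)) (snd (snd d)))"
    using pols3_rep[OF d'pol fin X_ne] by blast
  have Dd: "D (\<kappa>(0 := x, 1 := y, 2 := z)) = d' (x, y, z)" for x y z
  proof -
    have "\<kappa>(0 := x, 1 := y, 2 := z) = val3 Q x y z" by (auto simp: \<kappa>_def val3_def fun_eq_iff)
    then show ?thesis unfolding D(2) by simp
  qed
  \<comment> \<open>The constants are overwritten by \<open>y\<close>. With \<open>E\<close> as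
    linear part, \<open>eps y x\<close> is y + E (x - y) and \<open>D0 x y z\<close> is y + E (x -
    y) + E (z - y).\<close>
  define eps where "eps y x = F ((\<lambda>_. y)(0 := x))" for x y
  define D0 where "D0 x y z = D ((\<lambda>_. y)(0 := x, 2 := z))" for x y z
  have cv: "(\<lambda>_. y) \<in> vals X" if "y \<in> X" for y :: 'b using that by (simp add: vals_def)
  have epsX: "eps y x \<in> X" if "x \<in> X" "y \<in> X" for x y
    unfolding eps_def by (rule Tm_X[OF F vals_upd[OF cv]]) (use that in auto)
  have D0X: "D0 x y z \<in> X" if "x \<in> X" "y \<in> X" "z \<in> X" for x y z
    unfolding D0_def by (rule Tm_X[OF D(1) vals_upd[OF vals_upd[OF cv]]]) (use that in auto)
  have eps_id: "eps y y = y" if "y \<in> X" for y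
    unfolding eps_def by (rule idempotent_Tm[OF idem F that]) simp
  have D0_id: "D0 y y y = y" if "y \<in> X" for y
    unfolding D0_def by (rule idempotent_Tm[OF idem D(1) that]) simp
  have eps: "pard (eps y x) (eps y x') (e' x) (e' x')" if "x \<in> X" "x' \<in> X" "y \<in> X" for x x' y
    unfolding eps_def Fe[symmetric] by (rule pard_term[OF F cv[OF that(3)] \<kappa> that(1,2)])
  have eps': "pard (eps y x) y (e' x) (e' y)" if "x \<in> X" "y \<in> X" for x y
    using eps[OF that(1,2,2)] eps_id that by simp
  \<comment> \<open>At (x, y, z), \<open>s\<close> is y + E (z - y) and, as E is idempotent,
    \<open>f\<close> is y + E (x - y) + E (z - y). The outer \<open>eps\<close> turns this into z +
    E (x - y).\<close>
  define N where "N v = (let s = eps (v 1) (v 2); f = D0 (eps (v 1) (v 0)) (v 1) s in eps (v 2) f)" for v :: "nat \<Rightarrow> 'b"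
  have epsT: "(\<lambda>v. eps (p v) (q v)) \<in> Tm Q" if "p \<in> Tm Q" "q \<in> Tm Q" for p q :: "(nat \<Rightarrow> 'b) \<Rightarrow> 'b"
  proof -
    have "(\<lambda>v. eps (p v) (q v)) = (\<lambda>v. F (\<lambda>i. (if i = 0 then q else p) v))"
      unfolding eps_def by (intro ext arg_cong[where f = F]) auto
    moreover have "\<dots> \<in> Tm Q" by (rule Tm_subst[OF F]) (use that in auto)
    ultimately show ?thesis by (elim ssubst[where P = "\<lambda>h. h \<in> Tm Q"])
  qed
  have D0T: "(\<lambda>v. D0 (p v) (q v) (t v)) \<in> Tm Q" if "p \<in> Tm Q" "q \<in> Tm Q" "t \<in> Tm Q" for p q t
  proof -
    have "(\<lambda>v. D0 (p v) (q v) (t v)) = (\<lambda>v. D (\<lambda>i. (if i = 0 then p else if i = 2 then t else q) v))"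
      unfolding D0_def by (intro ext arg_cong[where f = D]) auto
    moreover have "\<dots> \<in> Tm Q" by (rule Tm_subst[OF D(1)]) (use that in auto)
    ultimately show ?thesis by (elim ssubst[where P = "\<lambda>h. h \<in> Tm Q"])
  qed
  have N: "N \<in> Tm Q" unfolding N_def Let_def
    by (intro epsT D0T Tm_var)
  have Nv: "N (v3 x y z) = eps z (D0 (eps y x) y (eps y z))" for x y z
    by (simp add: N_def v3_def)
  have "N (v3 y y z) = z" if yz: "y \<in> X" "z \<in> X" for y z
  proof -
    define s where "s = eps y z"
    have sX: "s \<in> X" unfolding s_def using epsX yz by blast
    \<comment> \<open>With its first two arguments equal, \<open>d'\<close> fixes the trace
      pointwise. The term \<open>D0 y y\<close> has the same differences as this polynomial, which
      determines it.\<close>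
    let ?p = "\<lambda>w. d' (u0, u0, w)"
    have p: "?p \<in> Pol1 Q"
      by (rule pols_precomp[OF d'pol, where \<rho> = "\<lambda>w. (u0, u0, w)"])
        (use UX[OF u0] in \<open>auto intro: pols_const pols_base\<close>)
    have pe: "?p (e' w) = e' w" if "w \<in> X" for w
    proof -
      have "r (e' w) = r w" using r that by (simp add: e'_def)
      moreover have "r u0 \<ominus> r u0 = zero" using minus_self r UX[OF u0] by blast
      ultimately show ?thesis using zero_plus r that by (simp add: d'_def e'_def)
    qed
    have "pard (D0 y y s) (D0 y y y) (?p s) (?p y)"
    proof -
      show ?thesis unfolding D0_def Dd[symmetric]
        by (rule pard_term[OF D(1)]) (intro vals_upd cv yz sX \<kappa> UX[OF u0])+
    qed
    moreover have s: "pard s y (e' z) (e' y)" unfolding s_def by (rule eps'[OF yz(2,1)])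
    then have "pard (?p s) (?p y) (e' z) (e' y)" using pard_pol[OF s p] pe yz by simp
    ultimately have "pard (D0 y y s) y (e' z) (e' y)" using pard_trans D0_id yz by metis
    then have f: "D0 y y s = s" using pard_cancel pard_trans pard_sym s by metis
    have "pard (eps z s) (eps z y) (e' s) (e' y)" by (rule eps[OF sX yz])
    moreover have "pard (e' s) (e' y) (e' z) (e' y)" using pard_pol[OF s e'pol] e'e' yz by simp
    moreover have "pard (eps z z) (eps z y) (e' z) (e' y)" by (rule eps[OF yz(2,1,2)])
    ultimately have "eps z s = eps z z" using pard_cancel pard_trans pard_sym by metis
    then show ?thesis using Nv f eps_id yz by (simp add: s_def)
  qed
  moreover have "N (v3 (g a) (g b) (g b)) = g a"
  proof -
    let ?u = "g a" and ?w = "g b"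
    have uw: "?u \<in> X" "?w \<in> X" using gX ab by auto
    have 1: "eps ?w ?u = ?u"
      using eps'[OF uw] e'g ab pard_cancel by auto
    have "pard (D0 ?u ?w ?w) (D0 ?w ?w ?w) (d' (?u, ?w, ?w)) (d' (?w, ?w, ?w))"
    proof -
      have eq: "\<kappa>(0 := x, 1 := ?w, 2 := ?w) = (\<kappa>(1 := ?w, 2 := ?w))(0 := x)" for x by auto
      have eq': "(\<lambda>_::nat. ?w)(0 := x, 2 := ?w) = (\<lambda>_. ?w)(0 := x)" for x by (auto simp: fun_eq_iff)
      show ?thesis unfolding D0_def Dd[symmetric] eq eq'
        by (rule pard_term[OF D(1)]) (intro uw \<kappa> cv vals_upd)+
    qed
    moreover have "d' (?u, ?w, ?w) = ?u" "d' (?w, ?w, ?w) = ?w"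
      using r ab minus_plus by (auto simp: d'_def)
    ultimately have "D0 ?u ?w ?w = ?u" using pard_cancel D0_id uw by metis
    then show ?thesis using 1 eps_id uw by (simp add: Nv)
  qed
  ultimately show ?thesis using that N by blast
qed

text \<open>Among the terms satisfying the first identity, take one that satisfies the second on as
  many trace pairs as possible. If it fails at \<open>(c', c)\<close>, then \<open>c'\<close> and
  the wrong value lie in a new trace, and the term of that trace repairs the failure without
  spoiling the good pairs.\<close>

lemma malcev:
  obtains N where "N \<in> Tm Q" "\<And>y z. y \<in> X \<Longrightarrow> z \<in> X \<Longrightarrow> N (v3 y y z) = z"
    "\<And>x y. x \<in> X \<Longrightarrow> y \<in> X \<Longrightarrow> N (v3 x y y) = x"
proof -
  define T where "T = {(g a, g b) | g a b. g \<in> Pol1 Q \<and> a \<in> U \<and> b \<in> U}"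
  have TX: "T \<subseteq> X \<times> X" using Pol1_closed[OF _ alg] UX by (auto simp: T_def)
  then have finT: "finite T" using fin finite_subset by blast
  define P where "P N \<longleftrightarrow> N \<in> Tm Q \<and> (\<forall>y\<in>X. \<forall>z\<in>X. N (v3 y y z) = z)" for N
  define good where "good N = {(x, y) \<in> T. N (v3 x y y) = x}" for N
  have P0: "P (\<lambda>v. v 2)" by (simp add: P_def Tm_var v3_def)
  have "card (good N) < Suc (card T)" for N
  proof -
    have "good N \<subseteq> T" by (auto simp: good_def)
    then show ?thesis using card_mono[OF finT] by (simp add: less_Suc_eq_le)
  qed
  then obtain N where N: "P N" and max: "\<And>N'. P N' \<Longrightarrow> card (good N') \<le> card (good N)"
    using ex_has_greatest_nat[of P "\<lambda>v. v 2" "\<lambda>N. card (good N)"] P0 by blast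
  have NT: "N \<in> Tm Q" and Nz: "\<And>y z. y \<in> X \<Longrightarrow> z \<in> X \<Longrightarrow> N (v3 y y z) = z" using N by (auto simp: P_def)
  have all: "N (v3 c' c c) = c'" if cc: "(c', c) \<in> T" for c c'
  proof (rule ccontr)
    assume bad: "N (v3 c' c c) \<noteq> c'"
    obtain g a b where g: "g \<in> Pol1 Q" "a \<in> U" "b \<in> U" "c' = g a" "c = g b" using cc by (auto simp: T_def)
    have cX: "c \<in> X" "c' \<in> X" using cc TX by auto
    define h where "h y = N (v3 c' y y)" for y
    have h: "h \<in> Pol1 Q"
    proof -
      have "(\<lambda>y. N (\<lambda>i. (if i = 0 then (\<lambda>_. c') else (\<lambda>y. y)) y)) \<in> Pol1 Q"
        by (rule pols_compV[OF subsetD[OF Tm_PolV NT]]) (auto intro: pols_const pols_base cX)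
      moreover have "(\<lambda>i. (if i = 0 then (\<lambda>_. c') else (\<lambda>y. y)) y) = v3 c' y y" for y
        by (auto simp: v3_def fun_eq_iff)
      ultimately show ?thesis unfolding h_def by (simp only:)
    qed
    define k where "k x = h (g x)" for x
    have k: "k \<in> Pol1 Q" unfolding k_def by (rule pols_comp1[OF h g(1)])
    have ka: "k a = c'" using Nz cX g by (simp add: k_def h_def)
    have kb: "k b = N (v3 c' c c)" using g by (simp add: k_def h_def)
    obtain N' where N': "N' \<in> Tm Q" "\<And>y z. y \<in> X \<Longrightarrow> z \<in> X \<Longrightarrow> N' (v3 y y z) = z"
      "N' (v3 (k a) (k b) (k b)) = k a"
      using trace_term[OF k g(2,3)] ka kb bad by metis
    \<comment> \<open>At (x, y, y) with a pair that is good for \<open>N\<close>, all three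
      arguments of \<open>N'\<close> equal \<open>x\<close>; at the failing pair they are
      \<open>k a\<close>, \<open>k b\<close>, \<open>k b\<close>.\<close>
    define M where "M v = N' (v3 (v 0) (N (v3 (v 0) (v 1) (v 1))) (N (v3 (v 0) (v 1) (v 2))))"
      for v :: "nat \<Rightarrow> 'b"
    have Mv: "M (v3 x y z) = N' (v3 x (N (v3 x y y)) (N (v3 x y z)))" for x y z
      by (simp add: M_def v3_def)
    have "M \<in> Tm Q" unfolding M_def by (intro Tm_v3_comp N'(1) NT Tm_var)
    then have PM: "P M" by (simp add: P_def Mv Nz N')
    have "good N \<subset> good M"
    proof
      show "good N \<subseteq> good M" using TX N' by (auto simp: good_def Mv)
      have "(c', c) \<in> good M" using cc N'(3) ka kb by (simp add: good_def Mv)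
      then show "good N \<noteq> good M" using bad by (auto simp: good_def)
    qed
    moreover have "finite (good M)" using finT by (rule finite_subset[rotated]) (auto simp: good_def)
    ultimately have "card (good N) < card (good M)" by (rule psubset_card_mono[rotated])
    then show False using max[OF PM] by simp
  qed
  \<comment> \<open>Invariance of differences makes this an equivalence. It contains the pairs of
    every trace, so \<open>connect\<close> applies.\<close>
  define E where "E = {(x, y). x \<in> X \<and> y \<in> X \<and> N (v3 x y y) = x}"
  have "equiv X E"
  proof (rule equivI)
    show "E \<subseteq> X \<times> X" by (auto simp: E_def)
    show "refl_on X E" using Nz by (auto simp: E_def refl_on_def)
    show "sym E"
    proof (rule symI)
      fix x y assume "(x, y) \<in> E"
      then have X: "x \<in> X" "y \<in> X" and eq: "N (v3 x y y) = x" by (auto simp: E_def)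
      have "pard (N (v3 y x x)) (N (v3 x x x)) (N (v3 y y y)) (N (v3 x y y))"
        by (rule pard_v3[OF NT]) (use X in auto)
      then have "N (v3 y x x) = y" using Nz X eq pard_cancel by auto
      then show "(y, x) \<in> E" using X by (simp add: E_def)
    qed
    show "trans E"
    proof (rule transI)
      fix x y z assume "(x, y) \<in> E" "(y, z) \<in> E"
      then have X: "x \<in> X" "y \<in> X" "z \<in> X" and eq: "N (v3 x y y) = x" "N (v3 y z z) = y"
        by (auto simp: E_def)
      have "pard (N (v3 x z z)) (N (v3 y z z)) (N (v3 x y y)) (N (v3 y y y))"
        by (rule pard_v3[OF NT]) (use X in auto)
      then have "N (v3 x z z) = x" using Nz X eq pard_cancel by auto
      then show "(x, z) \<in> E" using X by (simp add: E_def)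
    qed
  qed
  moreover have "(g u, g u') \<in> E" if "g \<in> Pol1 Q" "u \<in> U" "u' \<in> U" for g u u'
    using all[of "g u" "g u'"] that Pol1_closed[OF that(1) alg] UX by (auto simp: E_def T_def)
  ultimately have "(x, y) \<in> E" if "x \<in> X" "y \<in> X" for x y using connect that by blast
  then show ?thesis using that[OF NT Nz] by (simp add: E_def)
qed

text \<open>By \<open>coord\<close>, each coordinate \<open>e (p _)\<close> turns \<open>N\<close>
  into x - y + z over the group on \<open>U\<close>. The coordinates separate points, so the laws of
  the group on \<open>X\<close> with sum N (x, c, y) and an arbitrary zero \<open>c\<close> are
  checked coordinatewise.\<close>

theorem affine:
  obtains N and G :: "'b monoid" where "N \<in> Tm Q" "comm_group G" "carrier G = X"
    "\<And>x y z. x \<in> X \<Longrightarrow> y \<in> X \<Longrightarrow> z \<in> X \<Longrightarrow> N (v3 x y z) = x \<otimes>\<^bsub>G\<^esub> inv\<^bsub>G\<^esub> y \<otimes>\<^bsub>G\<^esub> z"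
proof -
  obtain N where N: "N \<in> Tm Q" and N1: "\<And>y z. y \<in> X \<Longrightarrow> z \<in> X \<Longrightarrow> N (v3 y y z) = z"
    and N2: "\<And>x y. x \<in> X \<Longrightarrow> y \<in> X \<Longrightarrow> N (v3 x y y) = x" using malcev by blast
  have NX: "N (v3 x y z) \<in> X" if "x \<in> X" "y \<in> X" "z \<in> X" for x y z
    by (rule Tm_X[OF N v3_vals[OF that]])
  have coord: "e (p (N (v3 x y z))) \<oplus> e (p y) = e (p x) \<oplus> e (p z)"
    if "x \<in> X" "y \<in> X" "z \<in> X" "p \<in> Pol1 Q" for x y z p
  proof -
    have "pard (N (v3 x y z)) (N (v3 y y z)) (N (v3 x y y)) (N (v3 y y y))"
      by (rule pard_v3[OF N]) (use that in auto)
    then have "pard (N (v3 x y z)) z x y" using N1 N2 that by simp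
    then show ?thesis using that(4) by (simp add: pard_def par_def)
  qed
  have ext: "x = y" if "x \<in> X" "y \<in> X" "\<And>p. p \<in> Pol1 Q \<Longrightarrow> e (p x) = e (p y)" for x y
    using separate that by blast
  obtain c where c: "c \<in> X" using X_ne by blast
  have asc: "N (v3 (N (v3 x c y)) c z) = N (v3 x c (N (v3 y c z)))" if X: "x \<in> X" "y \<in> X" "z \<in> X" for x y z
  proof (rule ext)
    fix p assume p: "p \<in> Pol1 Q"
    let ?f = "\<lambda>x. e (p x)"
    have U: "?f w \<in> U" if "w \<in> X" for w using ePolU p that by blast
    let ?xy = "N (v3 x c y)" and ?yz = "N (v3 y c z)"
    have xy: "?f ?xy \<oplus> ?f c = ?f x \<oplus> ?f y" and yz: "?f ?yz \<oplus> ?f c = ?f y \<oplus> ?f z"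
      using coord[OF _ c _ p] X by auto
    have l: "?f (N (v3 ?xy c z)) \<oplus> ?f c = ?f ?xy \<oplus> ?f z"
      and r: "?f (N (v3 x c ?yz)) \<oplus> ?f c = ?f x \<oplus> ?f ?yz"
      using coord[OF _ c _ p] X NX c by auto
    note UU = U[OF X(1)] U[OF X(2)] U[OF X(3)] U[OF c] U[OF NX[OF X(1) c X(2)]] U[OF NX[OF X(2) c X(3)]]
    have "(?f ?xy \<oplus> ?f z) \<oplus> ?f c = (?f ?xy \<oplus> ?f c) \<oplus> ?f z" using UU by (simp add: plus_ac)
    also have "\<dots> = ?f x \<oplus> (?f y \<oplus> ?f z)" using xy UU by (simp add: plus_assoc)
    also have "\<dots> = (?f x \<oplus> ?f ?yz) \<oplus> ?f c" using yz UU by (simp add: plus_assoc)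
    finally have "?f ?xy \<oplus> ?f z = ?f x \<oplus> ?f ?yz" by (rule plus_cancel[rotated 3]) (use UU plusU in auto)
    then have "?f (N (v3 ?xy c z)) \<oplus> ?f c = ?f (N (v3 x c ?yz)) \<oplus> ?f c" using l r by simp
    then show "?f (N (v3 ?xy c z)) = ?f (N (v3 x c ?yz))"
      by (rule plus_cancel[rotated 3]) (intro U NX X c)+
  qed (intro NX X c)+
  have comm: "N (v3 x c y) = N (v3 y c x)" if X: "x \<in> X" "y \<in> X" for x y
  proof (rule ext)
    fix p assume p: "p \<in> Pol1 Q"
    have U: "e (p w) \<in> U" if "w \<in> X" for w using ePolU p that by blast
    have "e (p (N (v3 x c y))) \<oplus> e (p c) = e (p (N (v3 y c x))) \<oplus> e (p c)"
      using coord[OF X(1) c X(2) p] coord[OF X(2) c X(1) p] plus_commute[OF U U] X by simp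
    then show "e (p (N (v3 x c y))) = e (p (N (v3 y c x)))"
      by (rule plus_cancel[rotated 3]) (intro U NX X c)+
  qed (intro NX X c)+
  have canc: "N (v3 (N (v3 x y c)) c y) = x" if X: "x \<in> X" "y \<in> X" for x y
  proof (rule ext)
    fix p assume p: "p \<in> Pol1 Q"
    have U: "e (p w) \<in> U" if "w \<in> X" for w using ePolU p that by blast
    have "e (p (N (v3 (N (v3 x y c)) c y))) \<oplus> e (p c) = e (p x) \<oplus> e (p c)"
      using coord[OF NX[OF X c] c X(2) p] coord[OF X c p] by simp
    then show "e (p (N (v3 (N (v3 x y c)) c y))) = e (p x)"
      by (rule plus_cancel[rotated 3]) (intro U NX X c)+
  qed (intro NX X c)+
  define G where "G = \<lparr>carrier = X, monoid.mult = (\<lambda>x y. N (v3 x c y)), one = c\<rparr>"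
  have G: "comm_group G"
  proof (rule comm_groupI)
    show "\<exists>y\<in>carrier G. y \<otimes>\<^bsub>G\<^esub> x = \<one>\<^bsub>G\<^esub>" if "x \<in> carrier G" for x
      using that canc[of c x] NX[of c x c] c by (auto simp: G_def)
  qed (auto simp: G_def NX c N1 asc intro: comm)
  then interpret G: comm_group G .
  have inv: "inv\<^bsub>G\<^esub> y = N (v3 c y c)" if "y \<in> X" for y
    by (rule G.inv_equality) (use that canc NX c in \<open>auto simp: G_def\<close>)
  have "N (v3 x y z) = x \<otimes>\<^bsub>G\<^esub> inv\<^bsub>G\<^esub> y \<otimes>\<^bsub>G\<^esub> z" if X: "x \<in> X" "y \<in> X" "z \<in> X" for x y z
  proof -
    have "N (v3 (N (v3 x c (N (v3 c y c)))) c z) = N (v3 x y z)"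
    proof (rule ext)
      fix p assume p: "p \<in> Pol1 Q"
      let ?f = "\<lambda>x. e (p x)"
      have U: "?f w \<in> U" if "w \<in> X" for w using ePolU p that by blast
      let ?i = "N (v3 c y c)"
      let ?m = "N (v3 x c ?i)"
      have iX: "?i \<in> X" using NX X c by blast
      have mX: "?m \<in> X" using NX X c iX by blast
      have 1: "?f (N (v3 ?m c z)) \<oplus> ?f c = ?f ?m \<oplus> ?f z" by (rule coord[OF mX c X(3) p])
      have 2: "?f ?m \<oplus> ?f c = ?f x \<oplus> ?f ?i" by (rule coord[OF X(1) c iX p])
      have 3: "?f ?i \<oplus> ?f y = ?f c \<oplus> ?f c" by (rule coord[OF c X(2) c p])
      have 4: "?f (N (v3 x y z)) \<oplus> ?f y = ?f x \<oplus> ?f z" by (rule coord[OF X p])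
      note UU = U[OF X(1)] U[OF X(2)] U[OF X(3)] U[OF c] U[OF iX] U[OF mX] U[OF NX[OF mX c X(3)]] U[OF NX[OF X]]
      let ?l = "?f (N (v3 ?m c z))" and ?r = "?f (N (v3 x y z))"
      \<comment> \<open>Adding \<open>?f c\<close> twice and \<open>?f y\<close> once makes the
        equations 1 to 4 applicable without subtraction.\<close>
      let ?k = "?f c \<oplus> (?f c \<oplus> ?f y)"
      have "?l \<oplus> ?k = (?l \<oplus> ?f c) \<oplus> (?f c \<oplus> ?f y)" using UU by (simp add: plus_assoc plusU)
      also have "\<dots> = (?f ?m \<oplus> ?f c) \<oplus> (?f z \<oplus> ?f y)" unfolding 1 using UU by (simp add: plus_ac)
      also have "\<dots> = (?f ?i \<oplus> ?f y) \<oplus> (?f x \<oplus> ?f z)" unfolding 2 using UU by (simp add: plus_ac)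
      also have "\<dots> = ?r \<oplus> ?k" unfolding 3 4[symmetric] using UU by (simp add: plus_ac)
      finally show "?l = ?r" by (rule plus_cancel[rotated 3]) (use UU plusU in auto)
    qed (intro NX X c)+
    then show ?thesis using inv X by (simp add: G_def)
  qed
  then show ?thesis using that[OF N G] by (simp add: G_def)
qed

end

section \<open>Minimal sets with a meet operation\<close>

lemma v3_simps: "v3 x y z 0 = x" "v3 x y z (Suc 0) = y" "v3 x y z 1 = y" "v3 x y z 2 = z"
  by (simp_all add: v3_def)

definition v4 :: "'a \<Rightarrow> 'a \<Rightarrow> 'a \<Rightarrow> 'a \<Rightarrow> nat \<Rightarrow> 'a" where
  "v4 x y z w i = (if i = 0 then x else if i = 1 then y else if i = 2 then z else w)"

lemma Tm_v4_comp:
  assumes "F \<in> Tm A" "a \<in> Tm A" "b \<in> Tm A" "c \<in> Tm A" "d \<in> Tm A"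
  shows "(\<lambda>v. F (v4 (a v) (b v) (c v) (d v))) \<in> Tm A"
proof -
  have "(\<lambda>v. F (v4 (a v) (b v) (c v) (d v))) =
      (\<lambda>v. F (\<lambda>i. (if i = 0 then a else if i = 1 then b else if i = 2 then c else d) v))"
    by (intro ext arg_cong[where f = F]) (auto simp: v4_def)
  moreover have "\<dots> \<in> Tm A" by (rule Tm_subst[OF assms(1)]) (use assms in auto)
  ultimately show ?thesis by (elim ssubst[where P = "\<lambda>h. h \<in> Tm A"])
qed

text \<open>The valuation \<open>v3 a b b\<close> gives all variables from 1 on the same value,
  which is how a term is truncated to two arguments by \<open>Tm_term_ops\<close>.\<close>

definition semilattice_pair :: "('f, 'b) ualg \<Rightarrow> 'b \<Rightarrow> 'b \<Rightarrow> bool" where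
  "semilattice_pair Q a b \<longleftrightarrow> (\<exists>F\<in>Tm Q. F (v3 a b b) = F (v3 b a a) \<and> F (v3 a b b) \<in> {a, b})"

definition majority_pair :: "('f, 'b) ualg \<Rightarrow> 'b \<Rightarrow> 'b \<Rightarrow> bool" where
  "majority_pair Q a b \<longleftrightarrow>
    (\<exists>F\<in>Tm Q. \<forall>x\<in>{a, b}. \<forall>y\<in>{a, b}. F (v3 x x y) = x \<and> F (v3 x y x) = x \<and> F (v3 y x x) = x)"

definition affine_alg :: "('f, 'b) ualg \<Rightarrow> bool" where
  "affine_alg Q \<longleftrightarrow> (\<exists>F\<in>Tm Q. \<exists>G :: 'b monoid. comm_group G \<and> carrier G = univ Q \<and>
       (\<forall>x\<in>univ Q. \<forall>y\<in>univ Q. \<forall>z\<in>univ Q. F (v3 x y z) = x \<otimes>\<^bsub>G\<^esub> inv\<^bsub>G\<^esub> y \<otimes>\<^bsub>G\<^esub> z))"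

text \<open>In the application \<open>C\<close> relates two elements if their representatives lie in the same
  connected component.\<close>

locale disconnected_alg =
  fixes Q :: "('f, 'b) ualg" and C :: "('b \<times> 'b) set"
  assumes alg: "is_algebra Q" and fin: "finite (univ Q)" and idem: "idempotent_algebra Q"
    and simple: "simple_alg Q"
    and C_equiv: "equiv (univ Q) C" and C_proper: "\<exists>x\<in>univ Q. \<exists>y\<in>univ Q. (x, y) \<notin> C"
    and C_sub: "\<And>S. S \<subset> univ Q \<Longrightarrow> closed_under Q S \<Longrightarrow> S \<times> S \<subseteq> C"
begin

abbreviation "X \<equiv> univ Q"

lemma C_trans: "(x, y) \<in> C \<Longrightarrow> (y, z) \<in> C \<Longrightarrow> (x, z) \<in> C"
  using C_equiv by (meson equiv_def transD)

lemma C_sym: "(x, y) \<in> C \<Longrightarrow> (y, x) \<in> C"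
  using C_equiv by (meson equiv_def symD)

lemma closed_univ:
  assumes "closed_under Q S" "S \<subseteq> X" "a \<in> S" "b \<in> S" "(a, b) \<notin> C"
  shows "S = X"
  using C_sub[of S] assms by blast

lemma closed_fst: "compat2 Q W \<Longrightarrow> closed_under Q (fst ` W)"
  unfolding closed_under_def
proof (intro ballI)
  fix f xs assume W: "compat2 Q W" and f: "f \<in> syms Q" "xs \<in> tuples (fst ` W) (arity Q f)"
  then have "\<forall>x\<in>set xs. \<exists>y. (x, y) \<in> W" by (force simp: tuples_def)
  then obtain h where h: "\<And>x. x \<in> set xs \<Longrightarrow> (x, h x) \<in> W" by metis
  then have "list_all2 (\<lambda>x y. (x, y) \<in> W) xs (map h xs)" by (auto simp: list_all2_conv_all_nth)
  then have "(interp Q f xs, interp Q f (map h xs)) \<in> W"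
    using W f by (auto simp: compat2_def tuples_def)
  then show "interp Q f xs \<in> fst ` W" by force
qed

lemma closed_image:
  assumes "compat2 Q W" "x \<in> X"
  shows "closed_under Q (W `` {x})"
  unfolding closed_under_def
proof (intro ballI)
  fix f ys assume f: "f \<in> syms Q" "ys \<in> tuples (W `` {x}) (arity Q f)"
  then have "\<forall>y\<in>set ys. (x, y) \<in> W" "length ys = arity Q f" by (auto simp: tuples_def)
  then have "list_all2 (\<lambda>x y. (x, y) \<in> W) (replicate (arity Q f) x) ys"
    by (auto simp: list_all2_conv_all_nth)
  then have "(interp Q f (replicate (arity Q f) x), interp Q f ys) \<in> W"
    using assms(1) f by (auto simp: compat2_def)
  then show "interp Q f ys \<in> W `` {x}"
    using idem f(1) assms(2) by (simp add: idempotent_algebra_def)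
qed

text \<open>No \<open>W\<close>-neighbourhood contains both \<open>a\<close> and \<open>b\<close>, so each of them is a proper subuniverse
  and lies in one class of \<open>C\<close>. Hence the linkedness congruence of \<open>W\<close> is contained in \<open>C\<close>.\<close>

lemma single_valued_of_swap:
  assumes W: "W \<subseteq> X \<times> X" "compat2 Q W" "sym W"
    and ab: "(a, b) \<in> W" "(a, b) \<notin> C" "(a, a) \<notin> W" "(b, b) \<notin> W"
    and xy: "(x, y) \<in> W" "(x, y') \<in> W"
  shows "y = y'"
proof (rule ccontr)
  assume ne: "y \<noteq> y'"
  have abX: "a \<in> X" "b \<in> X" and ba: "(b, a) \<in> W" using ab(1) W by (auto dest: symD)
  have im_sub: "W `` {z} \<subseteq> X" for z using W(1) by auto
  have tot: "fst ` W = X"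
    by (rule closed_univ[OF closed_fst[OF W(2)] _ _ _ ab(2)]) (use W(1) ab(1) ba in force)+
  have one: "W `` {z} \<times> W `` {z} \<subseteq> C" if z: "z \<in> X" for z
  proof -
    \<comment> \<open>Otherwise \<open>z\<close> would share the neighbourhood of \<open>a\<close>
      with \<open>b\<close>, and that of \<open>b\<close> with \<open>a\<close>. These are proper
      subuniverses, as neither contains its own centre, so \<open>a\<close> and \<open>b\<close>
      would be related by \<open>C\<close>.\<close>
    have "\<not> (a \<in> W `` {z} \<and> b \<in> W `` {z})"
    proof
      assume h: "a \<in> W `` {z} \<and> b \<in> W `` {z}"
      then have za: "z \<in> W `` {a}" and zb: "z \<in> W `` {b}" using W(3) by (auto dest: symD)
      have "W `` {a} \<subset> X" "W `` {b} \<subset> X" using im_sub ab abX by auto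
      then have "W `` {a} \<times> W `` {a} \<subseteq> C" "W `` {b} \<times> W `` {b} \<subseteq> C"
        using C_sub closed_image[OF W(2)] abX by blast+
      then have "(z, b) \<in> C" "(a, z) \<in> C" using za zb ab(1) ba by blast+
      then show False using C_trans ab(2) by blast
    qed
    then have "W `` {z} \<subset> X" using im_sub abX by blast
    then show ?thesis using C_sub closed_image[OF W(2) z] by blast
  qed
  define L where "L = {(y, y'). \<exists>x. (x, y) \<in> W \<and> (x, y') \<in> W}"
  have LX: "L \<subseteq> X \<times> X" using W(1) by (auto simp: L_def)
  have LC: "L \<subseteq> C" using one W(1) by (fastforce simp: L_def)
  have Lpol: "(p u, p u') \<in> L" if p: "p \<in> Pol1 Q" and u: "(u, u') \<in> L" for p u u'
  proof -
    \<comment> \<open>\<open>p'\<close> is the same polynomial with each constant exchanged for a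
      \<open>W\<close>-neighbour, which exists by \<open>tot\<close>.\<close>
    have "\<exists>p'. \<forall>z u. (z, u) \<in> W \<longrightarrow> (p' z, p u) \<in> W"
      using p unfolding pols_def
    proof induction
      case (gen_base g)
      then consider "g = (\<lambda>x. x)" | c where "c \<in> X" "g = (\<lambda>_. c)" by auto
      then show ?case
      proof cases
        case 1
        then show ?thesis by auto
      next
        case 2
        then obtain d where "(d, c) \<in> W" using tot W(3) by (metis imageE prod.collapse symD)
        then show ?thesis using 2 by (intro exI[of _ "\<lambda>_. d"]) auto
      qed
    next
      case (gen_app f gs)
      then obtain P where P: "\<And>g. g \<in> set gs \<Longrightarrow> \<forall>z u. (z, u) \<in> W \<longrightarrow> (P g z, g u) \<in> W" by metis
      have "(interp Q f (map (\<lambda>g. P g z) gs), interp Q f (map (\<lambda>g. g u) gs)) \<in> W" if "(z, u) \<in> W" for z u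
      proof -
        have "list_all2 (\<lambda>x y. (x, y) \<in> W) (map (\<lambda>g. P g z) gs) (map (\<lambda>g. g u) gs)"
          using P that by (auto simp: list_all2_conv_all_nth)
        then show ?thesis using W(2) gen_app(1,2) unfolding compat2_def by simp
      qed
      then show ?case by (intro exI[of _ "\<lambda>z. interp Q f (map (\<lambda>g. P g z) gs)"]) simp
    qed
    then obtain p' where "\<And>z u. (z, u) \<in> W \<Longrightarrow> (p' z, p u) \<in> W" by blast
    then show ?thesis using u unfolding L_def by blast
  qed
  have Lrefl: "(z, z) \<in> L" if z: "z \<in> X" for z
  proof -
    have "z \<in> fst ` W" using tot z by simp
    then obtain w where "(z, w) \<in> W" by auto
    then show ?thesis using W(3) by (auto simp: L_def dest: symD)
  qed
  have "equiv X (L\<^sup>+)"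
  proof (rule equivI)
    show "L\<^sup>+ \<subseteq> X \<times> X" using LX by (rule trancl_subset_Sigma)
    show "refl_on X (L\<^sup>+)" using Lrefl by (auto simp: refl_on_def)
    have "sym L" by (auto simp: L_def sym_def)
    then show "sym (L\<^sup>+)" by (rule sym_trancl)
  qed simp
  moreover have "(p u, p u') \<in> L\<^sup>+" if p: "p \<in> Pol1 Q" and "(u, u') \<in> L\<^sup>+" for p u u'
    using that(2)
  proof induction
    case (base y)
    then show ?case using Lpol p by blast
  next
    case (step y z)
    then show ?case using Lpol p by (meson trancl.trancl_into_trancl)
  qed
  ultimately have "congruence Q (L\<^sup>+)" by (rule congruenceI_pol[OF alg])
  then have "L\<^sup>+ = Id_on X \<or> L\<^sup>+ = X \<times> X" using simple by (simp add: simple_alg_def)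
  moreover have "(y, y') \<in> L\<^sup>+" using xy by (auto simp: L_def)
  ultimately have "L\<^sup>+ = X \<times> X" using ne by auto
  moreover have "L\<^sup>+ \<subseteq> C"
  proof -
    have "L\<^sup>+ \<subseteq> C\<^sup>+" using LC by (rule trancl_mono_subset)
    then show ?thesis using C_equiv by (simp add: equiv_def trancl_id)
  qed
  ultimately show False using ab abX by blast
qed

text \<open>Stated for any set of terms that the basic operations preserve, because one application
  restricts the terms by a prescribed value.\<close>

lemma Tm_pair_compat2:
  assumes "\<And>F Fs. \<lbrakk>F \<in> syms Q; length Fs = arity Q F; \<forall>g\<in>set Fs. g \<in> T\<rbrakk> \<Longrightarrow>
      (\<lambda>v. interp Q F (map (\<lambda>g. g v) Fs)) \<in> T"
  shows "compat2 Q {(F v, F w) | F. F \<in> T}"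
  unfolding compat2_def
proof (intro ballI allI impI)
  fix f xs ys assume f: "f \<in> syms Q" "length xs = arity Q f"
    and l: "list_all2 (\<lambda>x y. (x, y) \<in> {(F v, F w) | F. F \<in> T}) xs ys"
  have "\<forall>i<length xs. \<exists>F. F \<in> T \<and> xs ! i = F v \<and> ys ! i = F w"
    using l by (auto simp: list_all2_conv_all_nth)
  then obtain F where F: "\<And>i. i < length xs \<Longrightarrow> F i \<in> T \<and> xs ! i = F i v \<and> ys ! i = F i w" by metis
  let ?Fs = "map F [0..<length xs]"
  have "(\<lambda>v. interp Q f (map (\<lambda>g. g v) ?Fs)) \<in> T" by (rule assms) (use f F in auto)
  moreover have "map (\<lambda>g. g v) ?Fs = xs" "map (\<lambda>g. g w) ?Fs = ys"
    using F l by (auto intro!: nth_equalityI simp: list_all2_conv_all_nth)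
  ultimately show "(interp Q f xs, interp Q f ys) \<in> {(F v, F w) | F. F \<in> T}"
    by (intro CollectI exI[of _ "\<lambda>v. interp Q f (map (\<lambda>g. g v) ?Fs)"]) (simp only: simp_thms)
qed

text \<open>Without a semilattice term \<open>R\<close> is a function exchanging \<open>a\<close>
  and \<open>b\<close>, so a term value \<open>a\<close> or \<open>b\<close> on a tuple over these
  two elements is exchanged along with the tuple. Three equations then suffice for a majority term,
  and the values of the meet are also known with its parameters swapped.\<close>

lemma meet_edge:
  assumes ab: "a \<in> X" "b \<in> X" "(a, b) \<notin> C" and p: "p \<in> Pol2 Q"
    and meet: "p (a, a) = a" "p (a, b) = a" "p (b, a) = a" "p (b, b) = b"
  shows "semilattice_pair Q a b \<or> majority_pair Q a b"
proof (rule ccontr)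
  assume "\<not> ?thesis"
  note neg = this[unfolded semilattice_pair_def majority_pair_def]
  have closedX: "closed_under Q X" using alg by (simp add: is_algebra_def)
  have TmX: "F v \<in> X" if "F \<in> Tm Q" "v \<in> vals X" for F v using Tm_closed[OF that(1) closedX that(2)] .
  note idT = idempotent_Tm[OF idem]
  have Tm_app: "(\<lambda>v. interp Q f (map (\<lambda>g. g v) gs)) \<in> Tm Q"
    if "f \<in> syms Q" "length gs = arity Q f" "\<forall>g\<in>set gs. g \<in> Tm Q" for f gs
    using gen_app[OF that(1,2)] that(3) unfolding Tm_def by blast
  have gensX: "\<exists>F\<in>Tm Q. c = F (v3 a b b)" if "c \<in> X" for c
  proof -
    let ?S = "{F (v3 a b b) | F. F \<in> Tm Q}"
    have "closed_under Q ?S" unfolding closed_under_def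
    proof (intro ballI)
      fix f xs assume f: "f \<in> syms Q" "xs \<in> tuples ?S (arity Q f)"
      then have "\<forall>x\<in>set xs. \<exists>F\<in>Tm Q. x = F (v3 a b b)" by (auto simp: tuples_def)
      then obtain F where F: "\<And>x. x \<in> set xs \<Longrightarrow> F x \<in> Tm Q \<and> x = F x (v3 a b b)" by metis
      have "(\<lambda>v. interp Q f (map (\<lambda>g. g v) (map F xs))) \<in> Tm Q"
        by (rule Tm_app) (use f F in \<open>auto simp: tuples_def\<close>)
      moreover have "map (\<lambda>g. g (v3 a b b)) (map F xs) = xs"
        using F by (auto intro!: map_idI)
      ultimately show "interp Q f xs \<in> ?S"
        by (intro CollectI exI[of _ "\<lambda>v. interp Q f (map (\<lambda>g. g v) (map F xs))"]) (simp only: simp_thms)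
    qed
    moreover have "?S \<subseteq> X" using TmX v3_vals[OF ab(1,2,2)] by blast
    moreover have "a \<in> ?S"
      by (intro CollectI exI[of _ "\<lambda>v. v 0"]) (simp add: Tm_var v3_def)
    moreover have "b \<in> ?S"
      by (intro CollectI exI[of _ "\<lambda>v. v 1"]) (simp add: Tm_var v3_def)
    ultimately have "?S = X" using closed_univ ab(3) by blast
    then show ?thesis using that by blast
  qed
  obtain m where m: "m \<in> Tm Q" "\<And>x y. p (x, y) = m (v4 x y a b)"
  proof -
    define \<gamma> where "\<gamma> i d = v4 (fst d) (snd d) a b i" for i and d :: "'b \<times> 'b"
    have \<gamma>: "\<gamma> 0 = fst" "\<gamma> 1 = snd" "\<gamma> 2 = (\<lambda>_. a)" "\<gamma> 3 = (\<lambda>_. b)"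
      by (auto simp: \<gamma>_def v4_def fun_eq_iff)
    have in_g: "\<gamma> i \<in> gen Q (range \<gamma>)" for i by (rule gen_base) simp
    have "(\<lambda>d. g ((\<lambda>x. x) d)) \<in> gen Q (range \<gamma>)" if g: "g \<in> {fst, snd} \<union> (\<lambda>c _. c) ` X" for g
    proof -
      from g consider "g = fst" | "g = snd" | c where "c \<in> X" "g = (\<lambda>_. c)" by auto
      then show ?thesis
      proof cases
        case 3
        then obtain F where F: "F \<in> Tm Q" "c = F (v3 a b b)" using gensX by blast
        have "(\<lambda>d. F (\<lambda>i. \<gamma> (if i = 0 then 2 else 3) d)) \<in> gen Q (range \<gamma>)"
          by (rule Tm_subst_gen[OF F(1)]) (rule in_g)
        moreover have "(\<lambda>i. \<gamma> (if i = 0 then 2 else 3) d) = v3 a b b" for d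
          by (auto simp: \<gamma>_def v4_def v3_def fun_eq_iff)
        ultimately show ?thesis using 3 F by simp
      qed (use in_g[of 0] in_g[of 1] \<gamma> in simp_all)
    qed
    from gen_precomp[OF p[unfolded pols_def], where \<rho> = "\<lambda>x. x", OF this]
    have "p \<in> gen Q (range \<gamma>)" by simp
    then obtain F where "F \<in> Tm Q" "p = (\<lambda>d. F (\<lambda>i. \<gamma> i d))" by (rule gen_rep)
    then show ?thesis using that[of F] by (simp add: \<gamma>_def)
  qed
  have ne: "a \<noteq> b" using ab C_equiv by (auto simp: equiv_def refl_on_def)
  define R where "R = {(F (v3 a b b), F (v3 b a a)) | F. F \<in> Tm Q}"
  have RI: "(x, y) \<in> R" if "F \<in> Tm Q" "F (v3 a b b) = x" "F (v3 b a a) = y" for F x y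
    unfolding R_def using that by blast
  have "compat2 Q R" unfolding R_def by (rule Tm_pair_compat2) (rule Tm_app)
  moreover have "sym R"
  proof (rule symI)
    fix x y assume "(x, y) \<in> R"
    then obtain F where F: "F \<in> Tm Q" "x = F (v3 a b b)" "y = F (v3 b a a)" by (auto simp: R_def)
    let ?F = "\<lambda>v. F (v3 (v 1) (v 0) (v 0))"
    have "?F \<in> Tm Q" by (intro Tm_v3_comp F(1) Tm_var)
    moreover have "?F (v3 a b b) = y" "?F (v3 b a a) = x" using F by (simp_all add: v3_def)
    ultimately show "(y, x) \<in> R" by (rule RI)
  qed
  moreover have "R \<subseteq> X \<times> X" using TmX[OF _ v3_vals[OF ab(1,2,2)]] TmX[OF _ v3_vals[OF ab(2,1,1)]]
    by (auto simp: R_def)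
  moreover have Rab: "(a, b) \<in> R" unfolding R_def
    by (intro CollectI exI[of _ "\<lambda>v. v 0"]) (simp add: Tm_var v3_def)
  moreover have "(a, a) \<notin> R" "(b, b) \<notin> R" using neg by (auto simp: R_def)
  ultimately have Rsv: "y = y'" if "(x, y) \<in> R" "(x, y') \<in> R" for x y y'
    using single_valued_of_swap ab(3) that by blast
  have Rba: "(b, a) \<in> R" using \<open>sym R\<close> Rab by (rule symD)
  \<comment> \<open>Swapping \<open>a\<close> and \<open>b\<close> in all arguments moves the value
    of a term along \<open>R\<close>, which is single-valued.\<close>
  have dual: "F w' = sw" if F: "F \<in> Tm Q" and w: "\<And>i. (w i, w' i) = (a, b) \<or> (w i, w' i) = (b, a)"
      and s: "(F w, sw) \<in> R" for F w w' sw
  proof -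
    let ?g = "\<lambda>i. if w i = a then (\<lambda>v. v 0) else (\<lambda>v. v 1)"
    have 1: "(\<lambda>v. F (\<lambda>i. ?g i v)) \<in> Tm Q" by (rule Tm_subst[OF F]) (auto intro: Tm_var)
    have 2: "(\<lambda>i. ?g i (v3 a b b)) = w" "(\<lambda>i. ?g i (v3 b a a)) = w'"
      using w ne by (fastforce simp: v3_def fun_eq_iff)+
    have "(F w, F w') \<in> R"
      by (rule RI[OF 1]) (rule arg_cong[where f = F], rule 2)+
    then show ?thesis using Rsv s by blast
  qed
  \<comment> \<open>The swap supplies the other three majority equations, and idempotence those on
    the diagonal.\<close>
  have maj: False if F: "F \<in> Tm Q" "F (v3 a a b) = a" "F (v3 a b a) = a" "F (v3 b a a) = a" for F
  proof -
    have "F (v3 b b a) = b" "F (v3 b a b) = b" "F (v3 a b b) = b"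
      by (rule dual[OF F(1), of "v3 a a b"] dual[OF F(1), of "v3 a b a"] dual[OF F(1), of "v3 b a a"];
          use F Rab in \<open>auto simp: v3_def\<close>)+
    moreover have "F (v3 a a a) = a" "F (v3 b b b) = b" using idT F ab by (auto simp: v3_def)
    ultimately show False using neg F by blast
  qed
  define T where "T = {F \<in> Tm Q. F (v3 a b a) = a}"
  define W where "W = {(F (v3 a a b), F (v3 b a a)) | F. F \<in> T}"
  have WI: "(x, y) \<in> W" if "F \<in> Tm Q" "F (v3 a b a) = a" "F (v3 a a b) = x" "F (v3 b a a) = y" for F x y
    unfolding W_def T_def using that by blast
  have "compat2 Q W" unfolding W_def
  proof (rule Tm_pair_compat2)
    fix f gs assume f: "f \<in> syms Q" "length gs = arity Q f" "\<forall>g\<in>set gs. g \<in> T"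
    have "map (\<lambda>g. g (v3 a b a)) gs = replicate (arity Q f) a"
      using f by (auto simp: T_def intro!: nth_equalityI)
    then have "interp Q f (map (\<lambda>g. g (v3 a b a)) gs) = a"
      using idem f(1) ab by (simp add: idempotent_algebra_def)
    then show "(\<lambda>v. interp Q f (map (\<lambda>g. g v) gs)) \<in> T" using Tm_app[OF f(1,2)] f(3) by (simp add: T_def)
  qed
  moreover have "sym W"
  proof (rule symI)
    fix x y assume "(x, y) \<in> W"
    then obtain F where F: "F \<in> Tm Q" "F (v3 a b a) = a" "x = F (v3 a a b)" "y = F (v3 b a a)"
      by (auto simp: W_def T_def)
    let ?F = "\<lambda>v. F (v3 (v 2) (v 1) (v 0))"
    have "?F \<in> Tm Q" by (intro Tm_v3_comp F(1) Tm_var)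
    moreover have "?F (v3 a b a) = a" "?F (v3 a a b) = y" "?F (v3 b a a) = x"
      using F by (simp_all add: v3_def)
    ultimately show "(y, x) \<in> W" by (rule WI)
  qed
  moreover have "W \<subseteq> X \<times> X" using TmX[OF _ v3_vals[OF ab(1,1,2)]] TmX[OF _ v3_vals[OF ab(2,1,1)]]
    by (auto simp: W_def T_def)
  moreover have "(a, b) \<in> W" unfolding W_def T_def
    by (intro CollectI exI[of _ "\<lambda>v. v 0"]) (simp add: Tm_var v3_def)
  moreover have "(a, a) \<notin> W"
  proof
    assume "(a, a) \<in> W"
    then obtain F where "F \<in> Tm Q" "F (v3 a b a) = a" "F (v3 a a b) = a" "F (v3 b a a) = a"
      by (auto simp: W_def T_def)
    then show False using maj by blast
  qed
  moreover have "(b, b) \<notin> W"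
  proof
    assume "(b, b) \<in> W"
    then obtain F where F: "F \<in> Tm Q" "F (v3 a b a) = a" "F (v3 a a b) = b" "F (v3 b a a) = b"
      by (auto simp: W_def T_def)
    have F': "F (v3 b b a) = a" "F (v3 a b b) = a"
      by (rule dual[OF F(1), of "v3 a a b"] dual[OF F(1), of "v3 b a a"];
          use F Rba in \<open>auto simp: v3_def\<close>)+
    have "F (v3 a a a) = a" using idT F ab by (auto simp: v3_def)
    \<comment> \<open>Inserting \<open>F\<close> into its own middle argument corrects the two
      values \<open>b\<close>, since F (a, b, b) and F (b, b, a) are \<open>a\<close> by the
      swap.\<close>
    let ?F = "\<lambda>v. F (v3 (v 0) (F (v3 (v 0) (v 1) (v 2))) (v 2))"
    have "?F \<in> Tm Q" by (intro Tm_v3_comp F(1) Tm_var)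
    moreover have "?F (v3 a a b) = a" "?F (v3 a b a) = a" "?F (v3 b a a) = a"
      using F F' \<open>F (v3 a a a) = a\<close> by (simp_all add: v3_simps)
    ultimately show False by (rule maj)
  qed
  ultimately have Wsv: "y = y'" if "(x, y) \<in> W" "(x, y') \<in> W" for x y y'
    using single_valued_of_swap ab(3) that by blast
  have m1: "m (v4 a a a b) = a" "m (v4 a b a b) = a" "m (v4 b a a b) = a" "m (v4 b b a b) = b"
    using m(2) meet by auto
  have m2: "m (v4 a b b a) = b" "m (v4 a a b a) = a"
    by (rule dual[OF m(1), of "v4 b a a b"] dual[OF m(1), of "v4 b b a b"];
        use m1 Rab Rba in \<open>auto simp: v4_def\<close>)+
  \<comment> \<open>The value \<open>al\<close> need not be known. Two substitution instances of
    \<open>m\<close> share it at (a, a, b) but take the values \<open>b\<close> and \<open>a\<close>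
    at (b, a, a), while both give \<open>a\<close> at (a, b, a).\<close>
  define al where "al = m (v4 b a a a)"
  have "(al, b) \<in> W"
  proof -
    let ?F = "\<lambda>v. m (v4 (v 2) (v 0) (v 0) (v 1))"
    have "?F \<in> Tm Q" by (intro Tm_v4_comp m(1) Tm_var)
    moreover have "?F (v3 a b a) = a" "?F (v3 a a b) = al" "?F (v3 b a a) = b"
      using m1 m2 by (simp_all add: v3_def al_def)
    ultimately show ?thesis by (rule WI)
  qed
  moreover have "(al, a) \<in> W"
  proof -
    let ?F = "\<lambda>v. m (v4 (v 2) (v 1) (v 0) (v 1))"
    have "?F \<in> Tm Q" by (intro Tm_v4_comp m(1) Tm_var)
    moreover have "?F (v3 a b a) = a" "?F (v3 a a b) = al" "?F (v3 b a a) = a"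
      using m1 m2 by (simp_all add: v3_def al_def)
    ultimately show ?thesis by (rule WI)
  qed
  ultimately show False using Wsv ne by blast
qed

end

text \<open>In the mixed case some polynomial image of \<open>U\<close> meets two classes of
  \<open>C\<close>, as otherwise \<open>connect\<close> would make \<open>C\<close> full; a left
  inverse carries the meet over to that image. In the affine case any pair outside \<open>C\<close>
  serves.\<close>

lemma simple_edge:
  fixes Q :: "('f, 'b) ualg"
  assumes dis: "disconnected_alg Q C" and min: "minset Q e U"
    and nonunary: "nonunary_on Q e U"
  shows "\<exists>a\<in>univ Q. \<exists>b\<in>univ Q. (a, b) \<notin> C \<and> (semilattice_pair Q a b \<or> majority_pair Q a b \<or> affine_alg Q)"
proof -
  interpret D: disconnected_alg Q C by (rule dis)
  interpret M: minset Q e U by (rule min)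
  obtain a b where ab: "a \<in> univ Q" "b \<in> univ Q" "(a, b) \<notin> C" using D.C_proper by blast
  show ?thesis
  proof (cases M.mixed)
    case True
    then obtain u v m where uv: "u \<in> U" "v \<in> U" "u \<noteq> v" "U = {u, v}" and m: "m \<in> Pol2 Q"
      "m (u, u) = u" "m (u, v) = u" "m (v, u) = u" "m (v, v) = v" by (rule M.mixed_meet)
    have "\<exists>f\<in>Pol1 Q. (f u, f v) \<notin> C"
    proof (rule ccontr)
      assume "\<not> ?thesis"
      then have fC: "(f u, f v) \<in> C" if "f \<in> Pol1 Q" for f using that by blast
      have "(g x, g y) \<in> C" if g: "g \<in> Pol1 Q" and "x \<in> U" "y \<in> U" for g x y
      proof -
        have "(w, w) \<in> C" if "w \<in> univ Q" for w
          using D.C_equiv that by (auto simp: equiv_def refl_on_def)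
        then have "(g u, g u) \<in> C" "(g v, g v) \<in> C"
          using Pol1_closed[OF g M.alg] M.UX uv by auto
        then show ?thesis using that uv(4) fC[OF g] D.C_sym by auto
      qed
      then have "(a, b) \<in> C" using M.connect[OF D.C_equiv] ab by blast
      then show False using ab by simp
    qed
    then obtain f where f: "f \<in> Pol1 Q" "(f u, f v) \<notin> C" by blast
    have fX: "f u \<in> univ Q" "f v \<in> univ Q" using Pol1_closed[OF f(1) M.alg] M.UX uv by auto
    have "f u \<noteq> f v" using f D.C_equiv fX by (auto simp: equiv_def refl_on_def)
    then obtain g where g: "g \<in> Pol1 Q" "\<And>x. x \<in> U \<Longrightarrow> g (f x) = x"
      using M.left_inverse[OF f(1) uv(1,2)] by blast
    let ?p = "\<lambda>d. f (m (g (fst d), g (snd d)))"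
    have "?p \<in> Pol2 Q"
      by (intro pols_comp1[OF f(1)] pols_comp2[OF m(1)] pols_comp1[OF g(1)] pols_base) auto
    then have "semilattice_pair Q (f u) (f v) \<or> majority_pair Q (f u) (f v)"
      by (rule D.meet_edge[OF fX f(2)]) (use g uv m in simp_all)
    then show ?thesis by (intro bexI[OF _ fX(1)] bexI[OF _ fX(2)] conjI f(2)) blast
  next
    case False
    then interpret A: affine_minset Q e U by unfold_locales (use nonunary in auto)
    have "affine_alg Q" unfolding affine_alg_def using A.affine by metis
    then show ?thesis using ab by blast
  qed
qed

section \<open>Terms and polynomials as operations on tuples\<close>

lemma map_vals_tuples: "v \<in> vals S \<Longrightarrow> map v [0..<n] \<in> tuples S n"
  by (auto simp: tuples_def vals_def)

lemma term_ops_Tm: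
  assumes "t \<in> term_ops A n"
  obtains F where "F \<in> Tm A" "\<And>v. v \<in> vals (univ A) \<Longrightarrow> t (map v [0..<n]) = F v"
proof -
  have "\<exists>F\<in>Tm A. \<forall>v\<in>vals (univ A). t (map v [0..<n]) = F v"
    using assms
  proof induction
    case (proj i)
    then show ?case by (intro bexI[OF _ Tm_var[of i]]) (simp add: map_vals_tuples)
  next
    case (comp f gs)
    then obtain \<Phi> where \<Phi>: "\<And>g. g \<in> set gs \<Longrightarrow> \<Phi> g \<in> Tm A \<and> (\<forall>v\<in>vals (univ A). g (map v [0..<n]) = \<Phi> g v)"
      by metis
    have "(\<lambda>v. interp A f (map (\<lambda>g. g v) (map \<Phi> gs))) \<in> Tm A"
      unfolding Tm_def by (rule gen_app) (use comp \<Phi> in \<open>auto simp: Tm_def\<close>)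
    then show ?case
      by (intro bexI[of _ "\<lambda>v. interp A f (map (\<lambda>g. g v) (map \<Phi> gs))"] ballI)
        (auto simp: map_vals_tuples \<Phi> intro!: arg_cong[where f = "interp A f"])
  qed
  then show ?thesis using that by blast
qed

text \<open>The variables of \<open>F\<close> beyond the arity are all identified with the last
  argument, hence the minimum with \<open>n - 1\<close> and a positive \<open>n\<close>.\<close>

lemma Tm_term_ops:
  assumes "F \<in> Tm A" "0 < n"
  obtains t where "t \<in> term_ops A n" "\<And>xs. xs \<in> tuples (univ A) n \<Longrightarrow> t xs = F (\<lambda>i. xs ! min i (n - 1))"
proof -
  have "\<exists>t\<in>term_ops A n. \<forall>xs\<in>tuples (univ A) n. t xs = F (\<lambda>i. xs ! min i (n - 1))"
    using assms(1) unfolding Tm_def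
  proof induction
    case (gen_base g)
    then obtain i where "g = (\<lambda>v. v i)" by auto
    moreover have "min i (n - 1) < n" using assms(2) by auto
    ultimately show ?case by (intro bexI[OF _ term_ops.proj[of "min i (n - 1)"]]) auto
  next
    case (gen_app f gs)
    then obtain \<Phi> where \<Phi>: "\<And>g. g \<in> set gs \<Longrightarrow> \<Phi> g \<in> term_ops A n \<and>
        (\<forall>xs\<in>tuples (univ A) n. \<Phi> g xs = g (\<lambda>i. xs ! min i (n - 1)))"
      by metis
    have "(\<lambda>xs\<in>tuples (univ A) n. interp A f (map (\<lambda>g. g xs) (map \<Phi> gs))) \<in> term_ops A n"
      by (rule term_ops.comp) (use gen_app \<Phi> in auto)
    then show ?case
      by (intro bexI[of _ "\<lambda>xs\<in>tuples (univ A) n. interp A f (map (\<lambda>g. g xs) (map \<Phi> gs))"] ballI)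
        (auto simp: \<Phi> intro!: arg_cong[where f = "interp A f"])
  qed
  then show ?thesis using that by blast
qed

lemma pol_ops_PolV:
  assumes "p \<in> pol_ops A n" "univ A \<noteq> {}"
  obtains F where "F \<in> PolV A" "\<And>v. v \<in> vals (univ A) \<Longrightarrow> p (map v [0..<n]) = F v"
proof -
  obtain t cs k where t: "t \<in> term_ops A (n + k)" "cs \<in> tuples (univ A) k"
    and p: "p = (\<lambda>xs\<in>tuples (univ A) n. t (xs @ cs))"
    using assms(1) unfolding pol_ops_def by blast
  obtain T where T: "T \<in> Tm A" "\<And>v. v \<in> vals (univ A) \<Longrightarrow> t (map v [0..<n + k]) = T v"
    using term_ops_Tm[OF t(1)] by blast
  obtain c where c: "c \<in> univ A" using assms(2) by blast
  have cs: "length cs = k" "\<And>i. i < k \<Longrightarrow> cs ! i \<in> univ A" using t(2) by (auto simp: tuples_def)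
  define \<gamma> where "\<gamma> i = (if i < n then (\<lambda>v. v i) else if i < n + k then (\<lambda>_. cs ! (i - n)) else (\<lambda>_. c))"
    for i :: nat
  have "(\<lambda>v. T (\<lambda>i. \<gamma> i v)) \<in> PolV A"
    by (rule pols_compV[OF subsetD[OF Tm_PolV T(1)]])
      (use cs c in \<open>auto simp: \<gamma>_def intro: pols_base pols_const\<close>)
  moreover have "p (map v [0..<n]) = T (\<lambda>i. \<gamma> i v)" if v: "v \<in> vals (univ A)" for v
  proof -
    have "(\<lambda>i. \<gamma> i v) \<in> vals (univ A)" using v c cs by (auto simp: \<gamma>_def vals_def)
    moreover have "map v [0..<n] @ cs = map (\<lambda>i. \<gamma> i v) [0..<n + k]"
      by (rule nth_equalityI) (auto simp: \<gamma>_def nth_append cs)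
    ultimately show ?thesis using T(2) map_vals_tuples[OF v] by (simp add: p)
  qed
  ultimately show ?thesis using that by blast
qed

text \<open>Variables from \<open>n\<close> on are first fixed at \<open>c\<close>. What remains is
  a term in \<open>n\<close> variables followed by an enumeration of the universe, the shape that
  \<open>pol_ops\<close> prescribes.\<close>

lemma PolV_pol_ops:
  assumes "F \<in> PolV A" "c \<in> univ A" "finite (univ A)"
  obtains p where "p \<in> pol_ops A n"
    "\<And>xs. xs \<in> tuples (univ A) n \<Longrightarrow> p xs = F (\<lambda>i. if i < n then xs ! i else c)"
proof -
  define \<gamma> where "\<gamma> i = (if i < n then (\<lambda>v. v i) else (\<lambda>_. from_nat_into (univ A) (i - n)))" for i :: nat
  have const: "(\<lambda>_. k) \<in> range \<gamma>" if k: "k \<in> univ A" for k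
  proof -
    obtain i where "from_nat_into (univ A) i = k"
      using k assms(3) by (meson countable_finite from_nat_into_surj)
    then have "(\<lambda>_. k) = \<gamma> (i + n)" by (auto simp: \<gamma>_def fun_eq_iff)
    then show ?thesis by blast
  qed
  have var: "(\<lambda>v. v i) \<in> range \<gamma>" if "i < n" for i
    using that by (intro image_eqI[of _ _ i]) (auto simp: \<gamma>_def)
  let ?\<rho> = "\<lambda>(v :: nat \<Rightarrow> 'a) i. if i < n then v i else c"
  have "(\<lambda>v. g (?\<rho> v)) \<in> gen A (range \<gamma>)" if "g \<in> range (\<lambda>i v. v i) \<union> (\<lambda>c _. c) ` univ A" for g
  proof -
    from that consider i where "g = (\<lambda>v. v i)" | k where "k \<in> univ A" "g = (\<lambda>_. k)" by auto
    then show ?thesis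
    proof cases
      case 1
      then show ?thesis using var const[OF assms(2)] by (cases "i < n") (auto intro: gen_base)
    next
      case 2
      then show ?thesis using const by (auto intro: gen_base)
    qed
  qed
  from gen_precomp[where \<rho> = ?\<rho>, OF assms(1)[unfolded pols_def] this]
  have "(\<lambda>v. F (?\<rho> v)) \<in> gen A (range \<gamma>)" .
  then obtain T where T: "T \<in> Tm A" "(\<lambda>v. F (?\<rho> v)) = (\<lambda>v. T (\<lambda>i. \<gamma> i v))" by (rule gen_rep)
  obtain N where N: "\<And>v w. (\<And>i. i < N \<Longrightarrow> v i = w i) \<Longrightarrow> T v = T w"
    using PolV_finite_dep[OF subsetD[OF Tm_PolV T(1)]] by blast
  \<comment> \<open>\<open>T\<close> reads only variables below \<open>N\<close>, so cutting off at
    \<open>n + k - 1\<close> affects none of them; the successor keeps \<open>n + k\<close>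
    positive.\<close>
  define k where "k = Suc N"
  obtain t where t: "t \<in> term_ops A (n + k)"
    "\<And>xs. xs \<in> tuples (univ A) (n + k) \<Longrightarrow> t xs = T (\<lambda>i. xs ! min i (n + k - 1))"
    using Tm_term_ops[OF T(1), of "n + k"] by (auto simp: k_def)
  define cs where "cs = map (from_nat_into (univ A)) [0..<k]"
  have cs: "cs \<in> tuples (univ A) k"
    using assms(2) from_nat_into[of "univ A"] by (auto simp: cs_def tuples_def)
  let ?p = "\<lambda>xs\<in>tuples (univ A) n. t (xs @ cs)"
  have "?p \<in> pol_ops A n" unfolding pol_ops_def using t(1) cs by blast
  moreover have "?p xs = F (\<lambda>i. if i < n then xs ! i else c)" if xs: "xs \<in> tuples (univ A) n" for xs
  proof -
    have "xs @ cs \<in> tuples (univ A) (n + k)" using xs cs by (auto simp: tuples_def)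
    then have "t (xs @ cs) = T (\<lambda>i. (xs @ cs) ! min i (n + k - 1))" by (rule t(2))
    also have "\<dots> = T (\<lambda>i. \<gamma> i ((!) xs))"
    proof (rule N)
      fix i assume i: "i < N"
      have len: "length xs = n" using xs by (simp add: tuples_def)
      have "min i (n + k - 1) = i" "i - n < k" using i by (auto simp: k_def)
      then show "(xs @ cs) ! min i (n + k - 1) = \<gamma> i ((!) xs)"
        using len by (cases "i < n") (simp_all add: nth_append \<gamma>_def cs_def)
    qed
    also have "\<dots> = F (?\<rho> ((!) xs))" using fun_cong[OF T(2), of "(!) xs"] by simp
    finally show ?thesis using xs by simp
  qed
  ultimately show ?thesis using that by blast
qed

lemma pol_ops1_iff:
  assumes "univ A \<noteq> {}" "finite (univ A)"
  shows "p \<in> pol_ops A 1 \<Longrightarrow> \<exists>P\<in>Pol1 A. \<forall>x\<in>univ A. p [x] = P x"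
    and "P \<in> Pol1 A \<Longrightarrow> \<exists>p\<in>pol_ops A 1. \<forall>x\<in>univ A. p [x] = P x"
proof -
  assume "p \<in> pol_ops A 1"
  then obtain F where F: "F \<in> PolV A" "\<And>v. v \<in> vals (univ A) \<Longrightarrow> p (map v [0..<1]) = F v"
    using pol_ops_PolV[OF _ assms(1)] by blast
  have "(\<lambda>x. F (\<lambda>_. x)) \<in> Pol1 A"
    using pols_compV[OF F(1), of "\<lambda>_ x. x" "{\<lambda>x. x}"] by (simp add: pols_base)
  moreover have "p [x] = F (\<lambda>_. x)" if "x \<in> univ A" for x
    using F(2)[of "\<lambda>_. x"] that by (simp add: vals_def)
  ultimately show "\<exists>P\<in>Pol1 A. \<forall>x\<in>univ A. p [x] = P x"
    by (intro bexI[of _ "\<lambda>x. F (\<lambda>_. x)"]) auto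
next
  assume P: "P \<in> Pol1 A"
  obtain c where c: "c \<in> univ A" using assms(1) by blast
  have "(\<lambda>v. P (v 0)) \<in> PolV A" by (rule pols_comp1[OF P pols_base]) auto
  then obtain p where "p \<in> pol_ops A 1"
    "\<And>xs. xs \<in> tuples (univ A) 1 \<Longrightarrow> p xs = P (if 0 < (1::nat) then xs ! 0 else c)"
    using PolV_pol_ops[OF _ c assms(2), of "\<lambda>v. P (v 0)" 1] by blast
  then show "\<exists>p\<in>pol_ops A 1. \<forall>x\<in>univ A. p [x] = P x" by (intro bexI[of _ p]) (auto simp: tuples_def)
qed

section \<open>Factor algebras\<close>

lemma listset_blocks:
  "listset (map (\<lambda>x. \<theta> `` {x}) xs) = {ys. list_all2 (\<lambda>x y. (x, y) \<in> \<theta>) xs ys}"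
proof (induction xs)
  case (Cons x xs)
  show ?case
  proof (rule Set.set_eqI)
    fix ys
    show "ys \<in> listset (map (\<lambda>x. \<theta> `` {x}) (x # xs)) \<longleftrightarrow> ys \<in> {ys. list_all2 (\<lambda>x y. (x, y) \<in> \<theta>) (x # xs) ys}"
      by (cases ys) (auto simp: Cons.IH set_Cons_def)
  qed
qed simp

lemma op_mod_blocks:
  assumes "equiv S \<theta>" "set xs \<subseteq> S"
    and "\<And>ys. list_all2 (\<lambda>x y. (x, y) \<in> \<theta>) xs ys \<Longrightarrow> (t xs, t ys) \<in> \<theta>"
  shows "op_mod \<theta> t (map (\<lambda>x. \<theta> `` {x}) xs) = \<theta> `` {t xs}"
proof -
  have "list_all2 (\<lambda>x y. (x, y) \<in> \<theta>) xs xs"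
    using assms(1,2) by (auto simp: list_all2_same equiv_def refl_on_def)
  moreover have "\<theta> `` {t ys} = \<theta> `` {t xs}" if "list_all2 (\<lambda>x y. (x, y) \<in> \<theta>) xs ys" for ys
    using equiv_class_eq[OF assms(1) assms(3)[OF that]] by simp
  ultimately show ?thesis unfolding op_mod_def listset_blocks by blast
qed

lemma gen_congruence:
  assumes "h \<in> pols A G" "congruence A \<alpha>" "\<And>g. g \<in> G \<Longrightarrow> (g d, g d') \<in> \<alpha>"
  shows "(h d, h d') \<in> \<alpha>"
  using assms(1) unfolding pols_def
proof (rule gen_compat2)
  show "compat2 A \<alpha>" by (rule congruence_compat2[OF assms(2)])
  show "(g d, g d') \<in> \<alpha>" if "g \<in> G \<union> (\<lambda>c _. c) ` univ A" for g
    using that assms(2,3) by (auto simp: congruence_def equiv_def refl_on_def)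
qed

locale factor =
  fixes B :: "('f, 'a) ualg" and \<alpha> :: "('a \<times> 'a) set"
  assumes alg: "is_algebra B" and cong: "congruence B \<alpha>"
begin

abbreviation "X \<equiv> univ B"
abbreviation "Q \<equiv> factor_alg B \<alpha>"
abbreviation "blk x \<equiv> \<alpha> `` {x}"

lemma \<alpha>_equiv: "equiv X \<alpha>"
  using cong by (simp add: congruence_def)

lemma blk_eq: "x \<in> X \<Longrightarrow> y \<in> X \<Longrightarrow> blk x = blk y \<longleftrightarrow> (x, y) \<in> \<alpha>"
  using eq_equiv_class_iff[OF \<alpha>_equiv] by blast

lemma Q_simps: "univ Q = blk ` X" "syms Q = syms B" "arity Q = arity B"
  by (auto simp: factor_alg_def quotient_def)

lemma closedX: "closed_under B X"
  using alg by (simp add: is_algebra_def)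

lemma interp_Q:
  assumes "f \<in> syms B" "xs \<in> tuples X (arity B f)"
  shows "interp Q f (map blk xs) = blk (interp B f xs)"
proof -
  have "op_mod \<alpha> (interp B f) (map blk xs) = blk (interp B f xs)"
  proof (rule op_mod_blocks[OF \<alpha>_equiv])
    show "set xs \<subseteq> X" using assms(2) by (simp add: tuples_def)
    show "(interp B f xs, interp B f ys) \<in> \<alpha>" if "list_all2 (\<lambda>x y. (x, y) \<in> \<alpha>) xs ys" for ys
      using congruence_compat2[OF cong] assms that by (auto simp: compat2_def tuples_def)
  qed
  then show ?thesis by (simp add: factor_alg_def)
qed

lemma tuples_Q:
  assumes "ys \<in> tuples (univ Q) n"
  obtains xs where "xs \<in> tuples X n" "ys = map blk xs"
proof -
  have "\<forall>y\<in>set ys. \<exists>x. x \<in> X \<and> y = blk x" using assms by (auto simp: tuples_def Q_simps)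
  then obtain r where r: "\<And>y. y \<in> set ys \<Longrightarrow> r y \<in> X \<and> y = blk (r y)" by metis
  have "map blk (map r ys) = ys" using r by (auto simp: map_idI)
  then show ?thesis using that[of "map r ys"] r assms by (auto simp: tuples_def)
qed

lemma Q_alg: "is_algebra Q"
  unfolding is_algebra_def
proof
  show "univ Q \<noteq> {}" using alg by (simp add: Q_simps is_algebra_def)
  show "closed_under Q (univ Q)" unfolding closed_under_def
  proof (intro ballI)
    fix f ys assume f: "f \<in> syms Q" "ys \<in> tuples (univ Q) (arity Q f)"
    obtain xs where "xs \<in> tuples X (arity B f)" "ys = map blk xs"
      using tuples_Q[of ys] f by (auto simp: Q_simps(3))
    then show "interp Q f ys \<in> univ Q"
      using interp_Q f closedX by (auto simp: Q_simps closed_under_def)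
  qed
qed

lemma Q_fin: "finite X \<Longrightarrow> finite (univ Q)"
  by (simp add: Q_simps)

lemma Q_idem:
  assumes "idempotent_algebra B" shows "idempotent_algebra Q"
  unfolding idempotent_algebra_def
proof (intro ballI)
  fix f y assume f: "f \<in> syms Q" and "y \<in> univ Q"
  then obtain x where x: "x \<in> X" "y = blk x" by (auto simp: Q_simps)
  have "interp Q f (map blk (replicate (arity B f) x)) = blk (interp B f (replicate (arity B f) x))"
    by (rule interp_Q) (use f x in \<open>auto simp: Q_simps tuples_def\<close>)
  then show "interp Q f (replicate (arity Q f) y) = y"
    using assms f x by (simp add: idempotent_algebra_def Q_simps)
qed

lemma closed_preimage:
  assumes "closed_under Q S"
  shows "closed_under B {x \<in> X. blk x \<in> S}"
  unfolding closed_under_def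
proof (intro ballI)
  fix f xs assume f: "f \<in> syms B" "xs \<in> tuples {x \<in> X. blk x \<in> S} (arity B f)"
  then have xs: "xs \<in> tuples X (arity B f)" "map blk xs \<in> tuples S (arity Q f)"
    by (auto simp: tuples_def Q_simps)
  have "interp Q f (map blk xs) \<in> S"
    using assms f(1) xs(2) unfolding closed_under_def Q_simps by blast
  then have "blk (interp B f xs) \<in> S" using interp_Q[OF f(1) xs(1)] by simp
  then show "interp B f xs \<in> {x \<in> X. blk x \<in> S}" using closedX f(1) xs(1) by (simp add: closed_under_def)
qed

text \<open>The preimage \<gamma> of a congruence of the factor lies between \<alpha> and the full
  relation, so it is one of the two.\<close>

lemma Q_simple:
  assumes "prime_quotient B \<alpha> (X \<times> X)"
  shows "simple_alg Q"
  unfolding simple_alg_def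
proof (intro allI impI)
  fix \<theta> assume \<theta>: "congruence Q \<theta>"
  define \<gamma> where "\<gamma> = {(x, y). x \<in> X \<and> y \<in> X \<and> (blk x, blk y) \<in> \<theta>}"
  have eq: "equiv (univ Q) \<theta>" using \<theta> by (simp add: congruence_def)
  have blkQ: "blk x \<in> univ Q" if "x \<in> X" for x using that by (auto simp: Q_simps)
  have "congruence B \<gamma>" unfolding congruence_def
  proof (intro conjI ballI impI)
    show "equiv X \<gamma>"
    proof (rule equivI)
      show "\<gamma> \<subseteq> X \<times> X" by (auto simp: \<gamma>_def)
      show "refl_on X \<gamma>" using eq blkQ by (auto simp: \<gamma>_def equiv_def refl_on_def)
      show "sym \<gamma>" using eq by (auto simp: \<gamma>_def equiv_def sym_def)
      show "trans \<gamma>" using eq unfolding \<gamma>_def equiv_def trans_def by blast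
    qed
    fix f xs ys assume f: "f \<in> syms B" and xs: "xs \<in> tuples X (arity B f)" "ys \<in> tuples X (arity B f)"
      and l: "list_all2 (\<lambda>x y. (x, y) \<in> \<gamma>) xs ys"
    have "list_all2 (\<lambda>x y. (x, y) \<in> \<theta>) (map blk xs) (map blk ys)"
      using l by (auto simp: list_all2_conv_all_nth \<gamma>_def)
    then have "(interp Q f (map blk xs), interp Q f (map blk ys)) \<in> \<theta>"
      using congruence_compat2[OF \<theta>] f xs by (auto simp: compat2_def Q_simps tuples_def)
    then have "(blk (interp B f xs), blk (interp B f ys)) \<in> \<theta>" using interp_Q f xs by simp
    then show "(interp B f xs, interp B f ys) \<in> \<gamma>"
      using closedX f xs by (simp add: \<gamma>_def closed_under_def)
  qed
  moreover have "\<alpha> \<subseteq> \<gamma>"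
  proof
    fix z assume z: "z \<in> \<alpha>"
    obtain x y where xy: "z = (x, y)" by force
    have X: "x \<in> X" "y \<in> X" using \<alpha>_equiv z xy by (auto simp: equiv_def)
    then have "blk x = blk y" using z xy blk_eq by simp
    then show "z \<in> \<gamma>" using X xy blkQ eq by (auto simp: \<gamma>_def equiv_def refl_on_def)
  qed
  moreover have "\<gamma> \<subseteq> X \<times> X" by (auto simp: \<gamma>_def)
  ultimately have "\<gamma> = \<alpha> \<or> \<gamma> = X \<times> X" using assms unfolding prime_quotient_def by blast
  moreover have \<theta>sub: "\<theta> \<subseteq> univ Q \<times> univ Q" using eq by (auto simp: equiv_def)
  have "\<theta> = Id_on (univ Q)" if "\<gamma> = \<alpha>"
  proof
    show "\<theta> \<subseteq> Id_on (univ Q)"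
    proof
      fix z assume z: "z \<in> \<theta>"
      then obtain x y where xy: "z = (blk x, blk y)" "x \<in> X" "y \<in> X" using \<theta>sub by (auto simp: Q_simps)
      then have "(x, y) \<in> \<alpha>" using that z by (auto simp: \<gamma>_def)
      then have "blk x = blk y" using blk_eq xy by simp
      then show "z \<in> Id_on (univ Q)" using xy blkQ by auto
    qed
    show "Id_on (univ Q) \<subseteq> \<theta>" using eq by (auto simp: equiv_def refl_on_def)
  qed
  moreover have "\<theta> = univ Q \<times> univ Q" if "\<gamma> = X \<times> X"
  proof
    show "univ Q \<times> univ Q \<subseteq> \<theta>" using that by (auto simp: \<gamma>_def Q_simps)
  qed (rule \<theta>sub)
  ultimately show "\<theta> = Id_on (univ Q) \<or> \<theta> = univ Q \<times> univ Q" by blast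
qed

text \<open>\<open>D\<close> consists of points at which the generators take values in the universe,
  and \<delta> translates them into points over \<open>Q\<close>. Elements of \<open>gen\<close> are
  total functions, about which nothing is claimed outside \<open>D\<close>.\<close>

lemma gen_down:
  assumes "h \<in> gen B G" "\<And>g. g \<in> G \<Longrightarrow> \<exists>g'\<in>G'. \<forall>d\<in>D. g d \<in> X \<and> g' (\<delta> d) = blk (g d)"
  shows "\<exists>h'\<in>gen Q G'. \<forall>d\<in>D. h d \<in> X \<and> h' (\<delta> d) = blk (h d)"
  using assms(1)
proof induction
  case (gen_base g)
  then show ?case using assms(2) by (meson gen.gen_base)
next
  case (gen_app f gs)
  then obtain \<Phi> where \<Phi>: "\<And>g. g \<in> set gs \<Longrightarrow> \<Phi> g \<in> gen Q G' \<and> (\<forall>d\<in>D. g d \<in> X \<and> \<Phi> g (\<delta> d) = blk (g d))"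
    by metis
  let ?h' = "\<lambda>d. interp Q f (map (\<lambda>g. g d) (map \<Phi> gs))"
  have "?h' \<in> gen Q G'" by (rule gen.gen_app) (use gen_app \<Phi> in \<open>auto simp: Q_simps\<close>)
  moreover have "interp B f (map (\<lambda>g. g d) gs) \<in> X \<and> ?h' (\<delta> d) = blk (interp B f (map (\<lambda>g. g d) gs))"
    if d: "d \<in> D" for d
  proof -
    have t: "map (\<lambda>g. g d) gs \<in> tuples X (arity B f)" using \<Phi> d gen_app(2) by (auto simp: tuples_def)
    have "map (\<lambda>g. g (\<delta> d)) (map \<Phi> gs) = map blk (map (\<lambda>g. g d) gs)" using \<Phi> d by auto
    moreover have "interp B f (map (\<lambda>g. g d) gs) \<in> X"
      using closedX gen_app(1) t unfolding closed_under_def by blast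
    ultimately show ?thesis using interp_Q[OF gen_app(1) t] by (simp only:)
  qed
  ultimately show ?case by (intro bexI[where x = ?h'] ballI)
qed

lemma gen_up:
  assumes "h' \<in> gen Q G'" "\<And>g'. g' \<in> G' \<Longrightarrow> \<exists>g\<in>G. \<forall>d\<in>D. g d \<in> X \<and> g' (\<delta> d) = blk (g d)"
  shows "\<exists>h\<in>gen B G. \<forall>d\<in>D. h d \<in> X \<and> h' (\<delta> d) = blk (h d)"
  using assms(1)
proof induction
  case (gen_base g)
  then show ?case using assms(2) by (meson gen.gen_base)
next
  case (gen_app f gs)
  then obtain \<Phi> where \<Phi>: "\<And>g. g \<in> set gs \<Longrightarrow> \<Phi> g \<in> gen B G \<and> (\<forall>d\<in>D. \<Phi> g d \<in> X \<and> g (\<delta> d) = blk (\<Phi> g d))"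
    by metis
  let ?h = "\<lambda>d. interp B f (map (\<lambda>g. g d) (map \<Phi> gs))"
  have f: "f \<in> syms B" using gen_app by (simp add: Q_simps)
  have "?h \<in> gen B G" by (rule gen.gen_app) (use gen_app \<Phi> in \<open>auto simp: Q_simps\<close>)
  moreover have "?h d \<in> X \<and> interp Q f (map (\<lambda>g. g (\<delta> d)) gs) = blk (?h d)"
    if d: "d \<in> D" for d
  proof -
    have t: "map (\<lambda>g. g d) (map \<Phi> gs) \<in> tuples X (arity B f)"
      using \<Phi> d gen_app(2) by (auto simp: tuples_def Q_simps)
    have "map (\<lambda>g. g (\<delta> d)) gs = map blk (map (\<lambda>g. g d) (map \<Phi> gs))" using \<Phi> d by auto
    moreover have "?h d \<in> X" using closedX f t unfolding closed_under_def by blast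
    ultimately show ?thesis using interp_Q[OF f t] by (simp only:)
  qed
  ultimately show ?case by (intro bexI[where x = ?h] ballI)
qed

lemma Tm_up:
  assumes "F' \<in> Tm Q"
  obtains F where "F \<in> Tm B" "\<And>v. v \<in> vals X \<Longrightarrow> F' (\<lambda>i. blk (v i)) = blk (F v)"
proof -
  have "\<exists>F\<in>Tm B. \<forall>v\<in>vals X. F v \<in> X \<and> F' (\<lambda>i. blk (v i)) = blk (F v)"
    unfolding Tm_def by (rule gen_up[OF assms[unfolded Tm_def]]) (auto simp: vals_def)
  then show ?thesis using that by blast
qed

lemma PolV_down:
  assumes "F \<in> PolV B"
  obtains F' where "F' \<in> PolV Q" "\<And>v. v \<in> vals X \<Longrightarrow> F' (\<lambda>i. blk (v i)) = blk (F v)"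
proof -
  have "\<exists>F'\<in>PolV Q. \<forall>v\<in>vals X. F v \<in> X \<and> F' (\<lambda>i. blk (v i)) = blk (F v)"
    unfolding pols_def
    by (rule gen_down[OF assms[unfolded pols_def]]) (auto simp: vals_def Q_simps)
  then show ?thesis using that by blast
qed

lemma Pol1_down:
  assumes "P \<in> Pol1 B"
  obtains P' where "P' \<in> Pol1 Q" "\<And>x. x \<in> X \<Longrightarrow> P' (blk x) = blk (P x)"
proof -
  have "\<exists>P'\<in>Pol1 Q. \<forall>x\<in>X. P x \<in> X \<and> P' (blk x) = blk (P x)"
    unfolding pols_def
    by (rule gen_down[OF assms[unfolded pols_def]]) (auto simp: Q_simps)
  then show ?thesis using that by blast
qed

lemma Pol1_up:
  assumes "P' \<in> Pol1 Q"
  obtains P where "P \<in> Pol1 B" "\<And>x. x \<in> X \<Longrightarrow> P' (blk x) = blk (P x)"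
proof -
  have "\<exists>P\<in>Pol1 B. \<forall>x\<in>X. P x \<in> X \<and> P' (blk x) = blk (P x)"
    unfolding pols_def
    by (rule gen_up[OF assms[unfolded pols_def]]) (auto simp: Q_simps)
  then show ?thesis using that by blast
qed

end

section \<open>Traces of unary type\<close>

locale max_factor = factor +
  assumes prime: "prime_quotient B \<alpha> (X \<times> X)" and fin: "finite X"
begin

lemma X_ne: "X \<noteq> {}"
  using alg by (simp add: is_algebra_def)

lemma \<alpha>D: "(x, y) \<in> \<alpha> \<Longrightarrow> x \<in> X \<and> y \<in> X"
  using \<alpha>_equiv by (auto simp: equiv_def)

lemma \<alpha>_refl: "x \<in> X \<Longrightarrow> (x, x) \<in> \<alpha>"
  using \<alpha>_equiv by (auto simp: equiv_def refl_on_def)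

lemma \<alpha>_sym: "(x, y) \<in> \<alpha> \<Longrightarrow> (y, x) \<in> \<alpha>"
  using \<alpha>_equiv by (meson equiv_def symD)

lemma \<alpha>_trans: "(x, y) \<in> \<alpha> \<Longrightarrow> (y, z) \<in> \<alpha> \<Longrightarrow> (x, z) \<in> \<alpha>"
  using \<alpha>_equiv by (meson equiv_def transD)

lemma Pol1_\<alpha>: "p \<in> Pol1 B \<Longrightarrow> (x, y) \<in> \<alpha> \<Longrightarrow> (p x, p y) \<in> \<alpha>"
  by (rule gen_congruence[of p B "{\<lambda>x. x}" \<alpha> x y]) (use cong in auto)

lemma PolV_\<alpha>: "F \<in> PolV B \<Longrightarrow> (\<And>i. (v i, w i) \<in> \<alpha>) \<Longrightarrow> (F v, F w) \<in> \<alpha>"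
  by (rule gen_congruence[of F B "range (\<lambda>i v. v i)" \<alpha> v w]) (use cong in auto)

lemma Pol1_X: "p \<in> Pol1 B \<Longrightarrow> x \<in> X \<Longrightarrow> p x \<in> X"
  by (rule Pol1_closed[OF _ alg])

lemma separating_images_iff:
  "W \<in> separating_images B \<alpha> (X \<times> X) \<longleftrightarrow>
    (\<exists>P\<in>Pol1 B. W = P ` X \<and> (\<exists>x\<in>X. \<exists>y\<in>X. (P x, P y) \<notin> \<alpha>))"
proof
  assume "W \<in> separating_images B \<alpha> (X \<times> X)"
  then obtain p x y where p: "p \<in> pol_ops B 1" "W = (\<lambda>x. p [x]) ` X" "x \<in> X" "y \<in> X" "(p [x], p [y]) \<notin> \<alpha>"
    unfolding separating_images_def by blast
  obtain P where "P \<in> Pol1 B" "\<forall>x\<in>X. p [x] = P x" using pol_ops1_iff(1)[OF X_ne fin p(1)] by blast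
  then show "\<exists>P\<in>Pol1 B. W = P ` X \<and> (\<exists>x\<in>X. \<exists>y\<in>X. (P x, P y) \<notin> \<alpha>)"
    using p by (intro bexI[of _ P]) (auto cong: image_cong)
next
  assume "\<exists>P\<in>Pol1 B. W = P ` X \<and> (\<exists>x\<in>X. \<exists>y\<in>X. (P x, P y) \<notin> \<alpha>)"
  then obtain P x y where P: "P \<in> Pol1 B" "W = P ` X" "x \<in> X" "y \<in> X" "(P x, P y) \<notin> \<alpha>" by blast
  obtain p where p: "p \<in> pol_ops B 1" "\<forall>x\<in>X. p [x] = P x" using pol_ops1_iff(2)[OF X_ne fin P(1)] by blast
  have "W = (\<lambda>x. p [x]) ` X" using p(2) P(2) by (auto cong: image_cong)
  moreover have "(p [x], p [y]) \<notin> \<alpha>" using p(2) P by simp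
  ultimately show "W \<in> separating_images B \<alpha> (X \<times> X)"
    unfolding separating_images_def using p(1) P(3,4) by blast
qed

text \<open>A minimal separating image is the range of an idempotent polynomial. The last clause
  restates minimality: a polynomial pushed back into \<open>V\<close> collapses \<open>V\<close>
  modulo \<alpha> or permutes it.\<close>

lemma minimal_set_exists:
  obtains V E where "V \<in> minimal_sets B \<alpha> (X \<times> X)" "V \<subseteq> X" "\<not> V \<times> V \<subseteq> \<alpha>" "E \<in> Pol1 B"
    "\<And>x. x \<in> X \<Longrightarrow> E x \<in> V" "\<And>x. x \<in> V \<Longrightarrow> E x = x"
    "\<And>p. p \<in> Pol1 B \<Longrightarrow> (\<forall>x\<in>V. \<forall>y\<in>V. (E (p x), E (p y)) \<in> \<alpha>) \<or> (\<lambda>x. E (p x)) ` V = V"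
proof -
  let ?S = "separating_images B \<alpha> (X \<times> X)"
  have id: "(\<lambda>x. x) \<in> Pol1 B" by (rule pols_base) simp
  have "?S \<subseteq> Pow X" using Pol1_X by (auto simp: separating_images_iff)
  then have finS: "finite ?S" using fin finite_subset by blast
  have "\<alpha> \<subset> X \<times> X" using prime by (simp add: prime_quotient_def)
  then obtain x0 y0 where xy0: "x0 \<in> X" "y0 \<in> X" "(x0, y0) \<notin> \<alpha>" by auto
  then have "X \<in> ?S" unfolding separating_images_iff using id by (intro bexI[OF _ id]) auto
  then obtain V where V: "V \<in> ?S" "\<And>W. W \<in> ?S \<Longrightarrow> W \<subseteq> V \<Longrightarrow> W = V"
    using finite_has_minimal[OF finS] by (metis empty_iff)
  then have Vmin: "V \<in> minimal_sets B \<alpha> (X \<times> X)" by (auto simp: minimal_sets_def)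
  obtain P0 x1 y1 where P0: "P0 \<in> Pol1 B" "V = P0 ` X" "x1 \<in> X" "y1 \<in> X" "(P0 x1, P0 y1) \<notin> \<alpha>"
    using V(1) unfolding separating_images_iff by blast
  have VX: "V \<subseteq> X" using P0 Pol1_X by auto
  have Vn: "\<not> V \<times> V \<subseteq> \<alpha>" using P0 by auto
  \<comment> \<open>Otherwise the kernel congruence of the pullback of \<alpha> along
    \<open>P0\<close> contains \<alpha> and the square of \<open>V\<close>, so it is full by
    maximality, and \<open>P0\<close> would be constant modulo \<alpha>.\<close>
  have "\<exists>q\<in>Pol1 B. \<exists>x\<in>V. \<exists>y\<in>V. (P0 (q x), P0 (q y)) \<notin> \<alpha>"
  proof (rule ccontr)
    assume n: "\<not> ?thesis"
    let ?E = "{(x, y). x \<in> X \<and> y \<in> X \<and> (P0 x, P0 y) \<in> \<alpha>}"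
    define \<theta> where "\<theta> = {(x, y). x \<in> X \<and> y \<in> X \<and> (\<forall>q\<in>Pol1 B. (q x, q y) \<in> ?E)}"
    have "equiv X ?E"
    proof (rule equivI)
      show "refl_on X ?E" using \<alpha>_refl Pol1_X[OF P0(1)] by (auto simp: refl_on_def)
      show "sym ?E" using \<alpha>_sym by (auto simp: sym_def)
      show "trans ?E" using \<alpha>_trans unfolding trans_def by blast
    qed auto
    then have "congruence B \<theta>" unfolding \<theta>_def by (rule congruence_kernel[OF alg])
    moreover have "\<alpha> \<subseteq> \<theta>" using \<alpha>D Pol1_\<alpha> Pol1_X P0(1) by (auto simp: \<theta>_def)
    moreover have "V \<times> V \<subseteq> \<theta>" using n VX Pol1_X by (auto simp: \<theta>_def)
    then have "\<theta> \<noteq> \<alpha>" using Vn by auto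
    moreover have "\<theta> \<subseteq> X \<times> X" by (auto simp: \<theta>_def)
    ultimately have "\<theta> = X \<times> X" using prime unfolding prime_quotient_def by blast
    then have "(x1, y1) \<in> \<theta>" using P0 by simp
    then have "\<forall>q\<in>Pol1 B. (q x1, q y1) \<in> ?E" by (simp add: \<theta>_def)
    from bspec[OF this id] show False using P0(5) by simp
  qed
  then obtain q x2 y2 where q: "q \<in> Pol1 B" "x2 \<in> V" "y2 \<in> V" "(P0 (q x2), P0 (q y2)) \<notin> \<alpha>" by blast
  \<comment> \<open>By minimality this self-map of \<open>V\<close> is onto, hence a permutation; an
    iterate is then the retraction.\<close>
  define \<pi> where "\<pi> x = P0 (q x)" for x
  have \<pi>: "\<pi> \<in> Pol1 B" unfolding \<pi>_def by (rule pols_comp1[OF P0(1) q(1)])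
  have \<pi>V: "\<pi> x \<in> V" if "x \<in> X" for x using that P0(2) Pol1_X[OF q(1)] by (auto simp: \<pi>_def)
  have "(\<lambda>x. \<pi> (P0 x)) ` X \<in> ?S"
  proof -
    obtain x y where "x \<in> X" "y \<in> X" "x2 = P0 x" "y2 = P0 y" using q P0(2) by auto
    then show ?thesis unfolding separating_images_iff
      using q(4) by (intro bexI[OF _ pols_comp1[OF \<pi> P0(1)]]) (auto simp: \<pi>_def)
  qed
  moreover have "(\<lambda>x. \<pi> (P0 x)) ` X \<subseteq> V" using \<pi>V Pol1_X[OF P0(1)] by auto
  ultimately have "(\<lambda>x. \<pi> (P0 x)) ` X = V" by (rule V(2))
  then have im: "\<pi> ` V = V" unfolding P0(2) by (simp add: image_image)
  have finV: "finite V" using VX fin finite_subset by blast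
  have inj: "inj_on \<pi> V" using im finV by (simp add: eq_card_imp_inj_on)
  define E where "E = \<pi> ^^ fact (card V)"
  have E: "E \<in> Pol1 B" unfolding E_def by (rule pols_funpow[OF \<pi>])
  have Eid: "E x = x" if "x \<in> V" for x
    unfolding E_def by (rule funpow_fact_card[OF finV inj _ that]) (use \<pi>V VX in auto)
  have EV: "E x \<in> V" if "x \<in> X" for x
  proof -
    have "(\<pi> ^^ Suc n) x \<in> V" for n
      by (induction n) (use \<pi>V VX that in auto)
    moreover obtain n where "fact (card V) = Suc n" by (metis fact_nonzero old.nat.exhaust)
    ultimately show ?thesis unfolding E_def by metis
  qed
  have "(\<forall>x\<in>V. \<forall>y\<in>V. (E (p x), E (p y)) \<in> \<alpha>) \<or> (\<lambda>x. E (p x)) ` V = V" if p: "p \<in> Pol1 B" for p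
  proof (rule disjCI)
    assume n: "(\<lambda>x. E (p x)) ` V \<noteq> V"
    have EX: "E ` X = V"
    proof
      show "V \<subseteq> E ` X" using Eid VX by force
    qed (use EV in auto)
    have eq: "(\<lambda>x. E (p (E x))) ` X = (\<lambda>x. E (p x)) ` V" unfolding EX[symmetric] by (simp add: image_image)
    have "(\<lambda>x. E (p (E x))) ` X \<notin> ?S"
    proof
      assume "(\<lambda>x. E (p (E x))) ` X \<in> ?S"
      from V(2)[OF this] have "(\<lambda>x. E (p (E x))) ` X = V" using EV Pol1_X[OF p] Pol1_X[OF E] by blast
      then show False using n eq by simp
    qed
    moreover have "(\<lambda>x. E (p (E x))) \<in> Pol1 B" by (rule pols_comp1[OF E pols_comp1[OF p E]])
    ultimately have "\<forall>x\<in>X. \<forall>y\<in>X. (E (p (E x)), E (p (E y))) \<in> \<alpha>"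
      unfolding separating_images_iff by blast
    then show "\<forall>x\<in>V. \<forall>y\<in>V. (E (p x), E (p y)) \<in> \<alpha>" using Eid VX by (metis subsetD)
  qed
  then show ?thesis using that[OF Vmin VX Vn E EV Eid] by blast
qed

end

section \<open>Minimal sets on which all polynomials are essentially unary modulo \<alpha>\<close>

locale unary_trace = max_factor +
  fixes V :: "'b set" and E :: "'b \<Rightarrow> 'b"
  assumes V_min: "V \<in> minimal_sets B \<alpha> (X \<times> X)" and VX: "V \<subseteq> X" and V_sep: "\<not> V \<times> V \<subseteq> \<alpha>"
    and E_pol: "E \<in> Pol1 B" and E_V: "\<And>x. x \<in> X \<Longrightarrow> E x \<in> V" and E_id: "\<And>x. x \<in> V \<Longrightarrow> E x = x"
    and E_min: "\<And>p. p \<in> Pol1 B \<Longrightarrow> (\<forall>x\<in>V. \<forall>y\<in>V. (E (p x), E (p y)) \<in> \<alpha>) \<or> (\<lambda>x. E (p x)) ` V = V"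
    and unary: "\<And>F i j. F \<in> PolV B \<Longrightarrow> i \<noteq> j \<Longrightarrow>
      \<exists>v\<in>vals V. \<exists>x\<in>V. (E (F (v(i := x))), E (F v)) \<notin> \<alpha> \<Longrightarrow>
      \<exists>v\<in>vals V. \<exists>x\<in>V. (E (F (v(j := x))), E (F v)) \<notin> \<alpha> \<Longrightarrow> False"
begin

definition \<theta> where "\<theta> = \<alpha> \<inter> V \<times> V"

abbreviation "bl x \<equiv> \<theta> `` {x}"
abbreviation "W \<equiv> bl ` V"
abbreviation "FM \<equiv> factor_alg (induced_alg B V) \<theta>"

definition P where
  "P = {\<pi> \<in> Bij W. \<exists>F\<in>Pol1 B. \<forall>x\<in>V. F x \<in> V \<and> \<pi> (bl x) = bl (F x)}"

lemma \<theta>_equiv: "equiv V \<theta>"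
proof (rule equivI)
  show "refl_on V \<theta>" using \<alpha>_refl VX by (auto simp: \<theta>_def refl_on_def)
  show "sym \<theta>" using \<alpha>_sym by (auto simp: \<theta>_def sym_def)
  show "trans \<theta>" unfolding \<theta>_def trans_def using \<alpha>_trans by blast
qed (auto simp: \<theta>_def)

lemma bl_eq: "x \<in> V \<Longrightarrow> y \<in> V \<Longrightarrow> bl x = bl y \<longleftrightarrow> (x, y) \<in> \<alpha>"
  using eq_equiv_class_iff[OF \<theta>_equiv] by (auto simp: \<theta>_def)

lemma FM_simps: "univ FM = W" "syms FM = {(n, p). p \<in> pol_ops B n \<and> p ` tuples V n \<subseteq> V}" "arity FM = fst"
  "interp FM f = op_mod \<theta> (snd f)"
  by (auto simp: factor_alg_def induced_alg_def quotient_def)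

lemma V_ne: "V \<noteq> {}"
  using V_sep by auto

lemma finW: "finite W"
  by (rule finite_imageI) (rule finite_subset[OF VX fin])

lemma vals_VX: "v \<in> vals V \<Longrightarrow> v \<in> vals X"
  using VX by (auto simp: vals_def)

lemma tuples_W:
  assumes "ys \<in> tuples W n"
  obtains v where "v \<in> vals V" "ys = map (\<lambda>i. bl (v i)) [0..<n]"
proof -
  obtain c where c: "c \<in> V" using V_ne by blast
  have "\<forall>i<n. \<exists>x. x \<in> V \<and> ys ! i = bl x" using assms by (auto simp: tuples_def subset_iff in_set_conv_nth)
  then obtain r where r: "\<And>i. i < n \<Longrightarrow> r i \<in> V \<and> ys ! i = bl (r i)" by metis
  show ?thesis
    by (rule that[of "\<lambda>i. if i < n then r i else c"])
      (use r c assms in \<open>auto simp: vals_def tuples_def intro!: nth_equalityI\<close>)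
qed

lemma W_tuples: "v \<in> vals V \<Longrightarrow> map (\<lambda>i. bl (v i)) [0..<n] \<in> tuples W n"
  by (auto simp: tuples_def vals_def)

text \<open>Only inverses need care: \<open>W\<close> is finite, so the inverse of a permutation is
  an iterate, and it is induced by the iterate of the polynomial.\<close>

lemma P_subgroup: "subgroup P (BijGroup W)"
proof -
  interpret G: group "BijGroup W" by (rule group_BijGroup)
  show ?thesis
  proof (rule G.subgroupI)
    show "P \<subseteq> carrier (BijGroup W)" by (auto simp: P_def BijGroup_def)
    have "(\<lambda>x\<in>W. x) \<in> P"
      unfolding P_def
      by (intro CollectI conjI id_Bij bexI[of _ "\<lambda>x. x"] pols_base) auto
    then show "P \<noteq> {}" by blast
  next
    fix \<pi> assume \<pi>P: "\<pi> \<in> P"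
    then obtain F where \<pi>: "\<pi> \<in> Bij W" and F: "F \<in> Pol1 B" "\<And>x. x \<in> V \<Longrightarrow> F x \<in> V \<and> \<pi> (bl x) = bl (F x)"
      by (auto simp: P_def)
    let ?n = "fact (card W) - 1 :: nat"
    have FnV: "(F ^^ k) x \<in> V" if "x \<in> V" for k x using that F by (induction k) auto
    have pw: "(\<pi> ^^ k) (bl x) = bl ((F ^^ k) x)" if "x \<in> V" for k x
      using that FnV F(2) by (induction k) auto
    have bij: "bij_betw \<pi> W W" using \<pi> by (simp add: Bij_def)
    then have inj: "inj_on \<pi> W" and cl: "\<And>z. z \<in> W \<Longrightarrow> \<pi> z \<in> W"
      by (auto simp: bij_betw_def)
    have "inv_into W \<pi> z = (\<pi> ^^ ?n) z" if z: "z \<in> W" for z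
    proof (rule inv_into_f_eq[OF inj])
      show "\<pi> ((\<pi> ^^ ?n) z) = z" using funpow_inverse(2)[OF finW inj _ z] cl by blast
      have "(\<pi> ^^ k) z \<in> W" for k using z cl by (induction k) auto
      then show "(\<pi> ^^ ?n) z \<in> W" .
    qed
    then have "(\<lambda>x\<in>W. inv_into W \<pi> x) (bl x) = bl ((F ^^ ?n) x)" if "x \<in> V" for x
      using that pw by simp
    then have "(\<lambda>x\<in>W. inv_into W \<pi> x) \<in> P"
      unfolding P_def using restrict_inv_into_Bij[OF \<pi>] pols_funpow[OF F(1), of ?n] FnV by blast
    then show "inv\<^bsub>BijGroup W\<^esub> \<pi> \<in> P" using inv_BijGroup[OF \<pi>] by simp
  next
    fix \<pi> \<rho> assume "\<pi> \<in> P" "\<rho> \<in> P"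
    then obtain F G where \<pi>: "\<pi> \<in> Bij W" "\<rho> \<in> Bij W"
      and F: "F \<in> Pol1 B" "\<And>x. x \<in> V \<Longrightarrow> F x \<in> V \<and> \<pi> (bl x) = bl (F x)"
      and G: "G \<in> Pol1 B" "\<And>x. x \<in> V \<Longrightarrow> G x \<in> V \<and> \<rho> (bl x) = bl (G x)"
      by (auto simp: P_def)
    have "compose W \<pi> \<rho> (bl x) = bl (F (G x))" if "x \<in> V" for x
      using that F(2) G(2) by (simp add: compose_eq)
    then have "compose W \<pi> \<rho> \<in> P"
      unfolding P_def using compose_Bij[OF \<pi>] pols_comp1[OF F(1) G(1)] F(2) G(2)
      by (intro CollectI conjI bexI[of _ "\<lambda>x. F (G x)"]) auto
    then show "\<pi> \<otimes>\<^bsub>BijGroup W\<^esub> \<rho> \<in> P" using \<pi> by (simp add: BijGroup_def)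
  qed
qed

text \<open>The link between the two algebras to be compared: each of them turns out to have exactly
  these essentially unary polynomial operations.\<close>

definition S where
  "S n = {\<lambda>xs\<in>tuples W n. \<pi> (xs ! i) | \<pi> i. \<pi> \<in> P \<and> i < n} \<union> {\<lambda>xs\<in>tuples W n. c | c. c \<in> W}"

lemma P_W: "\<pi> \<in> P \<Longrightarrow> z \<in> W \<Longrightarrow> \<pi> z \<in> W"
  by (auto simp: P_def Bij_def bij_betw_def)

lemma P_id: "(\<lambda>x\<in>W. x) \<in> P"
  using subgroup.one_closed[OF P_subgroup] by (simp add: BijGroup_def)

lemma P_compose: "\<pi> \<in> P \<Longrightarrow> \<rho> \<in> P \<Longrightarrow> compose W \<pi> \<rho> \<in> P"
proof -
  assume \<pi>: "\<pi> \<in> P" "\<rho> \<in> P"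
  then have "\<pi> \<in> Bij W" "\<rho> \<in> Bij W" by (simp_all add: P_def)
  then have "\<pi> \<otimes>\<^bsub>BijGroup W\<^esub> \<rho> = compose W \<pi> \<rho>" by (simp add: BijGroup_def)
  then show ?thesis using subgroup.m_closed[OF P_subgroup \<pi>] by simp
qed

lemma pol_opsI: "t \<in> term_ops A (n + k) \<Longrightarrow> cs \<in> tuples (univ A) k \<Longrightarrow>
    (\<lambda>xs\<in>tuples (univ A) n. t (xs @ cs)) \<in> pol_ops A n"
  unfolding pol_ops_def by blast

lemma const_pol_ops:
  assumes "c \<in> univ A"
  shows "(\<lambda>xs\<in>tuples (univ A) n. c) \<in> pol_ops A n"
proof -
  let ?t = "\<lambda>xs\<in>tuples (univ A) (n + 1). xs ! n"
  have t: "?t \<in> term_ops A (n + 1)" by (rule term_ops.proj) simp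
  have c: "[c] \<in> tuples (univ A) 1" using assms by (simp add: tuples_def)
  have "(\<lambda>xs\<in>tuples (univ A) n. ?t (xs @ [c])) = (\<lambda>xs\<in>tuples (univ A) n. c)"
    using assms by (auto simp: fun_eq_iff tuples_def nth_append restrict_def)
  then show ?thesis using pol_opsI[OF t c] by (simp only:)
qed

lemma perm_pol_ops: "pol_ops (perm_alg W P) n = S n"
proof -
  let ?A = "perm_alg W P"
  have A: "univ ?A = W" "syms ?A = P" "arity ?A = (\<lambda>_. 1)" "interp ?A = (\<lambda>\<pi> xs. \<pi> (hd xs))"
    by (simp_all add: perm_alg_def)
  have tms: "\<exists>\<pi>\<in>P. \<exists>i<m. t = (\<lambda>xs\<in>tuples W m. \<pi> (xs ! i))" if "t \<in> term_ops ?A m" for t m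
    using that
  proof induction
    case (proj i)
    have "(\<lambda>xs\<in>tuples W m. xs ! i) = (\<lambda>xs\<in>tuples W m. (\<lambda>x\<in>W. x) (xs ! i))"
      using proj by (auto simp: fun_eq_iff restrict_def tuples_def subset_iff)
    then show ?case using P_id proj unfolding A by blast
  next
    case (comp f gs)
    then obtain g where gs: "gs = [g]" by (auto simp: A length_Suc_conv)
    have "g \<in> set gs" using gs by simp
    from bspec[OF comp(3) this] have "\<exists>\<pi>\<in>P. \<exists>i<m. g = (\<lambda>xs\<in>tuples W m. \<pi> (xs ! i))" by (rule conjunct2)
    then obtain \<pi> i where g: "\<pi> \<in> P" "i < m" "g = (\<lambda>xs\<in>tuples W m. \<pi> (xs ! i))" by blast
    have f: "f \<in> P" using comp by (simp add: A)
    have "(\<lambda>xs\<in>tuples W m. f (g xs)) = (\<lambda>xs\<in>tuples W m. compose W f \<pi> (xs ! i))"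
      using g by (auto simp: fun_eq_iff restrict_def tuples_def subset_iff compose_def)
    then show ?case using P_compose[OF f g(1)] g(2) gs unfolding A by auto
  qed
  show ?thesis
  proof
    show "pol_ops ?A n \<subseteq> S n"
    proof
      fix p assume "p \<in> pol_ops ?A n"
      then obtain t cs k where t: "t \<in> term_ops ?A (n + k)" "cs \<in> tuples W k"
        and p: "p = (\<lambda>xs\<in>tuples W n. t (xs @ cs))"
        unfolding pol_ops_def A by blast
      obtain \<pi> i where \<pi>: "\<pi> \<in> P" "i < n + k" "t = (\<lambda>xs\<in>tuples W (n + k). \<pi> (xs ! i))"
        using tms[OF t(1)] by blast
      have tx: "t (xs @ cs) = \<pi> ((xs @ cs) ! i)" if "xs \<in> tuples W n" for xs
        using that t(2) \<pi>(3) by (auto simp: tuples_def)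
      show "p \<in> S n"
      proof (cases "i < n")
        case True
        have "p = (\<lambda>xs\<in>tuples W n. \<pi> (xs ! i))"
          unfolding p using tx True by (auto simp: fun_eq_iff restrict_def tuples_def nth_append)
        then show ?thesis unfolding S_def using \<pi> True by blast
      next
        case False
        have "p = (\<lambda>xs\<in>tuples W n. \<pi> (cs ! (i - n)))"
          unfolding p using tx False by (auto simp: fun_eq_iff restrict_def tuples_def nth_append)
        moreover have "\<pi> (cs ! (i - n)) \<in> W"
          by (rule P_W[OF \<pi>(1)]) (use t(2) \<pi>(2) False nth_mem[of "i - n" cs] in \<open>auto simp: tuples_def\<close>)
        ultimately show ?thesis unfolding S_def by blast
      qed
    qed
    show "S n \<subseteq> pol_ops ?A n"
    proof
      fix p assume "p \<in> S n"
      then consider \<pi> i where "p = (\<lambda>xs\<in>tuples W n. \<pi> (xs ! i))" "\<pi> \<in> P" "i < n"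
        | c where "p = (\<lambda>xs\<in>tuples W n. c)" "c \<in> W" unfolding S_def by blast
      then show "p \<in> pol_ops ?A n"
      proof cases
        case 1
        let ?t = "\<lambda>xs\<in>tuples (univ ?A) n. interp ?A \<pi> (map (\<lambda>g. g xs) [\<lambda>xs\<in>tuples (univ ?A) n. xs ! i])"
        have "?t \<in> term_ops ?A n"
          by (rule term_ops.comp) (use 1 in \<open>auto simp: A intro: term_ops.proj[of i n ?A, unfolded A]\<close>)
        moreover have "?t = p" using 1 by (auto simp: A fun_eq_iff restrict_def)
        ultimately have t: "p \<in> term_ops ?A (n + 0)" by simp
        have "p = (\<lambda>xs\<in>tuples (univ ?A) n. p (xs @ []))" using 1 by (auto simp: A fun_eq_iff restrict_def)
        moreover have "[] \<in> tuples (univ ?A) 0" by (simp add: tuples_def)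
        ultimately show ?thesis using pol_opsI[OF t, of "[]"] by metis
      next
        case 2
        then show ?thesis using const_pol_ops[of c ?A n] by (simp add: A)
      qed
    qed
  qed
qed

text \<open>Lifting to a polynomial of \<open>B\<close> that preserves \<open>V\<close> allows
  dependence on variables to be tested in \<open>B\<close>, where the assumption
  \<open>unary\<close> applies.\<close>

lemma FM_term:
  assumes "t \<in> term_ops FM m"
  shows "\<exists>F\<in>PolV B. \<forall>v\<in>vals V. F v \<in> V \<and> t (map (\<lambda>i. bl (v i)) [0..<m]) = bl (F v)"
  using assms
proof induction
  case (proj i)
  then show ?case
    by (intro bexI[of _ "\<lambda>v. v i"]) (auto simp: FM_simps W_tuples vals_def intro: pols_base)
next
  case (comp f gs)
  obtain n p where f: "f = (n, p)" by force
  have p: "p \<in> pol_ops B n" "p ` tuples V n \<subseteq> V" using comp(1) f by (auto simp: FM_simps)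
  have len: "length gs = n" using comp(2) f by (simp add: FM_simps)
  obtain G where G: "G \<in> PolV B" "\<And>v. v \<in> vals X \<Longrightarrow> p (map v [0..<n]) = G v"
    using pol_ops_PolV[OF p(1) X_ne] by blast
  have "\<forall>i<n. \<exists>F. F \<in> PolV B \<and> (\<forall>v\<in>vals V. F v \<in> V \<and> (gs ! i) (map (\<lambda>i. bl (v i)) [0..<m]) = bl (F v))"
    using comp(3) len by (metis nth_mem)
  then obtain \<Phi> where \<Phi>: "\<And>i. i < n \<Longrightarrow> \<Phi> i \<in> PolV B \<and>
      (\<forall>v\<in>vals V. \<Phi> i v \<in> V \<and> (gs ! i) (map (\<lambda>i. bl (v i)) [0..<m]) = bl (\<Phi> i v))" by metis
  obtain c where c: "c \<in> V" using V_ne by blast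
  \<comment> \<open>Positions beyond the arity get a dummy value in \<open>V\<close>, so that the
    whole valuation stays in \<open>V\<close>.\<close>
  define \<gamma> where "\<gamma> i = (if i < n then \<Phi> i else (\<lambda>_. c))" for i
  have pol: "(\<lambda>v. G (\<lambda>i. \<gamma> i v)) \<in> PolV B"
    by (rule pols_compV[OF G(1)]) (use \<Phi> c VX in \<open>auto simp: \<gamma>_def intro: pols_const\<close>)
  have "G (\<lambda>i. \<gamma> i v) \<in> V \<and> op_mod \<theta> p (map (\<lambda>g. g (map (\<lambda>i. bl (v i)) [0..<m])) gs) = bl (G (\<lambda>i. \<gamma> i v))"
    if v: "v \<in> vals V" for v
  proof -
    let ?w = "\<lambda>i. \<gamma> i v"
    have w: "?w \<in> vals V" using v \<Phi> c by (auto simp: \<gamma>_def vals_def)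
    let ?xs = "map ?w [0..<n]"
    have xs: "?xs \<in> tuples V n" by (rule map_vals_tuples[OF w])
    have pG: "p ?xs = G ?w" by (rule G(2)[OF vals_VX[OF w]])
    have "map (\<lambda>g. g (map (\<lambda>i. bl (v i)) [0..<m])) gs = map bl ?xs"
      by (rule nth_equalityI) (use \<Phi> v len in \<open>auto simp: \<gamma>_def\<close>)
    moreover have "op_mod \<theta> p (map bl ?xs) = bl (p ?xs)"
    proof (rule op_mod_blocks[OF \<theta>_equiv])
      show "set ?xs \<subseteq> V" using xs by (simp add: tuples_def)
      fix ys assume l: "list_all2 (\<lambda>x y. (x, y) \<in> \<theta>) ?xs ys"
      let ?u = "\<lambda>i. if i < n then ys ! i else c"
      have leny: "length ys = n" using l by (auto dest: list_all2_lengthD)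
      have li: "(?w i, ys ! i) \<in> \<theta>" if "i < n" for i using l that by (auto simp: list_all2_conv_all_nth)
      then have u: "?u \<in> vals V" using c by (auto simp: vals_def \<theta>_def)
      have ys: "map ?u [0..<n] = ys" using leny by (auto intro!: nth_equalityI)
      have "p ys = G ?u" using G(2)[OF vals_VX[OF u]] unfolding ys .
      moreover have "(G ?w, G ?u) \<in> \<alpha>"
        by (rule PolV_\<alpha>[OF G(1)]) (use li c \<alpha>_refl VX in \<open>auto simp: \<theta>_def \<gamma>_def\<close>)
      moreover have "p ?xs \<in> V" using xs p(2) by blast
      moreover have "p ys \<in> V" using map_vals_tuples[OF u, of n] p(2) unfolding ys by blast
      ultimately show "(p ?xs, p ys) \<in> \<theta>" using pG by (simp add: \<theta>_def)
    qed
    moreover have "p ?xs \<in> V" using xs p(2) by blast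
    ultimately show ?thesis using pG by simp
  qed
  then show ?case
    by (intro bexI[OF _ pol] ballI) (simp add: FM_simps W_tuples f)
qed

text \<open>By \<open>unary\<close> at most one variable is essential modulo \<alpha>. With none the
  operation is constant. With one it factors through a unary polynomial \<open>f\<close> that is not
  constant modulo \<alpha>, hence maps \<open>V\<close> onto itself and induces a permutation in
  \<open>P\<close>.\<close>

lemma FM_pol_ops: "pol_ops FM n = S n"
proof
  show "S n \<subseteq> pol_ops FM n"
  proof
    fix q assume "q \<in> S n"
    then consider \<pi> i where "q = (\<lambda>xs\<in>tuples W n. \<pi> (xs ! i))" "\<pi> \<in> P" "i < n"
      | c where "q = (\<lambda>xs\<in>tuples W n. c)" "c \<in> W" unfolding S_def by blast
    then show "q \<in> pol_ops FM n"
    proof cases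
      case 1
      obtain F where F: "F \<in> Pol1 B" "\<And>x. x \<in> V \<Longrightarrow> F x \<in> V \<and> \<pi> (bl x) = bl (F x)"
        using 1(2) by (auto simp: P_def)
      obtain p where p: "p \<in> pol_ops B 1" "\<And>x. x \<in> X \<Longrightarrow> p [x] = F x"
        using pol_ops1_iff(2)[OF X_ne fin F(1)] by blast
      have pV: "p ` tuples V 1 \<subseteq> V" using p(2) F(2) VX by (auto simp: tuples_def length_Suc_conv)
      have op: "op_mod \<theta> p [z] = \<pi> z" if z: "z \<in> W" for z
      proof -
        obtain x where x: "x \<in> V" "z = bl x" using z by blast
        have "op_mod \<theta> p (map bl [x]) = bl (p [x])"
        proof (rule op_mod_blocks[OF \<theta>_equiv])
          fix ys assume "list_all2 (\<lambda>x y. (x, y) \<in> \<theta>) [x] ys"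
          then obtain y where y: "ys = [y]" "(x, y) \<in> \<theta>" by (auto simp: list_all2_Cons1)
          then have "y \<in> V" "(F x, F y) \<in> \<alpha>" using Pol1_\<alpha>[OF F(1)] by (auto simp: \<theta>_def)
          moreover have "p [x] = F x" "p ys = F y" using p(2) x(1) y(1) \<open>y \<in> V\<close> VX by auto
          ultimately show "(p [x], p ys) \<in> \<theta>" using F(2) x(1) by (simp add: \<theta>_def)
        qed (use x in simp)
        then show ?thesis using x F(2) p(2) VX by auto
      qed
      let ?f = "(1 :: nat, p)"
      have f: "?f \<in> syms FM" using p(1) pV by (simp add: FM_simps)
      let ?t = "\<lambda>xs\<in>tuples (univ FM) n. interp FM ?f (map (\<lambda>g. g xs) [\<lambda>xs\<in>tuples (univ FM) n. xs ! i])"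
      have "?t \<in> term_ops FM n"
        by (rule term_ops.comp[OF f]) (use 1 in \<open>auto simp: FM_simps intro: term_ops.proj[of i n FM, unfolded FM_simps]\<close>)
      moreover have "?t = q"
        unfolding 1 FM_simps
      proof (rule restrict_ext)
        fix xs assume xs: "xs \<in> tuples W n"
        then have "xs ! i \<in> W" using 1(3) by (auto simp: tuples_def)
        then show "op_mod \<theta> (snd ?f) (map (\<lambda>g. g xs) [\<lambda>xs\<in>tuples W n. xs ! i]) = \<pi> (xs ! i)"
          using xs op by simp
      qed
      ultimately have t: "q \<in> term_ops FM (n + 0)" by simp
      have "q = (\<lambda>xs\<in>tuples (univ FM) n. q (xs @ []))" using 1 by (auto simp: FM_simps fun_eq_iff restrict_def)
      moreover have "[] \<in> tuples (univ FM) 0" by (simp add: tuples_def)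
      ultimately show ?thesis using pol_opsI[OF t, of "[]"] by metis
    next
      case 2
      then show ?thesis using const_pol_ops[of c FM n] by (simp add: FM_simps)
    qed
  qed
  show "pol_ops FM n \<subseteq> S n"
  proof
    fix q assume "q \<in> pol_ops FM n"
    then obtain t cs k where t: "t \<in> term_ops FM (n + k)" "cs \<in> tuples W k"
      and q: "q = (\<lambda>xs\<in>tuples W n. t (xs @ cs))"
      unfolding pol_ops_def FM_simps by blast
    obtain F0 where F0: "F0 \<in> PolV B"
      "\<And>v. v \<in> vals V \<Longrightarrow> F0 v \<in> V \<and> t (map (\<lambda>i. bl (v i)) [0..<n + k]) = bl (F0 v)"
      using FM_term[OF t(1)] by blast
    obtain d where d: "d \<in> vals V" "cs = map (\<lambda>i. bl (d i)) [0..<k]" using tuples_W[OF t(2)] by blast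
    define F where "F v = F0 (\<lambda>i. if i < n then v i else d (i - n))" for v
    have F: "F \<in> PolV B"
    proof -
      have "(\<lambda>v. F0 (\<lambda>i. (if i < n then (\<lambda>v. v i) else (\<lambda>_. d (i - n))) v)) \<in> PolV B"
        by (rule pols_compV[OF F0(1)]) (use d VX in \<open>auto simp: vals_def intro: pols_base pols_const\<close>)
      moreover have "F = (\<lambda>v. F0 (\<lambda>i. (if i < n then (\<lambda>v. v i) else (\<lambda>_. d (i - n))) v))"
        unfolding F_def by (intro ext arg_cong[where f = F0]) auto
      ultimately show ?thesis by simp
    qed
    have FV: "F v \<in> V" and qF: "q (map (\<lambda>i. bl (v i)) [0..<n]) = bl (F v)" if v: "v \<in> vals V" for v
    proof -
      let ?w = "\<lambda>i. if i < n then v i else d (i - n)"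
      have w: "?w \<in> vals V" using v d by (auto simp: vals_def)
      have "map (\<lambda>i. bl (v i)) [0..<n] @ cs = map (\<lambda>i. bl (?w i)) [0..<n + k]"
        unfolding d(2) by (rule nth_equalityI) (auto simp: nth_append)
      then show "F v \<in> V" "q (map (\<lambda>i. bl (v i)) [0..<n]) = bl (F v)"
        using F0(2)[OF w] W_tuples[OF v, of n] by (simp_all add: q F_def)
    qed
    have ess_n: "F (v(i := x)) = F v" if "\<not> i < n" for v i x
      unfolding F_def by (rule arg_cong[where f = F0]) (use that in auto)
    define ess where "ess i \<longleftrightarrow> (\<exists>v\<in>vals V. \<exists>x\<in>V. (F (v(i := x)), F v) \<notin> \<alpha>)" for i
    have ess_E: "\<exists>v\<in>vals V. \<exists>x\<in>V. (E (F (v(i := x))), E (F v)) \<notin> \<alpha>" if "ess i" for i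
      using that FV E_id vals_upd unfolding ess_def by metis
    have one: "i = j" if "ess i" "ess j" for i j
      using unary[OF F _ ess_E[OF that(1)] ess_E[OF that(2)]] by blast
    obtain N where N: "\<And>v w. (\<And>i. i < N \<Longrightarrow> v i = w i) \<Longrightarrow> F v = F w"
      using PolV_finite_dep[OF F] by blast
    obtain c where c: "c \<in> V" using V_ne by blast
    have cv: "(\<lambda>_. c) \<in> vals V" using c by (simp add: vals_def)
    have q_eqI: "q = (\<lambda>xs\<in>tuples W n. r xs)"
      if "\<And>v. v \<in> vals V \<Longrightarrow> bl (F v) = r (map (\<lambda>i. bl (v i)) [0..<n])" for r
    proof
      fix xs
      show "q xs = (\<lambda>xs\<in>tuples W n. r xs) xs"
      proof (cases "xs \<in> tuples W n")
        case True
        then obtain v where "v \<in> vals V" "xs = map (\<lambda>i. bl (v i)) [0..<n]" by (rule tuples_W)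
        then show ?thesis using that qF True by simp
      qed (simp add: q)
    qed
    show "q \<in> S n"
    proof (cases "\<exists>i. ess i")
      case False
      have "(F (\<lambda>_. c), F w) \<in> \<alpha>" if w: "w \<in> vals V" for w
      proof (rule vals_induct[OF cv w, where n = N])
        show "(F (\<lambda>_. c), F (\<lambda>_. c)) \<in> \<alpha>" using \<alpha>_refl FV[OF cv] VX by blast
      next
        fix k j x assume "k \<in> vals V" "x \<in> V" "(F (\<lambda>_. c), F k) \<in> \<alpha>"
        moreover have "(F (k(j := x)), F k) \<in> \<alpha>" using False calculation(1,2) unfolding ess_def by blast
        ultimately show "(F (\<lambda>_. c), F (k(j := x))) \<in> \<alpha>" using \<alpha>_sym \<alpha>_trans by blast
      next
        fix k k' :: "nat \<Rightarrow> 'b" assume "\<And>i. i < N \<Longrightarrow> k i = k' i" "(F (\<lambda>_. c), F k) \<in> \<alpha>"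
        then show "(F (\<lambda>_. c), F k') \<in> \<alpha>" using N[of k k'] by simp
      qed
      then have "bl (F w) = bl (F (\<lambda>_. c))" if "w \<in> vals V" for w
        using bl_eq[OF FV[OF cv] FV[OF that]] that by simp
      then have "q = (\<lambda>xs\<in>tuples W n. bl (F (\<lambda>_. c)))" by (rule q_eqI)
      then show ?thesis unfolding S_def using FV[OF cv] by blast
    next
      case True
      then obtain i where i: "ess i" by blast
      have i_n: "i < n"
      proof (rule ccontr)
        assume "\<not> i < n"
        then have "F (v(i := x)) = F v" for v x by (rule ess_n)
        then show False using i FV \<alpha>_refl VX unfolding ess_def by (metis subsetD)
      qed
      define f where "f x = F ((\<lambda>_. c)(i := x))" for x
      have f: "f \<in> Pol1 B" unfolding f_def by (rule PolV_section1[OF F vals_VX[OF cv]])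
      have fV: "f x \<in> V" if "x \<in> V" for x unfolding f_def by (rule FV[OF vals_upd[OF cv that]])
      have Ff: "(F w, f (w i)) \<in> \<alpha>" if w: "w \<in> vals V" for w
      proof -
        have wi: "w i \<in> V" using w by (simp add: vals_def)
        have "(F w, F ((\<lambda>_. c)(i := w i))) \<in> \<alpha>"
        proof (rule vals_induct[OF w cv, where n = N and P = "\<lambda>k. (F w, F (k(i := w i))) \<in> \<alpha>"])
          show "(F w, F (w(i := w i))) \<in> \<alpha>" using \<alpha>_refl FV[OF w] VX by auto
        next
          fix k j x assume k: "k \<in> vals V" "x \<in> V" "(F w, F (k(i := w i))) \<in> \<alpha>"
          show "(F w, F (k(j := x, i := w i))) \<in> \<alpha>"
          proof (cases "j = i")
            case True
            then show ?thesis using k by (simp only: fun_upd_upd)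
          next
            case False
            then have "\<not> ess j" using one i by blast
            then have "(F (k(i := w i, j := x)), F (k(i := w i))) \<in> \<alpha>"
              using vals_upd[OF k(1) wi, of i] k(2) unfolding ess_def by blast
            then show ?thesis using k(3) \<alpha>_sym \<alpha>_trans False by (metis fun_upd_twist)
          qed
        next
          fix k k' :: "nat \<Rightarrow> 'b" assume kk: "\<And>l. l < N \<Longrightarrow> k l = k' l" and a: "(F w, F (k(i := w i))) \<in> \<alpha>"
          have "F (k(i := w i)) = F (k'(i := w i))" by (rule N) (use kk in auto)
          then show "(F w, F (k'(i := w i))) \<in> \<alpha>" using a by (simp only:)
        qed
        then show ?thesis by (simp add: f_def)
      qed
      have nc: "\<not> (\<forall>x\<in>V. \<forall>y\<in>V. (f x, f y) \<in> \<alpha>)"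
      proof
        assume a: "\<forall>x\<in>V. \<forall>y\<in>V. (f x, f y) \<in> \<alpha>"
        obtain v x where v: "v \<in> vals V" "x \<in> V" "(F (v(i := x)), F v) \<notin> \<alpha>" using i unfolding ess_def by blast
        have "(F (v(i := x)), f x) \<in> \<alpha>" using Ff[OF vals_upd[OF v(1,2)], of i] by simp
        moreover have "(f x, f (v i)) \<in> \<alpha>" using a v by (simp add: vals_def)
        moreover have "(f (v i), F v) \<in> \<alpha>" using Ff[OF v(1)] by (rule \<alpha>_sym)
        ultimately show False using v(3) \<alpha>_trans by blast
      qed
      have "(\<forall>x\<in>V. \<forall>y\<in>V. (f x, f y) \<in> \<alpha>) \<or> f ` V = V"
        using E_min[OF f] fV E_id by (simp cong: image_cong)
      then have fim: "f ` V = V" using nc by blast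
      define \<pi> where "\<pi> = (\<lambda>z\<in>W. bl (f (SOME x. x \<in> V \<and> bl x = z)))"
      have \<pi>f: "\<pi> (bl x) = bl (f x)" if x: "x \<in> V" for x
      proof -
        have "\<exists>y. y \<in> V \<and> bl y = bl x" using x by blast
        from someI_ex[OF this] have y: "(SOME y. y \<in> V \<and> bl y = bl x) \<in> V" "bl (SOME y. y \<in> V \<and> bl y = bl x) = bl x" by auto
        then have "(f (SOME y. y \<in> V \<and> bl y = bl x), f x) \<in> \<alpha>" using Pol1_\<alpha>[OF f] bl_eq x by blast
        then have "bl (f (SOME y. y \<in> V \<and> bl y = bl x)) = bl (f x)" using bl_eq fV y(1) x by simp
        then show ?thesis using x by (simp add: \<pi>_def)
      qed
      have "\<pi> ` W = bl ` (f ` V)" using \<pi>f by (auto simp: image_image)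
      then have "\<pi> ` W = W" using fim by simp
      then have "\<pi> \<in> Bij W"
        using finW eq_card_imp_inj_on[of W \<pi>] by (auto simp: Bij_def bij_betw_def \<pi>_def)
      then have "\<pi> \<in> P" unfolding P_def using f fV \<pi>f by blast
      moreover have "q = (\<lambda>xs\<in>tuples W n. \<pi> (xs ! i))"
      proof (rule q_eqI)
        fix v :: "nat \<Rightarrow> 'b" assume v: "v \<in> vals V"
        then have "v i \<in> V" by (simp add: vals_def)
        then have "bl (F v) = \<pi> (bl (v i))" using \<pi>f bl_eq[OF FV[OF v] fV] Ff[OF v] by simp
        then show "bl (F v) = \<pi> (map (\<lambda>i. bl (v i)) [0..<n] ! i)" using i_n by simp
      qed
      ultimately show ?thesis unfolding S_def using i_n by blast
    qed
  qed
qed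

text \<open>Since the upper congruence is full, the trace through any point of \<open>V\<close> is
  \<open>V\<close> itself.\<close>

lemma type_1: "has_type_1 B \<alpha> (X \<times> X)"
proof -
  obtain c where c: "c \<in> V" using V_ne by blast
  have "V = V \<inter> (X \<times> X) `` {c}" using c VX by auto
  then have "V \<in> traces B \<alpha> (X \<times> X)" unfolding traces_def using V_min V_sep c by blast
  moreover have "unary_type FM"
    unfolding unary_type_def polynomially_equivalent_def
    by (intro exI[of _ P]) (simp add: FM_simps(1) P_subgroup FM_pol_ops perm_pol_ops, simp add: perm_alg_def)
  ultimately show ?thesis unfolding has_type_1_def \<theta>_def by blast
qed

end

section \<open>Transport of minimal sets and terms to and from the simple factor\<close>

context max_factor
begin

text \<open>As type 1 is excluded, the assumptions of \<open>unary_trace\<close> cannot hold, which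
  leaves a polynomial with two essential variables modulo \<alpha>. Everything is then read on
  blocks.\<close>

lemma nonunary_minset:
  assumes idem: "idempotent_algebra B" and nt: "\<not> has_type_1 B \<alpha> (X \<times> X)"
  obtains e U where "minset Q e U" "nonunary_on Q e U"
proof -
  obtain V E where V: "V \<in> minimal_sets B \<alpha> (X \<times> X)" "V \<subseteq> X" "\<not> V \<times> V \<subseteq> \<alpha>" and E: "E \<in> Pol1 B"
    "\<And>x. x \<in> X \<Longrightarrow> E x \<in> V" "\<And>x. x \<in> V \<Longrightarrow> E x = x"
    "\<And>p. p \<in> Pol1 B \<Longrightarrow> (\<forall>x\<in>V. \<forall>y\<in>V. (E (p x), E (p y)) \<in> \<alpha>) \<or> (\<lambda>x. E (p x)) ` V = V"
    using minimal_set_exists by blast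
  have VX: "x \<in> X" if "x \<in> V" for x using that V by blast
  have "\<exists>F i j. F \<in> PolV B \<and> i \<noteq> j \<and>
      (\<exists>v\<in>vals V. \<exists>x\<in>V. (E (F (v(i := x))), E (F v)) \<notin> \<alpha>) \<and>
      (\<exists>v\<in>vals V. \<exists>x\<in>V. (E (F (v(j := x))), E (F v)) \<notin> \<alpha>)"
  proof (rule ccontr)
    assume n: "\<not> ?thesis"
    have "unary_trace B \<alpha> V E"
    proof
      show "False" if "F \<in> PolV B" "i \<noteq> j"
        "\<exists>v\<in>vals V. \<exists>x\<in>V. (E (F (v(i := x))), E (F v)) \<notin> \<alpha>"
        "\<exists>v\<in>vals V. \<exists>x\<in>V. (E (F (v(j := x))), E (F v)) \<notin> \<alpha>" for F i j
        using n that by blast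
    qed (fact V E)+
    then show False using unary_trace.type_1 nt by blast
  qed
  then obtain F i j where F: "F \<in> PolV B" "i \<noteq> j"
    and ess: "\<exists>v\<in>vals V. \<exists>x\<in>V. (E (F (v(i := x))), E (F v)) \<notin> \<alpha>"
      "\<exists>v\<in>vals V. \<exists>x\<in>V. (E (F (v(j := x))), E (F v)) \<notin> \<alpha>" by blast
  obtain E' where E': "E' \<in> Pol1 Q" "\<And>x. x \<in> X \<Longrightarrow> E' (blk x) = blk (E x)"
    using Pol1_down[OF E(1)] by blast
  obtain F' where F': "F' \<in> PolV Q" "\<And>v. v \<in> vals X \<Longrightarrow> F' (\<lambda>i. blk (v i)) = blk (F v)"
    using PolV_down[OF F(1)] by blast
  define U where "U = blk ` V"
  have "minset Q E' U"
  proof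
    show "is_algebra Q" by (rule Q_alg)
    show "finite (univ Q)" by (rule Q_fin[OF fin])
    show "idempotent_algebra Q" by (rule Q_idem[OF idem])
    show "simple_alg Q" by (rule Q_simple[OF prime])
    show "E' \<in> Pol1 Q" by (rule E')
    show "E' z = z" if "z \<in> U" for z using that E'(2) E(3) VX by (auto simp: U_def)
    show "E' z \<in> U" if "z \<in> univ Q" for z using that E'(2) E(2) by (auto simp: U_def Q_simps)
    show "U \<subseteq> univ Q" using V by (auto simp: U_def Q_simps)
    show "\<exists>u\<in>U. \<exists>v\<in>U. u \<noteq> v"
    proof -
      obtain x y where xy: "x \<in> V" "y \<in> V" "(x, y) \<notin> \<alpha>" using V(3) by auto
      then have "blk x \<noteq> blk y" using blk_eq VX by simp
      then show ?thesis using xy by (auto simp: U_def)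
    qed
    fix p' assume "p' \<in> Pol1 Q"
    then obtain p where p: "p \<in> Pol1 B" "\<And>x. x \<in> X \<Longrightarrow> p' (blk x) = blk (p x)"
      using Pol1_up by blast
    have pX: "p x \<in> X" if "x \<in> V" for x using Pol1_X[OF p(1) VX[OF that]] .
    have eq: "E' (p' (blk x)) = blk (E (p x))" if "x \<in> V" for x
      using that p(2) E'(2) pX VX by simp
    have EX: "E (p x) \<in> X" if "x \<in> V" for x using E(2)[OF pX[OF that]] VX by blast
    from E(4)[OF p(1)] show "(\<forall>x\<in>U. \<forall>y\<in>U. E' (p' x) = E' (p' y)) \<or> inj_on (\<lambda>x. E' (p' x)) U"
    proof
      assume c: "\<forall>x\<in>V. \<forall>y\<in>V. (E (p x), E (p y)) \<in> \<alpha>"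
      have "E' (p' (blk x)) = E' (p' (blk y))" if "x \<in> V" "y \<in> V" for x y
        using eq[OF that(1)] eq[OF that(2)] blk_eq[OF EX[OF that(1)] EX[OF that(2)]] c that by metis
      then show ?thesis unfolding U_def by blast
    next
      \<comment> \<open>Surjectivity passes to blocks directly, unlike injectivity, and on the
        finite set \<open>U\<close> it gives injectivity back.\<close>
      assume im: "(\<lambda>x. E (p x)) ` V = V"
      have "(\<lambda>z. E' (p' z)) ` U = (\<lambda>x. blk (E (p x))) ` V"
        unfolding U_def image_image by (rule image_cong) (use eq in auto)
      also have "\<dots> = blk ` ((\<lambda>x. E (p x)) ` V)" by (simp add: image_image)
      finally have "(\<lambda>z. E' (p' z)) ` U = U" by (simp add: im U_def)
      moreover have "finite U" unfolding U_def using finite_subset[OF V(2) fin] by simp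
      ultimately show ?thesis using eq_card_imp_inj_on by metis
    qed
  qed
  moreover have ess': "\<exists>v\<in>vals U. \<exists>x\<in>U. E' (F' (v(l := x))) \<noteq> E' (F' v)"
    if l: "\<exists>v\<in>vals V. \<exists>x\<in>V. (E (F (v(l := x))), E (F v)) \<notin> \<alpha>" for l
  proof -
    obtain v x where v: "v \<in> vals V" "x \<in> V" "(E (F (v(l := x))), E (F v)) \<notin> \<alpha>" using l by blast
    have ev: "E' (F' (\<lambda>i. blk (w i))) = blk (E (F w))" and EFX: "E (F w) \<in> X" if "w \<in> vals V" for w
    proof -
      have w: "w \<in> vals X" using that VX by (auto simp: vals_def)
      have "F w \<in> X" by (rule PolV_closed[OF F(1) alg w])
      then show "E' (F' (\<lambda>i. blk (w i))) = blk (E (F w))" "E (F w) \<in> X"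
        using F'(2)[OF w] E'(2) E(2) VX by auto
    qed
    have v': "v(l := x) \<in> vals V" by (rule vals_upd[OF v(1,2)])
    have up: "(\<lambda>i. blk (v i))(l := blk x) = (\<lambda>i. blk ((v(l := x)) i))" by (auto simp: fun_eq_iff)
    have "E' (F' ((\<lambda>i. blk (v i))(l := blk x))) \<noteq> E' (F' (\<lambda>i. blk (v i)))"
      unfolding up ev[OF v'] ev[OF v(1)] using v(3) blk_eq[OF EFX[OF v'] EFX[OF v(1)]] by simp
    moreover have "(\<lambda>i. blk (v i)) \<in> vals U" "blk x \<in> U" using v by (auto simp: U_def vals_def)
    ultimately show ?thesis by blast
  qed
  have "nonunary_on Q E' U" unfolding nonunary_on_def
    by (intro bexI[OF _ F'(1)] exI[of _ i] exI[of _ j] conjI F(2) ess' ess)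
  ultimately show ?thesis using that by blast
qed

lemma Tm_op_mod:
  assumes "F \<in> Tm Q" "0 < n"
  obtains t where "t \<in> term_ops B n"
    "\<And>ys. ys \<in> tuples (univ Q) n \<Longrightarrow> op_mod \<alpha> t ys = F (\<lambda>i. ys ! min i (n - 1))"
proof -
  obtain G where G: "G \<in> Tm B" "\<And>v. v \<in> vals X \<Longrightarrow> F (\<lambda>i. blk (v i)) = blk (G v)"
    using Tm_up[OF assms(1)] by blast
  obtain t where t: "t \<in> term_ops B n" "\<And>xs. xs \<in> tuples X n \<Longrightarrow> t xs = G (\<lambda>i. xs ! min i (n - 1))"
    using Tm_term_ops[OF G(1) assms(2)] by blast
  have "op_mod \<alpha> t ys = F (\<lambda>i. ys ! min i (n - 1))" if "ys \<in> tuples (univ Q) n" for ys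
  proof -
    obtain xs where xs: "xs \<in> tuples X n" and ys: "ys = map blk xs" using \<open>ys \<in> _\<close> by (rule tuples_Q)
    have len: "length xs = n" and xsX: "set xs \<subseteq> X" using xs by (auto simp: tuples_def)
    have idx: "min i (n - 1) < n" for i using assms(2) by auto
    have v: "(\<lambda>i. xs ! min i (n - 1)) \<in> vals X"
      using xsX idx len by (auto simp: vals_def)
    have "op_mod \<alpha> t (map blk xs) = blk (t xs)"
    proof (rule op_mod_blocks[OF \<alpha>_equiv xsX])
      fix ys assume l: "list_all2 (\<lambda>x y. (x, y) \<in> \<alpha>) xs ys"
      have ys: "ys \<in> tuples X n"
        using l len \<alpha>D by (fastforce simp: tuples_def list_all2_conv_all_nth in_set_conv_nth)
      have "(G (\<lambda>i. xs ! min i (n - 1)), G (\<lambda>i. ys ! min i (n - 1))) \<in> \<alpha>"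
        by (rule PolV_\<alpha>[OF subsetD[OF Tm_PolV G(1)]]) (use l idx len in \<open>auto simp: list_all2_conv_all_nth\<close>)
      then show "(t xs, t ys) \<in> \<alpha>" using t(2) xs ys by simp
    qed
    then show ?thesis using t(2)[OF xs] G(2)[OF v] idx len by (simp add: ys)
  qed
  then show ?thesis using that t(1) by blast
qed

end

lemma nth_v3:
  "(\<lambda>i. [x, y] ! min i (2 - 1)) = v3 x y y" "(\<lambda>i. [x, y, z] ! min i (3 - 1)) = v3 x y z"
proof -
  show "(\<lambda>i. [x, y] ! min i (2 - 1)) = v3 x y y"
  proof
    show "[x, y] ! min i (2 - 1) = v3 x y y i" for i by (cases i) (auto simp: v3_def)
  qed
  show "(\<lambda>i. [x, y, z] ! min i (3 - 1)) = v3 x y z"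
  proof
    fix i :: nat
    consider "i = 0" | "i = 1" | "i \<ge> 2" by linarith
    then show "[x, y, z] ! min i (3 - 1) = v3 x y z i"
      by cases (auto simp: v3_def min_def numeral_2_eq_2)
  qed
qed

section \<open>Subalgebras\<close>

lemma closed_under_univ_update [simp]: "closed_under (A\<lparr>univ := S\<rparr>) T \<longleftrightarrow> closed_under A T"
  by (simp add: closed_under_def)

text \<open>Term operations are extensional, so they change with the universe; the same term read
  over \<open>B\<close> agrees on tuples from \<open>S\<close>.\<close>

lemma term_ops_extend:
  assumes "t' \<in> term_ops (B\<lparr>univ := S\<rparr>) n" "S \<subseteq> univ B"
  shows "\<exists>t\<in>term_ops B n. \<forall>xs\<in>tuples S n. t xs = t' xs"
  using assms(1)
proof induction
  case (proj i)
  then show ?case using assms(2)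
    by (intro bexI[OF _ term_ops.proj[of i]]) (auto simp: tuples_def)
next
  case (comp f gs)
  then obtain \<Phi> where \<Phi>: "\<And>g. g \<in> set gs \<Longrightarrow> \<Phi> g \<in> term_ops B n \<and> (\<forall>xs\<in>tuples S n. \<Phi> g xs = g xs)"
    by metis
  let ?t = "\<lambda>xs\<in>tuples (univ B) n. interp B f (map (\<lambda>g. g xs) (map \<Phi> gs))"
  have t: "?t \<in> term_ops B n" by (rule term_ops.comp) (use comp \<Phi> in auto)
  have "?t xs = interp B f (map (\<lambda>g. g xs) gs)" if xs: "xs \<in> tuples S n" for xs
  proof -
    have "xs \<in> tuples (univ B) n" using xs assms(2) by (auto simp: tuples_def)
    moreover have "map (\<lambda>g. g xs) (map \<Phi> gs) = map (\<lambda>g. g xs) gs" using \<Phi> xs by auto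
    ultimately show ?thesis by (simp only: restrict_apply if_True)
  qed
  then show ?case by (intro bexI[OF _ t]) simp
qed

lemma listset_tuples:
  "xs \<in> listset Xs \<Longrightarrow> \<forall>Y\<in>set Xs. Y \<subseteq> S \<Longrightarrow> xs \<in> tuples S (length Xs)"
proof (induction Xs arbitrary: xs)
  case (Cons Y Xs)
  obtain z zs where "xs = z # zs" "z \<in> Y" "zs \<in> listset Xs" using Cons.prems(1) by (auto simp: set_Cons_def)
  then show ?case using Cons.IH[of zs] Cons.prems(2) by (auto simp: tuples_def)
qed (simp add: tuples_def)

lemma op_mod_cong:
  assumes "\<And>xs. xs \<in> tuples S (length Xs) \<Longrightarrow> t xs = t' xs" "\<forall>Y\<in>set Xs. Y \<subseteq> S"
  shows "op_mod \<theta> t Xs = op_mod \<theta> t' Xs"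
  unfolding op_mod_def using listset_tuples[OF _ assms(2)] assms(1) by (intro SUP_cong) auto

lemma Sg_subalgebra:
  assumes "closed_under B S" "S \<subseteq> univ B" "a \<in> S" "b \<in> S"
  shows "Sg (B\<lparr>univ := S\<rparr>) a b = Sg B a b"
proof -
  have "\<Inter>{T. T \<subseteq> S \<and> closed_under B T \<and> a \<in> T \<and> b \<in> T} =
      \<Inter>{T. T \<subseteq> univ B \<and> closed_under B T \<and> a \<in> T \<and> b \<in> T}" (is "?L = ?R")
  proof
    show "?L \<subseteq> ?R"
    proof
      fix x assume x: "x \<in> ?L"
      have "x \<in> T" if "T \<subseteq> univ B" "closed_under B T" "a \<in> T" "b \<in> T" for T
      proof -
        have "closed_under B (T \<inter> S)" using that(2) assms(1) by (auto simp: closed_under_def tuples_def)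
        then have "x \<in> T \<inter> S" using x that assms by blast
        then show ?thesis by blast
      qed
      then show "x \<in> ?R" by blast
    qed
  qed (use assms(2) in blast)
  then show ?thesis by (simp add: Sg_def)
qed

lemma univ_Sg_subset:
  assumes "closed_under B S" "S \<subseteq> univ B" "a \<in> S" "b \<in> S"
  shows "univ (Sg B a b) \<subseteq> S"
  using assms by (auto simp: Sg_def)

text \<open>The generated subalgebra, and with it the congruence, is the same in both algebras. Its
  blocks lie in \<open>S\<close>, where the extended term operation agrees with the given
  one.\<close>

lemma is_edge_mono:
  fixes B :: "('f, 'a) ualg"
  assumes S: "closed_under B S" "S \<subseteq> univ B" and e: "is_edge (B\<lparr>univ := S\<rparr>) a b"
  shows "is_edge B a b"
proof -
  let ?B = "B\<lparr>univ := S\<rparr>"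
  have ab: "a \<in> S" "b \<in> S" using e by (auto simp: is_edge_def)
  have Sg: "Sg ?B a b = Sg B a b" by (rule Sg_subalgebra[OF S ab])
  obtain \<theta> where \<theta>: "congruence (Sg B a b) \<theta>" "\<theta> `` {a} \<noteq> \<theta> `` {b}"
    and ops: "(\<exists>t\<in>term_ops ?B 2. semilattice_on (op_mod \<theta> t) (\<theta> `` {a}) (\<theta> `` {b})) \<or>
         (\<exists>t\<in>term_ops ?B 3. majority_on (op_mod \<theta> t) {\<theta> `` {a}, \<theta> `` {b}}) \<or>
         (\<exists>t\<in>term_ops ?B 3. affine_on (op_mod \<theta> t) (univ (Sg B a b) // \<theta>))"
    using e unfolding is_edge_def Sg by blast
  have sub: "\<theta> \<subseteq> S \<times> S"
    using \<theta>(1) univ_Sg_subset[OF S ab] unfolding congruence_def equiv_def by blast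
  then have blkS: "\<theta> `` {x} \<subseteq> S" for x by blast
  have ext: "\<exists>t\<in>term_ops B n. \<forall>Xs. length Xs = n \<longrightarrow> (\<forall>Y\<in>set Xs. Y \<subseteq> S) \<longrightarrow> op_mod \<theta> t Xs = op_mod \<theta> t' Xs"
    if t': "t' \<in> term_ops ?B n" for t' n
  proof -
    obtain t where t: "t \<in> term_ops B n" "\<forall>xs\<in>tuples S n. t xs = t' xs"
      using term_ops_extend[OF t' S(2)] by blast
    have "op_mod \<theta> t Xs = op_mod \<theta> t' Xs" if "length Xs = n" "\<forall>Y\<in>set Xs. Y \<subseteq> S" for Xs
      by (rule op_mod_cong[OF _ that(2)]) (use t(2) that(1) in simp)
    then show ?thesis using t(1) by blast
  qed
  have "(\<exists>t\<in>term_ops B 2. semilattice_on (op_mod \<theta> t) (\<theta> `` {a}) (\<theta> `` {b})) \<or>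
         (\<exists>t\<in>term_ops B 3. majority_on (op_mod \<theta> t) {\<theta> `` {a}, \<theta> `` {b}}) \<or>
         (\<exists>t\<in>term_ops B 3. affine_on (op_mod \<theta> t) (univ (Sg B a b) // \<theta>))"
    using ops
  proof (elim disjE bexE)
    fix t' assume t': "t' \<in> term_ops ?B 2" "semilattice_on (op_mod \<theta> t') (\<theta> `` {a}) (\<theta> `` {b})"
    obtain t where t: "t \<in> term_ops B 2"
      "\<And>Xs. length Xs = 2 \<Longrightarrow> \<forall>Y\<in>set Xs. Y \<subseteq> S \<Longrightarrow> op_mod \<theta> t Xs = op_mod \<theta> t' Xs"
      using ext[OF t'(1)] by blast
    have "op_mod \<theta> t [\<theta> `` {x}, \<theta> `` {y}] = op_mod \<theta> t' [\<theta> `` {x}, \<theta> `` {y}]" for x y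
      using blkS by (intro t(2)) auto
    then have "semilattice_on (op_mod \<theta> t) (\<theta> `` {a}) (\<theta> `` {b})"
      using t'(2) unfolding semilattice_on_def by metis
    then show ?thesis using t(1) by blast
  next
    fix t' assume t': "t' \<in> term_ops ?B 3" "majority_on (op_mod \<theta> t') {\<theta> `` {a}, \<theta> `` {b}}"
    obtain t where t: "t \<in> term_ops B 3"
      "\<And>Xs. length Xs = 3 \<Longrightarrow> \<forall>Y\<in>set Xs. Y \<subseteq> S \<Longrightarrow> op_mod \<theta> t Xs = op_mod \<theta> t' Xs"
      using ext[OF t'(1)] by blast
    have "op_mod \<theta> t [x, y, z] = op_mod \<theta> t' [x, y, z]"
      if "x \<in> {\<theta> `` {a}, \<theta> `` {b}}" "y \<in> {\<theta> `` {a}, \<theta> `` {b}}" "z \<in> {\<theta> `` {a}, \<theta> `` {b}}" for x y z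
      using blkS that by (intro t(2)) auto
    then have "majority_on (op_mod \<theta> t) {\<theta> `` {a}, \<theta> `` {b}}"
      using t'(2) unfolding majority_on_def by simp
    then show ?thesis using t(1) by blast
  next
    fix t' assume t': "t' \<in> term_ops ?B 3" "affine_on (op_mod \<theta> t') (univ (Sg B a b) // \<theta>)"
    obtain t where t: "t \<in> term_ops B 3"
      "\<And>Xs. length Xs = 3 \<Longrightarrow> \<forall>Y\<in>set Xs. Y \<subseteq> S \<Longrightarrow> op_mod \<theta> t Xs = op_mod \<theta> t' Xs"
      using ext[OF t'(1)] by blast
    have "Y \<subseteq> S" if "Y \<in> univ (Sg B a b) // \<theta>" for Y using that blkS by (auto simp: quotient_def)
    then have eq: "op_mod \<theta> t [x, y, z] = op_mod \<theta> t' [x, y, z]"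
      if "x \<in> univ (Sg B a b) // \<theta>" "y \<in> univ (Sg B a b) // \<theta>" "z \<in> univ (Sg B a b) // \<theta>" for x y z
      using that by (intro t(2)) auto
    obtain G :: "'a set monoid" where "comm_group G" "carrier G = univ (Sg B a b) // \<theta>"
      "\<forall>x\<in>univ (Sg B a b) // \<theta>. \<forall>y\<in>univ (Sg B a b) // \<theta>. \<forall>z\<in>univ (Sg B a b) // \<theta>.
        op_mod \<theta> t' [x, y, z] = x \<otimes>\<^bsub>G\<^esub> inv\<^bsub>G\<^esub> y \<otimes>\<^bsub>G\<^esub> z"
      using t'(2) unfolding affine_on_def by blast
    then have "affine_on (op_mod \<theta> t) (univ (Sg B a b) // \<theta>)"
      unfolding affine_on_def by (intro exI[of _ G]) (simp add: eq)
    then show ?thesis using t(1) by blast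
  qed
  then show ?thesis using \<theta> ab S(2) unfolding is_edge_def by blast
qed

section \<open>Connectedness\<close>

definition edges :: "('f, 'a) ualg \<Rightarrow> ('a \<times> 'a) set" where
  "edges B = {(a, b). is_edge B a b}\<^sup>s"

lemma max_congruence:
  assumes "finite (univ B)" "is_algebra B" "x \<in> univ B" "y \<in> univ B" "x \<noteq> y"
  obtains \<alpha> where "prime_quotient B \<alpha> (univ B \<times> univ B)"
proof -
  let ?X = "univ B"
  let ?C = "{\<theta>. congruence B \<theta> \<and> \<theta> \<noteq> ?X \<times> ?X}"
  have sub: "\<theta> \<subseteq> ?X \<times> ?X" if "congruence B \<theta>" for \<theta> using that by (auto simp: congruence_def equiv_def)
  then have "?C \<subseteq> Pow (?X \<times> ?X)" by blast
  then have fin: "finite ?C" using assms(1) by (meson finite_Pow_iff finite_SigmaI finite_subset)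
  have cl: "closed_under B ?X" using assms(2) by (simp add: is_algebra_def)
  have "congruence B (Id_on ?X)"
    by (rule congruenceI_pol[OF assms(2)])
      (auto simp: equiv_def refl_on_def sym_def trans_def intro: Pol1_closed[OF _ assms(2)])
  moreover have "Id_on ?X \<noteq> ?X \<times> ?X" using assms(3-5) by auto
  ultimately have "Id_on ?X \<in> ?C" by blast
  then obtain \<alpha> where \<alpha>: "\<alpha> \<in> ?C" "\<And>\<theta>. \<theta> \<in> ?C \<Longrightarrow> \<alpha> \<subseteq> \<theta> \<Longrightarrow> \<alpha> = \<theta>"
    using finite_has_maximal[OF fin] by (metis (no_types, lifting) empty_iff)
  have "congruence B (?X \<times> ?X)" unfolding congruence_def
    using cl by (auto simp: equiv_def refl_on_def sym_def trans_def closed_under_def)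
  then have "prime_quotient B \<alpha> (?X \<times> ?X)"
    unfolding prime_quotient_def using \<alpha> sub by blast
  then show ?thesis by (rule that)
qed

lemma subalgebra_connected:
  fixes A :: "('f, 'a) ualg"
  assumes A: "is_algebra A" "finite (univ A)" "idempotent_algebra A" "omits_type_1 A"
    and "subalgebra B A" "x \<in> univ B" "y \<in> univ B"
  shows "(x, y) \<in> (edges B)\<^sup>*"
  using assms(5-)
proof (induction "card (univ B)" arbitrary: B x y rule: less_induct)
  case less
  obtain S where S: "S \<subseteq> univ A" "S \<noteq> {}" "closed_under A S" and B: "B = A\<lparr>univ := S\<rparr>"
    using less.prems(1) unfolding subalgebra_def by blast
  let ?X = "univ B"
  have X: "?X = S" by (simp add: B)
  have alg: "is_algebra B" using S by (simp add: is_algebra_def B)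
  have fin: "finite ?X" using finite_subset[OF S(1) A(2)] by (simp add: B)
  have idem: "idempotent_algebra B" using A(3) S(1) by (auto simp: idempotent_algebra_def B)
  define C0 where "C0 = {(x, y). x \<in> ?X \<and> y \<in> ?X \<and> (x, y) \<in> (edges B)\<^sup>*}"
  have "sym ((edges B)\<^sup>*)" by (rule sym_rtrancl) (auto simp: edges_def symcl_def sym_def)
  then have C0_sym: "(y, x) \<in> C0" if "(x, y) \<in> C0" for x y using that by (auto simp: C0_def dest: symD)
  have C0_trans: "(x, z) \<in> C0" if "(x, y) \<in> C0" "(y, z) \<in> C0" for x y z
    using that by (auto simp: C0_def intro: rtrancl_trans)
  have C0_refl: "(x, x) \<in> C0" if "x \<in> ?X" for x using that by (simp add: C0_def)
  have C0_edge: "(x, y) \<in> C0" if "is_edge B x y" for x y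
  proof -
    have "x \<in> ?X" "y \<in> ?X" using that unfolding is_edge_def by blast+
    moreover have "(x, y) \<in> edges B" using that by (simp add: edges_def symcl_def)
    ultimately show ?thesis by (auto simp: C0_def)
  qed
  \<comment> \<open>A proper subuniverse is connected by the induction hypothesis, and its edges
    remain edges of \<open>B\<close>.\<close>
  have sub: "T \<times> T \<subseteq> C0" if T: "T \<subset> ?X" "closed_under B T" for T
  proof
    fix z assume "z \<in> T \<times> T"
    then obtain u v where uv: "z = (u, v)" "u \<in> T" "v \<in> T" by auto
    let ?B = "B\<lparr>univ := T\<rparr>"
    have "card (univ ?B) < card ?X" using psubset_card_mono[OF fin T(1)] by simp
    moreover have "subalgebra ?B A"
      unfolding subalgebra_def using T S(1) uv(2) by (intro exI[of _ T]) (auto simp: B)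
    ultimately have "(u, v) \<in> (edges ?B)\<^sup>*" using less.hyps uv by simp
    moreover have "edges ?B \<subseteq> edges B"
      using is_edge_mono[OF T(2)] T(1) by (auto simp: edges_def symcl_def)
    ultimately have "(u, v) \<in> (edges B)\<^sup>*" using rtrancl_mono by blast
    then show "z \<in> C0" using uv T(1) by (auto simp: C0_def)
  qed
  show ?case
  proof (rule ccontr)
    assume neg: "(x, y) \<notin> (edges B)\<^sup>*"
    then have "x \<noteq> y" by auto
    then obtain \<alpha> where pq: "prime_quotient B \<alpha> (?X \<times> ?X)"
      using max_congruence[OF fin alg less.prems(2,3)] by blast
    then have cong: "congruence B \<alpha>" and ne: "\<alpha> \<noteq> ?X \<times> ?X" by (auto simp: prime_quotient_def)
    interpret M: max_factor B \<alpha> by unfold_locales (fact alg cong pq fin)+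
    have "\<not> has_type_1 B \<alpha> (?X \<times> ?X)" using A(4) less.prems(1) pq unfolding omits_type_1_def by blast
    then obtain e U where mU: "minset M.Q e U" and non: "nonunary_on M.Q e U"
      using M.nonunary_minset[OF idem] by blast
    \<comment> \<open>By idempotence a block is a subuniverse, and it is proper because \<alpha> is
      not full.\<close>
    have \<alpha>C0: "(u, v) \<in> C0" if uv: "(u, v) \<in> \<alpha>" for u v
    proof -
      have uvX: "u \<in> ?X" "v \<in> ?X" using M.\<alpha>D[OF uv] by auto
      let ?T = "{w \<in> ?X. M.blk w \<in> {M.blk u}}"
      have "closed_under M.Q {M.blk u}"
        by (rule closed_under_singleton[OF M.Q_idem[OF idem]]) (use uvX in \<open>simp add: M.Q_simps\<close>)
      then have cl: "closed_under B ?T" by (rule M.closed_preimage)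
      have "?T \<noteq> ?X"
      proof
        assume "?T = ?X"
        then have all: "M.blk w = M.blk u" if "w \<in> ?X" for w using that by blast
        have "(w, w') \<in> \<alpha>" if "w \<in> ?X" "w' \<in> ?X" for w w'
          using M.blk_eq[OF that] all that by simp
        then have "?X \<times> ?X \<subseteq> \<alpha>" by blast
        moreover have "\<alpha> \<subseteq> ?X \<times> ?X" using M.\<alpha>D by auto
        ultimately show False using ne by blast
      qed
      then have "?T \<times> ?T \<subseteq> C0" using sub[OF _ cl] by blast
      moreover have "M.blk v = M.blk u" using M.blk_eq[OF uvX] uv by simp
      ultimately show ?thesis using uvX by blast
    qed
    define C where "C = {(M.blk u, M.blk v) | u v. (u, v) \<in> C0}"
    have C_iff: "(M.blk u, M.blk v) \<in> C \<longleftrightarrow> (u, v) \<in> C0" if uv: "u \<in> ?X" "v \<in> ?X" for u v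
    proof
      assume "(M.blk u, M.blk v) \<in> C"
      then obtain u' v' where u': "M.blk u = M.blk u'" "M.blk v = M.blk v'" "(u', v') \<in> C0" by (auto simp: C_def)
      then have "u' \<in> ?X" "v' \<in> ?X" by (auto simp: C0_def)
      then have "(u, u') \<in> \<alpha>" "(v', v) \<in> \<alpha>" using M.blk_eq uv u' M.\<alpha>_sym by auto
      then show "(u, v) \<in> C0" using \<alpha>C0 C0_trans u'(3) by blast
    qed (auto simp: C_def)
    have dis: "disconnected_alg M.Q C"
    proof
      show "is_algebra M.Q" by (rule M.Q_alg)
      show "finite (univ M.Q)" by (rule M.Q_fin[OF fin])
      show "idempotent_algebra M.Q" by (rule M.Q_idem[OF idem])
      show "simple_alg M.Q" by (rule M.Q_simple[OF pq])
      show "equiv (univ M.Q) C"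
      proof (rule equivI)
        show "C \<subseteq> univ M.Q \<times> univ M.Q" by (auto simp: C_def C0_def M.Q_simps)
        show "refl_on (univ M.Q) C" using C_iff C0_refl by (auto simp: M.Q_simps refl_on_def)
        show "sym C" using C0_sym unfolding C_def sym_def by blast
        show "trans C"
        proof (rule transI)
          fix a b c assume "(a, b) \<in> C" "(b, c) \<in> C"
          then obtain u v w where "a = M.blk u" "b = M.blk v" "c = M.blk w" "(u, v) \<in> C0" "v \<in> ?X" "w \<in> ?X" "u \<in> ?X"
            by (auto simp: C_def C0_def)
          then show "(a, c) \<in> C" using C_iff C0_trans \<open>(b, c) \<in> C\<close> by blast
        qed
      qed
      have "(M.blk x, M.blk y) \<notin> C" using C_iff[OF less.prems(2,3)] neg by (simp add: C0_def)
      then show "\<exists>x\<in>univ M.Q. \<exists>y\<in>univ M.Q. (x, y) \<notin> C" using less.prems by (auto simp: M.Q_simps)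
      show "T \<times> T \<subseteq> C" if T: "T \<subset> univ M.Q" "closed_under M.Q T" for T
      proof -
        let ?T = "{u \<in> ?X. M.blk u \<in> T}"
        have TQ: "T \<subseteq> M.blk ` ?X" using T(1) by (auto simp: M.Q_simps)
        have "?T \<subset> ?X" using T(1) by (auto simp: M.Q_simps)
        then have "?T \<times> ?T \<subseteq> C0" by (rule sub[OF _ M.closed_preimage[OF T(2)]])
        then show ?thesis using TQ C_iff by blast
      qed
    qed
    obtain a b where ab: "a \<in> univ M.Q" "b \<in> univ M.Q" "(a, b) \<notin> C" and
      ops: "semilattice_pair M.Q a b \<or> majority_pair M.Q a b \<or> affine_alg M.Q"
      using simple_edge[OF dis mU non] by (elim bexE conjE) (rule that)
    obtain u v where uv: "u \<in> ?X" "v \<in> ?X" "a = M.blk u" "b = M.blk v" using ab by (auto simp: M.Q_simps)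
    have nC0: "(u, v) \<notin> C0" using C_iff uv ab(3) by blast
    \<comment> \<open>A proper subuniverse containing both would lie in one component. In particular
      an affine operation on \<open>Q\<close> lives on the factor of the generated subalgebra, as an
      edge demands.\<close>
    have Sg: "Sg B u v = B"
    proof -
      have "T = ?X" if "T \<subseteq> ?X" "closed_under B T" "u \<in> T" "v \<in> T" for T
        using sub[of T] that nC0 by blast
      moreover have "closed_under B ?X" using alg by (simp add: is_algebra_def)
      ultimately have "{T. T \<subseteq> ?X \<and> closed_under B T \<and> u \<in> T \<and> v \<in> T} = {?X}" using uv by blast
      then show ?thesis by (simp add: Sg_def)
    qed
    have op3: "\<exists>t\<in>term_ops B 3. \<forall>x\<in>univ M.Q. \<forall>y\<in>univ M.Q. \<forall>z\<in>univ M.Q. op_mod \<alpha> t [x, y, z] = F (v3 x y z)"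
      if F: "F \<in> Tm M.Q" for F
    proof -
      obtain t where t: "t \<in> term_ops B 3"
        "\<And>ys. ys \<in> tuples (univ M.Q) 3 \<Longrightarrow> op_mod \<alpha> t ys = F (\<lambda>i. ys ! min i (3 - 1))"
        using M.Tm_op_mod[OF F, of 3] by auto
      have "op_mod \<alpha> t [p, q, r] = F (v3 p q r)" if "p \<in> univ M.Q" "q \<in> univ M.Q" "r \<in> univ M.Q" for p q r
        using t(2)[of "[p, q, r]"] that unfolding nth_v3 by (simp add: tuples_def)
      then show ?thesis using t(1) by blast
    qed
    have op2: "\<exists>t\<in>term_ops B 2. \<forall>x\<in>univ M.Q. \<forall>y\<in>univ M.Q. op_mod \<alpha> t [x, y] = F (v3 x y y)"
      if F: "F \<in> Tm M.Q" for F
    proof -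
      obtain t where t: "t \<in> term_ops B 2"
        "\<And>ys. ys \<in> tuples (univ M.Q) 2 \<Longrightarrow> op_mod \<alpha> t ys = F (\<lambda>i. ys ! min i (2 - 1))"
        using M.Tm_op_mod[OF F, of 2] by auto
      have "op_mod \<alpha> t [p, q] = F (v3 p q q)" if "p \<in> univ M.Q" "q \<in> univ M.Q" for p q
        using t(2)[of "[p, q]"] that unfolding nth_v3 by (simp add: tuples_def)
      then show ?thesis using t(1) by blast
    qed
    have "(\<exists>t\<in>term_ops B 2. semilattice_on (op_mod \<alpha> t) a b) \<or>
         (\<exists>t\<in>term_ops B 3. majority_on (op_mod \<alpha> t) {a, b}) \<or>
         (\<exists>t\<in>term_ops B 3. affine_on (op_mod \<alpha> t) (?X // \<alpha>))"
      using ops unfolding semilattice_pair_def majority_pair_def affine_alg_def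
    proof (elim disjE bexE)
      fix F assume F: "F \<in> Tm M.Q" "F (v3 a b b) = F (v3 b a a) \<and> F (v3 a b b) \<in> {a, b}"
      then obtain t where "t \<in> term_ops B 2" "\<forall>x\<in>univ M.Q. \<forall>y\<in>univ M.Q. op_mod \<alpha> t [x, y] = F (v3 x y y)"
        using op2 by blast
      then show ?thesis using F(2) ab by (intro disjI1 bexI[of _ t]) (auto simp: semilattice_on_def)
    next
      fix F assume F: "F \<in> Tm M.Q" "\<forall>x\<in>{a, b}. \<forall>y\<in>{a, b}. F (v3 x x y) = x \<and> F (v3 x y x) = x \<and> F (v3 y x x) = x"
      obtain t where t: "t \<in> term_ops B 3"
        "\<forall>x\<in>univ M.Q. \<forall>y\<in>univ M.Q. \<forall>z\<in>univ M.Q. op_mod \<alpha> t [x, y, z] = F (v3 x y z)"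
        using op3[OF F(1)] by blast
      have "op_mod \<alpha> t [p, q, r] = F (v3 p q r)" if "p \<in> {a, b}" "q \<in> {a, b}" "r \<in> {a, b}" for p q r
        using t(2) ab that by blast
      then have "majority_on (op_mod \<alpha> t) {a, b}" using F(2) unfolding majority_on_def by simp
      then show ?thesis using t(1) by blast
    next
      fix F assume F: "F \<in> Tm M.Q" "\<exists>G :: 'a set monoid. comm_group G \<and> carrier G = univ M.Q \<and>
       (\<forall>x\<in>univ M.Q. \<forall>y\<in>univ M.Q. \<forall>z\<in>univ M.Q. F (v3 x y z) = x \<otimes>\<^bsub>G\<^esub> inv\<^bsub>G\<^esub> y \<otimes>\<^bsub>G\<^esub> z)"
      obtain t where t: "t \<in> term_ops B 3"
        "\<forall>x\<in>univ M.Q. \<forall>y\<in>univ M.Q. \<forall>z\<in>univ M.Q. op_mod \<alpha> t [x, y, z] = F (v3 x y z)"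
        using op3[OF F(1)] by blast
      have "?X // \<alpha> = univ M.Q" by (simp add: factor_alg_def)
      moreover obtain G :: "'a set monoid" where "comm_group G" "carrier G = univ M.Q"
        "\<forall>x\<in>univ M.Q. \<forall>y\<in>univ M.Q. \<forall>z\<in>univ M.Q. F (v3 x y z) = x \<otimes>\<^bsub>G\<^esub> inv\<^bsub>G\<^esub> y \<otimes>\<^bsub>G\<^esub> z"
        using F(2) by blast
      ultimately have "affine_on (op_mod \<alpha> t) (?X // \<alpha>)"
        unfolding affine_on_def using t(2) by (intro exI[of _ G]) simp
      then show ?thesis using t(1) by blast
    qed
    moreover have "a \<noteq> b" using ab nC0 C0_refl uv C_iff by metis
    ultimately have "is_edge B u v"
      unfolding is_edge_def Sg using cong uv by blast
    then show False using C0_edge nC0 by blast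
  qed
qed

theorem theorem1:
  fixes A :: "('f, 'a) ualg"
  assumes "is_algebra A"
    and "finite (univ A)"
    and "idempotent_algebra A"
    and "omits_type_1 A"
  shows "\<forall>B. subalgebra B A \<longrightarrow> Digraph_Component.connected (with_proj (graph_of B))"
proof (intro allI impI)
  fix B assume B: "subalgebra B A"
  let ?G = "with_proj (graph_of B)"
  have verts: "verts ?G = univ B" by (simp add: graph_of_def)
  have arcs: "(arcs_ends ?G)\<^sup>s = edges B" by (simp add: edges_def graph_of_def)
  \<comment> \<open>Connectedness refers to walks inside the vertex set; no edge leaves it, so the
    ordinary closure suffices.\<close>
  have sub: "edges B \<subseteq> univ B \<times> univ B" by (auto simp: edges_def symcl_def is_edge_def)
  have "(u, v) \<in> rtrancl_on (univ B) (edges B)" if "u \<in> univ B" "v \<in> univ B" for u v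
    using subalgebra_connected[OF assms B that]
  proof induction
    case base
    then show ?case using that(1) by (rule rtrancl_on_refl)
  next
    case (step y z)
    then show ?case using sub by (auto intro: rtrancl_on_into_rtrancl_on)
  qed
  moreover have "univ B \<noteq> {}" using B by (auto simp: subalgebra_def)
  ultimately show "Digraph_Component.connected ?G"
    unfolding connected_conv verts arcs by blast
qed

end
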